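(* Let $k\ge 1$ be an integer, let $\Sigma$ be a finite alphabet, and let $\Gamma\subseteq\mathcal{P}(\Sigma^k)$ be convex. For $d\geq 1$ let $\Gamma^{\otimes d}$ be its $d$-axial-product semiconstrained system. Then $$\limsup_{d\to\infty}\mathsf{cap}(\Gamma^{\otimes d})=h_{\mathrm{ind}}(\Gamma),$$ where $\mathsf{cap}$ denotes the capacity and $h_{\mathrm{ind}}$ the independence entropy.
   Context: Notation: $\Sigma$ is a finite alphabet; $[n]=\{0,1,\dots,n-1\}$; $F_n^d=[n]^d\subset\mathbb{Z}^d$; $\mathbf{e}_i$ ($i\in[d]$) is the $i$-th unit vector; $[k]\mathbf{e}_i=\{0,\mathbf{e}_i,\dots,(k-1)\mathbf{e}_i\}$; $\Sigma^k=\Sigma^{[k]}$. $\mathcal{P}(X)$ is the set of probability measures on $X$. For $S\subseteq\tilde S$ and $\mu\in\mathcal{P}(\Sigma^{\tilde S})$, $\pi_S(\mu)\in\mathcal{P}(\Sigma^S)$ is the $S$-marginal. Marginals on $[k]\mathbf{e}_i$, and on translates $S+\mathbf{v}$, are identified with measures on $\Sigma^k$, respectively $\Sigma^S$, in the obvious way. The total variation distance is $\|\mu-\nu\|_{TV}=\sup_W|\mu(W)-\nu(W)|$. A ($\mathbb{Z}^d$-)semiconstrained system (SCS) is a set $\Gamma\subseteq\mathcal{P}(\Sigma^S)$ for a finite $S\subseteq\mathbb{Z}^d$. For $\epsilon>0$, $\mathbb{B}_\epsilon(\Gamma)=\{\mu\in\mathcal{P}(\Sigma^S): \inf_{\nu\in\Gamma}\|\mu-\nu\|_{TV}\le\epsilon\}$.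 Empirical distribution: for $w\in\Sigma^{F_n^d}$ let $\hat w\in\Sigma^{\mathbb{Z}^d}$, $\hat w_{\mathbf v}=w_{\mathbf v \bmod n}$ (entrywise), and let $\mathrm{fr}^S_w\in\mathcal{P}(\Sigma^S)$ be the law of $(\hat w_{\mathbf v+\mathbf s})_{\mathbf s\in S}$ for $\mathbf v$ uniform in $F_n^d$. Admissible blocks: $\mathcal{B}_n(\Gamma)=\{w\in\Sigma^{F_n^d}:\mathrm{fr}^S_w\in\Gamma\}$. Capacity: $\mathsf{cap}(\Gamma)=\lim_{\epsilon\to0^+}\limsup_{n\to\infty}\frac1{n^d}\log_2|\mathcal{B}_n(\mathbb{B}_\epsilon(\Gamma))|$. Independence entropy, for $\Gamma\subseteq\mathcal{P}(\Sigma^S)$ with $S\subseteq F_k^d$: for $n\ge k$ and $\mu\in\mathcal{P}(\Sigma^{F_n^d})$ let $\overline{\pi}_S(\mu)=\frac1{n^d}\sum_{\mathbf v\in F_n^d}\pi_{S+\mathbf v}(\mu)$, coordinates of $S+\mathbf v$ being taken modulo $n$. Let $\overline{\mathcal{P}}_n(\Gamma)$ be the set of product measures $\mu=\prod_{\mathbf v\in F_n^d}p_{\mathbf v}$, $p_{\mathbf v}\in\mathcal{P}(\Sigma)$, on $\Sigma^{F_n^d}$ with $\overline{\pi}_S(\mu)\in\Gamma$. With $H(\mu)=-\sum_w\mu(w)\log_2\mu(w)$, set $\widehat{h_{\mathrm{ind}}}(\Gamma)=\limsup_{n\to\infty}\sup_{\mu\in\overline{\mathcal{P}}_n(\Gamma)}\frac1{n^d}H(\mu)$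 and $h_{\mathrm{ind}}(\Gamma)=\lim_{\epsilon\to0^+}\widehat{h_{\mathrm{ind}}}(\mathbb{B}_\epsilon(\Gamma))$. Axial product: for a one-dimensional SCS $\Gamma\subseteq\mathcal{P}(\Sigma^k)$ let $S=\bigcup_{i\in[d]}[k]\mathbf{e}_i$ and $\Gamma^{\otimes d}=\{\mu\in\mathcal{P}(\Sigma^S):\ \pi_{[k]\mathbf{e}_i}(\mu)\in\Gamma\text{ for all }i\in[d]\}$. Conventions: $\log_2 0=-\infty$ and $\sup\emptyset=-\infty$. *)

theory Defs
  imports "HOL-Probability.Probability"
begin

text \<open>A point of \<open>\<int>\<^sup>d\<close> is a function on \<open>nat\<close> whose coordinates with index \<open>\<ge> d\<close> are all zero, so that
  points of all dimensions live in one type and \<open>d\<close> can vary inside a statement.\<close>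

type_synonym site = "nat \<Rightarrow> int"

definition lattice :: "nat \<Rightarrow> site set" where
  "lattice d = {v. \<forall>i\<ge>d. v i = 0}"

definition box :: "nat \<Rightarrow> nat \<Rightarrow> site set" where
  "box n d = {v \<in> lattice d. \<forall>i<d. 0 \<le> v i \<and> v i < int n}"

definition site_add :: "site \<Rightarrow> site \<Rightarrow> site" where
  "site_add v s = (\<lambda>i. v i + s i)"

definition site_mod :: "nat \<Rightarrow> site \<Rightarrow> site" where
  "site_mod n v = (\<lambda>i. v i mod int n)"

definition axis_point :: "nat \<Rightarrow> nat \<Rightarrow> site" where
  "axis_point i j = (\<lambda>l. if l = i then int j else 0)"

definition segment :: "nat \<Rightarrow> nat \<Rightarrow> site set" where
  "segment k i = axis_point i ` {..<k}"

text \<open>Elements of \<open>\<Sigma>\<^sup>S\<close> are extensional functions on \<open>S\<close>; the alphabet \<open>\<Sigma>\<close> is a finite type. The space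
  \<open>\<Sigma>\<^sup>k\<close> is \<open>configs {..<k}\<close>.\<close>

definition configs :: "'i set \<Rightarrow> ('i \<Rightarrow> 'a) set" where
  "configs S = S \<rightarrow>\<^sub>E UNIV"

definition probs :: "'i set \<Rightarrow> ('i \<Rightarrow> 'a) pmf set" where
  "probs S = {\<mu>. set_pmf \<mu> \<subseteq> configs S}"

definition tv_dist :: "'b pmf \<Rightarrow> 'b pmf \<Rightarrow> real" where
  "tv_dist \<mu> \<nu> = (SUP W. \<bar>measure_pmf.prob \<mu> W - measure_pmf.prob \<nu> W\<bar>)"

definition convex_pmfs :: "'b pmf set \<Rightarrow> bool" where
  "convex_pmfs \<Gamma> \<longleftrightarrow> (\<forall>\<mu>\<in>\<Gamma>. \<forall>\<nu>\<in>\<Gamma>. \<forall>t\<in>{0..1}.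
     bind_pmf (bernoulli_pmf t) (\<lambda>b. if b then \<mu> else \<nu>) \<in> \<Gamma>)"

text \<open>The infimum is taken in \<open>ereal\<close>, so that it is \<open>\<infinity>\<close> for empty \<open>\<Gamma>\<close>, whose enlargement is then empty.\<close>

definition enlarge :: "'i set \<Rightarrow> real \<Rightarrow> ('i \<Rightarrow> 'a) pmf set \<Rightarrow> ('i \<Rightarrow> 'a) pmf set" where
  "enlarge S \<epsilon> \<Gamma> = {\<mu> \<in> probs S. (INF \<nu>\<in>\<Gamma>. ereal (tv_dist \<mu> \<nu>)) \<le> ereal \<epsilon>}"

text \<open>\<open>window n S w v\<close> is the pattern of shape \<open>S\<close> that the \<open>n\<close>-periodic extension of \<open>w\<close> shows at \<open>v\<close>.\<close>

definition window :: "nat \<Rightarrow> site set \<Rightarrow> (site \<Rightarrow> 'a) \<Rightarrow> site \<Rightarrow> (site \<Rightarrow> 'a)" where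
  "window n S w v = restrict (\<lambda>s. w (site_mod n (site_add v s))) S"

definition empirical :: "nat \<Rightarrow> nat \<Rightarrow> site set \<Rightarrow> (site \<Rightarrow> 'a) \<Rightarrow> (site \<Rightarrow> 'a) pmf" where
  "empirical n d S w = map_pmf (window n S w) (pmf_of_set (box n d))"

definition admissible :: "nat \<Rightarrow> nat \<Rightarrow> site set \<Rightarrow> (site \<Rightarrow> 'a) pmf set \<Rightarrow> (site \<Rightarrow> 'a) set" where
  "admissible n d S \<Gamma> = {w \<in> configs (box n d). empirical n d S w \<in> \<Gamma>}"

definition log2_card :: "'b set \<Rightarrow> ereal" where
  "log2_card A = (if card A = 0 then -\<infinity> else ereal (log 2 (real (card A))))"

text \<open>Both limits as \<open>\<epsilon> \<rightarrow> 0+\<close> below exist, since the expressions are monotone in \<open>\<epsilon>\<close>.\<close>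

definition capacity :: "nat \<Rightarrow> site set \<Rightarrow> (site \<Rightarrow> 'a) pmf set \<Rightarrow> ereal" where
  "capacity d S \<Gamma> = Lim (at_right 0) (\<lambda>\<epsilon>::real.
     limsup (\<lambda>n. log2_card (admissible n d S (enlarge S \<epsilon> \<Gamma>)) / ereal (real n ^ d)))"

definition entropy_pmf :: "'b pmf \<Rightarrow> real" where
  "entropy_pmf \<mu> = - (\<Sum>x\<in>set_pmf \<mu>. pmf \<mu> x * log 2 (pmf \<mu> x))"

text \<open>The uniform mixture over \<open>v\<close> in the box of the marginals of \<open>\<mu>\<close> on \<open>S + v\<close> (modulo \<open>n\<close>).\<close>

definition avg_marginal :: "nat \<Rightarrow> nat \<Rightarrow> site set \<Rightarrow> (site \<Rightarrow> 'a) pmf \<Rightarrow> (site \<Rightarrow> 'a) pmf" where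
  "avg_marginal n d S \<mu> =
     bind_pmf (pmf_of_set (box n d)) (\<lambda>v. map_pmf (\<lambda>w. window n S w v) \<mu>)"

definition product_measures ::
    "nat \<Rightarrow> nat \<Rightarrow> site set \<Rightarrow> (site \<Rightarrow> 'a) pmf set \<Rightarrow> (site \<Rightarrow> 'a) pmf set" where
  "product_measures n d S \<Gamma> =
     {\<mu>. (\<exists>p. \<mu> = Pi_pmf (box n d) undefined p) \<and> avg_marginal n d S \<mu> \<in> \<Gamma>}"

definition h_ind_hat :: "nat \<Rightarrow> site set \<Rightarrow> (site \<Rightarrow> 'a) pmf set \<Rightarrow> ereal" where
  "h_ind_hat d S \<Gamma> = limsup (\<lambda>n.
     SUP \<mu>\<in>product_measures n d S \<Gamma>. ereal (entropy_pmf \<mu> / real n ^ d))"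

definition h_ind :: "nat \<Rightarrow> site set \<Rightarrow> (site \<Rightarrow> 'a) pmf set \<Rightarrow> ereal" where
  "h_ind d S \<Gamma> = Lim (at_right 0) (\<lambda>\<epsilon>::real. h_ind_hat d S (enlarge S \<epsilon> \<Gamma>))"

definition axis_word :: "nat \<Rightarrow> nat \<Rightarrow> (site \<Rightarrow> 'a) \<Rightarrow> (nat \<Rightarrow> 'a)" where
  "axis_word k i \<omega> = restrict (\<lambda>j. \<omega> (axis_point i j)) {..<k}"

definition axial_shape :: "nat \<Rightarrow> nat \<Rightarrow> site set" where
  "axial_shape k d = (\<Union>i<d. segment k i)"

definition axial_product :: "nat \<Rightarrow> nat \<Rightarrow> (nat \<Rightarrow> 'a) pmf set \<Rightarrow> (site \<Rightarrow> 'a) pmf set" where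
  "axial_product k d \<Gamma> =
     {\<mu> \<in> probs (axial_shape k d). \<forall>i<d. map_pmf (axis_word k i) \<mu> \<in> \<Gamma>}"

text \<open>A subset of \<open>\<P>(\<Sigma>\<^sup>k)\<close> read as a one-dimensional system with shape \<open>[k] \<subseteq> \<int>\<^sup>1\<close>.\<close>

definition line_system :: "nat \<Rightarrow> (nat \<Rightarrow> 'a) pmf set \<Rightarrow> (site \<Rightarrow> 'a) pmf set" where
  "line_system k \<Gamma> = {\<mu> \<in> probs (segment k 0). map_pmf (axis_word k 0) \<mu> \<in> \<Gamma>}"

end

theory Submission
  imports Defs "HOL-Library.Fun_Lexorder"
begin

text \<open>Both inequalities compare the axial products with periodic sequences \<open>q 0, \<dots>, q (M - 1)\<close> of independent
  letters, which are the product measures in the definition of the independence entropy.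

  \<^emph>\<open>The capacity is at least the independence entropy, for every \<open>d \<ge> 1\<close>.\<close> Fill a box of side a multiple of
  \<open>M\<close> with independent letters, the one at \<open>v\<close> drawn from \<open>q\<close> at \<open>(\<Sum>i<d. v i) mod M\<close>. Every
  axis-parallel line then carries the sequence \<open>q\<close>, so the entropy per site is that of \<open>q\<close>
  (\<open>entropy_phase_field\<close>) and all axis marginals of the averaged window equal the averaged marginal of
  \<open>q\<close> (\<open>axis_marginal_phase_field\<close>), which is close to one single \<open>\<nu> \<in> \<Gamma>\<close>. A second moment estimate
  (\<open>prob_atypical_le\<close>) shows that most words have nearly the expected empirical measure, and a set that
  carries most of the measure has about \<open>2 ^ H\<close> elements (\<open>entropy_le_log_card\<close>). It remains to see
  that a measure on the axial shape whose axis marginals are all close to \<open>\<nu>\<close> is close to one whose axis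
  marginals are all equal to \<open>\<nu>\<close>, hence to the axial product (\<open>glue_near\<close>).

  \<^emph>\<open>The capacity is asymptotically at most the independence entropy.\<close> Let \<open>A\<close> be the set of words on
  a box that are admissible for a small enlargement, and draw one of them uniformly. For \<open>l \<le> d\<close> let \<open>F l\<close> be the sum over all sites of the entropy
  of the letter there given the lexicographically earlier letters in the slab through the site spanned by
  the first \<open>l\<close> directions. \<open>F\<close> is decreasing, \<open>F d\<close> is the entropy \<open>log \<bar>A\<bar>\<close> of the word, and \<open>F 0\<close> is
  at most \<open>log \<bar>\<Sigma>\<bar>\<close> per site; so some step \<open>F l - F (l + 1)\<close> is at most \<open>log \<bar>\<Sigma>\<bar> / d\<close> per site. For this
  \<open>l\<close>, condition on the whole lines in direction \<open>l\<close> that precede a given one: the letters on the given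
  line are then nearly independent, while their entropies still add up to at least \<open>log \<bar>A\<bar>\<close>
  (\<open>exists_direction\<close>). By a form of Pinsker's inequality, the conditional laws of the windows on the line
  are close to products (\<open>sum_tv_dist_path_le\<close>). Stringing the conditional letter laws together, line after
  line and word after word, gives one long sequence of independent letters whose averaged marginal is close
  to the average of the empirical axis marginals, and this average is close to \<open>\<Gamma>\<close> by convexity
  (\<open>entropy_of_admissible_le\<close>). The error is of order \<open>d powr (- 1/2)\<close>, up to boundary terms that vanish
  as the box grows.\<close>

section \<open>Total variation\<close>

lemma tv_dist_bdd: "bdd_above (range (\<lambda>W. \<bar>measure_pmf.prob \<mu> W - measure_pmf.prob \<nu> W\<bar>))"
proof (rule bdd_aboveI2)
  fix W
  show "\<bar>measure_pmf.prob \<mu> W - measure_pmf.prob \<nu> W\<bar> \<le> 1"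
    using measure_pmf.prob_le_1[of \<mu> W] measure_pmf.prob_le_1[of \<nu> W]
      measure_nonneg[of \<mu> W] measure_nonneg[of \<nu> W] by linarith
qed

lemma prob_diff_le_tv_dist:
  "\<bar>measure_pmf.prob \<mu> W - measure_pmf.prob \<nu> W\<bar> \<le> tv_dist \<mu> \<nu>"
  unfolding tv_dist_def by (rule cSUP_upper[OF _ tv_dist_bdd]) simp

lemma tv_dist_leI:
  assumes "\<And>W. \<bar>measure_pmf.prob \<mu> W - measure_pmf.prob \<nu> W\<bar> \<le> c"
  shows "tv_dist \<mu> \<nu> \<le> c"
  unfolding tv_dist_def by (rule cSUP_least) (use assms in auto)

lemma tv_dist_nonneg: "0 \<le> tv_dist \<mu> \<nu>"
  using prob_diff_le_tv_dist[of \<mu> "{}" \<nu>] by simp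

lemma tv_dist_le_1: "tv_dist \<mu> \<nu> \<le> 1"
proof (rule tv_dist_leI)
  fix W
  show "\<bar>measure_pmf.prob \<mu> W - measure_pmf.prob \<nu> W\<bar> \<le> 1"
    using measure_pmf.prob_le_1[of \<mu> W] measure_pmf.prob_le_1[of \<nu> W]
      measure_nonneg[of \<mu> W] measure_nonneg[of \<nu> W] by linarith
qed

lemma tv_dist_commute: "tv_dist \<mu> \<nu> = tv_dist \<nu> \<mu>"
  unfolding tv_dist_def by (simp add: abs_minus_commute)

lemma tv_dist_refl [simp]: "tv_dist \<mu> \<mu> = 0"
  using tv_dist_leI[of \<mu> \<mu> 0] tv_dist_nonneg[of \<mu> \<mu>] by simp

lemma tv_dist_triangle: "tv_dist \<mu> \<nu> \<le> tv_dist \<mu> \<rho> + tv_dist \<rho> \<nu>"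
proof (rule tv_dist_leI)
  fix W
  show "\<bar>measure_pmf.prob \<mu> W - measure_pmf.prob \<nu> W\<bar> \<le> tv_dist \<mu> \<rho> + tv_dist \<rho> \<nu>"
    using prob_diff_le_tv_dist[of \<mu> W \<rho>] prob_diff_le_tv_dist[of \<rho> W \<nu>] by linarith
qed

lemma tv_dist_map_pmf_le: "tv_dist (map_pmf f \<mu>) (map_pmf f \<nu>) \<le> tv_dist \<mu> \<nu>"
  by (rule tv_dist_leI) (simp add: prob_diff_le_tv_dist measure_map_pmf)

lemma prob_bind_pmf_of_set:
  assumes "finite A" "A \<noteq> {}"
  shows "measure_pmf.prob (bind_pmf (pmf_of_set A) f) W
       = (\<Sum>x\<in>A. measure_pmf.prob (f x) W) / card A"
  by (simp add: bind_pmf.rep_eq measure_pmf.measure_bind[where N="count_space UNIV"] measure_subprob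
      integral_pmf_of_set assms)

lemma pmf_bind_pmf_of_set:
  assumes "finite A" "A \<noteq> {}"
  shows "pmf (bind_pmf (pmf_of_set A) f) y = (\<Sum>x\<in>A. pmf (f x) y) / card A"
  using assms by (simp add: pmf_bind integral_pmf_of_set)

lemma tv_dist_bind_pmf_of_set_le:
  assumes "finite A" "A \<noteq> {}"
  shows "tv_dist (bind_pmf (pmf_of_set A) f) (bind_pmf (pmf_of_set A) g)
       \<le> (\<Sum>x\<in>A. tv_dist (f x) (g x)) / card A"
proof (rule tv_dist_leI)
  fix W
  have "\<bar>(\<Sum>x\<in>A. measure_pmf.prob (f x) W) - (\<Sum>x\<in>A. measure_pmf.prob (g x) W)\<bar>
      \<le> (\<Sum>x\<in>A. tv_dist (f x) (g x))"
    unfolding sum_subtractf[symmetric]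
    by (rule order_trans[OF sum_abs sum_mono]) (rule prob_diff_le_tv_dist)
  then show "\<bar>measure_pmf.prob (bind_pmf (pmf_of_set A) f) W
      - measure_pmf.prob (bind_pmf (pmf_of_set A) g) W\<bar> \<le> (\<Sum>x\<in>A. tv_dist (f x) (g x)) / card A"
    using assms by (simp add: prob_bind_pmf_of_set diff_divide_distrib[symmetric] divide_right_mono)
qed

lemma prob_eq_sum_pmf:
  assumes "finite X" "set_pmf \<mu> \<subseteq> X"
  shows "measure_pmf.prob \<mu> W = (\<Sum>x\<in>X \<inter> W. pmf \<mu> x)"
proof -
  have "measure_pmf.prob \<mu> W = measure_pmf.prob \<mu> (X \<inter> W)"
    by (rule measure_pmf.finite_measure_eq_AE) (use assms in \<open>auto simp: AE_measure_pmf_iff\<close>)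
  also have "\<dots> = (\<Sum>x\<in>X \<inter> W. pmf \<mu> x)"
    using assms by (simp add: measure_measure_pmf_finite)
  finally show ?thesis .
qed

lemma tv_dist_le_sum:
  assumes "finite X" "set_pmf \<mu> \<subseteq> X" "set_pmf \<nu> \<subseteq> X"
  shows "tv_dist \<mu> \<nu> \<le> (\<Sum>x\<in>X. \<bar>pmf \<mu> x - pmf \<nu> x\<bar>)"
proof (rule tv_dist_leI)
  fix W
  have "\<bar>measure_pmf.prob \<mu> W - measure_pmf.prob \<nu> W\<bar> = \<bar>\<Sum>x\<in>X \<inter> W. pmf \<mu> x - pmf \<nu> x\<bar>"
    using assms by (simp add: prob_eq_sum_pmf[of X] sum_subtractf)
  also have "\<dots> \<le> (\<Sum>x\<in>X \<inter> W. \<bar>pmf \<mu> x - pmf \<nu> x\<bar>)" by (rule sum_abs)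
  also have "\<dots> \<le> (\<Sum>x\<in>X. \<bar>pmf \<mu> x - pmf \<nu> x\<bar>)"
    using assms by (intro sum_mono2) auto
  finally show "\<bar>measure_pmf.prob \<mu> W - measure_pmf.prob \<nu> W\<bar> \<le> (\<Sum>x\<in>X. \<bar>pmf \<mu> x - pmf \<nu> x\<bar>)" .
qed

lemma sum_pmf_excess_le_tv_dist:
  assumes "finite X" "set_pmf \<mu> \<subseteq> X" "set_pmf \<nu> \<subseteq> X"
  shows "(\<Sum>x\<in>X. max 0 (pmf \<mu> x - pmf \<nu> x)) \<le> tv_dist \<mu> \<nu>"
proof -
  let ?W = "{x. pmf \<nu> x < pmf \<mu> x}"
  have "(\<Sum>x\<in>X. max 0 (pmf \<mu> x - pmf \<nu> x)) = (\<Sum>x\<in>X \<inter> ?W. pmf \<mu> x - pmf \<nu> x)"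
    using assms(1) by (intro sum.mono_neutral_cong_right) auto
  also have "\<dots> = measure_pmf.prob \<mu> ?W - measure_pmf.prob \<nu> ?W"
    using assms by (simp add: prob_eq_sum_pmf[of X] sum_subtractf)
  also have "\<dots> \<le> tv_dist \<mu> \<nu>"
    using prob_diff_le_tv_dist[of \<mu> ?W \<nu>] by linarith
  finally show ?thesis .
qed

text \<open>A weak form of Pinsker's inequality: by \<open>ln x \<le> x - 1\<close> at \<open>x = sqrt (R/Q)\<close>, the relative entropy
  dominates \<open>\<Sum>(sqrt Q - sqrt R)\<^sup>2\<close>; and \<open>\<bar>Q - R\<bar> = \<bar>sqrt Q - sqrt R\<bar> (sqrt Q + sqrt R)\<close>. The free parameter
  \<open>\<theta>\<close> keeps the bound affine in the relative entropy, so that it can be averaged.\<close>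

lemma tv_dist_le_relative_entropy:
  assumes "finite X" "set_pmf Q \<subseteq> X" "set_pmf R \<subseteq> X" "set_pmf Q \<subseteq> set_pmf R" "\<theta> > 0"
  shows "tv_dist Q R \<le> \<theta> + (\<Sum>x\<in>X. pmf Q x * ln (pmf Q x / pmf R x)) / \<theta>"
proof -
  define D where "D = (\<Sum>x\<in>X. pmf Q x * ln (pmf Q x / pmf R x))"
  define a where "a x = sqrt (pmf Q x)" for x
  define b where "b x = sqrt (pmf R x)" for x
  have sq: "(a x)\<^sup>2 = pmf Q x" "(b x)\<^sup>2 = pmf R x" for x
    by (auto simp: a_def b_def)
  have nn: "a x \<ge> 0" "b x \<ge> 0" for x by (auto simp: a_def b_def)
  have one: "(\<Sum>x\<in>X. pmf Q x) = 1" "(\<Sum>x\<in>X. pmf R x) = 1"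
    using assms by (auto intro: sum_pmf_eq_1)
  have pt: "pmf Q x + pmf R x - 2 * a x * b x + (pmf Q x - pmf R x) \<le> pmf Q x * ln (pmf Q x / pmf R x)" for x
  proof (cases "pmf Q x = 0")
    case True then show ?thesis by (simp add: a_def)
  next
    case False
    then have pos: "pmf Q x > 0" "pmf R x > 0"
      using assms(4) by (auto simp: pmf_positive_iff set_pmf_iff)
    then have ab: "a x > 0" "b x > 0" by (auto simp: a_def b_def)
    have "ln (b x / a x) \<le> b x / a x - 1" using ab by (intro ln_le_minus_one) auto
    moreover have "ln (pmf Q x / pmf R x) = - 2 * ln (b x / a x)"
      unfolding sq[symmetric] using ab by (simp add: ln_div ln_realpow)
    ultimately have "ln (pmf Q x / pmf R x) \<ge> 2 - 2 * (b x / a x)" by linarith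
    then have "(a x)\<^sup>2 * ln (pmf Q x / pmf R x) \<ge> (a x)\<^sup>2 * (2 - 2 * (b x / a x))"
      by (intro mult_left_mono) auto
    also have "(a x)\<^sup>2 * (2 - 2 * (b x / a x)) = 2 * (a x)\<^sup>2 - 2 * a x * b x"
      using ab by (simp add: field_simps power2_eq_square)
    finally show ?thesis by (simp add: sq)
  qed
  have H: "(\<Sum>x\<in>X. (a x - b x)\<^sup>2) \<le> D"
  proof -
    have "(\<Sum>x\<in>X. (a x - b x)\<^sup>2) = (\<Sum>x\<in>X. pmf Q x + pmf R x - 2 * a x * b x)"
      by (intro sum.cong refl) (simp add: power2_diff sq)
    also have "\<dots> = (\<Sum>x\<in>X. pmf Q x + pmf R x - 2 * a x * b x + (pmf Q x - pmf R x))"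
      by (simp add: sum.distrib sum_subtractf sum_distrib_left[symmetric] one)
    also have "\<dots> \<le> D" unfolding D_def by (rule sum_mono) (rule pt)
    finally show ?thesis .
  qed
  have "\<bar>pmf Q x - pmf R x\<bar> \<le> \<theta> * (pmf Q x + pmf R x) / 2 + (a x - b x)\<^sup>2 / \<theta>" for x
  proof -
    have "\<bar>pmf Q x - pmf R x\<bar> = \<bar>a x - b x\<bar> * (a x + b x)"
    proof -
      have "pmf Q x - pmf R x = (a x - b x) * (a x + b x)"
        unfolding sq[symmetric] by (simp add: algebra_simps power2_eq_square)
      then show ?thesis using nn[of x] by (simp add: abs_mult)
    qed
    moreover have "2 * (\<bar>a x - b x\<bar> * (a x + b x)) \<le> \<theta> / 2 * (a x + b x)\<^sup>2 + 2 / \<theta> * (a x - b x)\<^sup>2"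
    proof -
      have gen: "(\<theta> * s - 2 * t)\<^sup>2 / (2 * \<theta>) = \<theta> / 2 * s\<^sup>2 + 2 / \<theta> * t\<^sup>2 - 2 * (t * s)" for s t
        using assms(5) by (simp add: power2_eq_square field_simps)
      have "0 \<le> (\<theta> * (a x + b x) - 2 * \<bar>a x - b x\<bar>)\<^sup>2 / (2 * \<theta>)" using assms(5) by simp
      also have "\<dots> = \<theta> / 2 * (a x + b x)\<^sup>2 + 2 / \<theta> * (a x - b x)\<^sup>2 - 2 * (\<bar>a x - b x\<bar> * (a x + b x))"
        unfolding gen by simp
      finally show ?thesis by simp
    qed
    moreover have "(a x + b x)\<^sup>2 \<le> 2 * (pmf Q x + pmf R x)"
    proof -
      have "0 \<le> (a x - b x)\<^sup>2" by simp
      then show ?thesis unfolding sq[symmetric] by (simp add: power2_sum power2_diff)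
    qed
    then have "\<theta> / 2 * (a x + b x)\<^sup>2 \<le> \<theta> / 2 * (2 * (pmf Q x + pmf R x))"
      using assms(5) by (intro mult_left_mono) auto
    then have "\<theta> / 2 * (a x + b x)\<^sup>2 \<le> \<theta> * (pmf Q x + pmf R x)"
      by (simp add: algebra_simps)
    ultimately have "2 * \<bar>pmf Q x - pmf R x\<bar> \<le> \<theta> * (pmf Q x + pmf R x) + 2 / \<theta> * (a x - b x)\<^sup>2"
      by simp
    then show ?thesis by (simp add: field_simps)
  qed
  then have "(\<Sum>x\<in>X. \<bar>pmf Q x - pmf R x\<bar>)
      \<le> (\<Sum>x\<in>X. \<theta> * (pmf Q x + pmf R x) / 2 + (a x - b x)\<^sup>2 / \<theta>)"
    by (rule sum_mono)
  also have "\<dots> = \<theta> * ((\<Sum>x\<in>X. pmf Q x) + (\<Sum>x\<in>X. pmf R x)) / 2 + (\<Sum>x\<in>X. (a x - b x)\<^sup>2) / \<theta>"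
    by (simp add: sum.distrib sum_divide_distrib[symmetric] sum_distrib_left[symmetric])
  also have "\<dots> \<le> \<theta> + D / \<theta>"
    using H assms(5) by (simp add: one divide_right_mono)
  finally show ?thesis
    using tv_dist_le_sum[OF assms(1-3)] by (simp add: D_def)
qed

section \<open>Convexity and enlargements\<close>

text \<open>Splitting off one point writes a uniform mixture as a mixture of two, to which convexity applies.\<close>

lemma bind_pmf_of_set_insert:
  assumes "finite A" "A \<noteq> {}" "a \<notin> A"
  shows "bind_pmf (pmf_of_set (insert a A)) f =
    bind_pmf (bernoulli_pmf (1 / (card A + 1))) (\<lambda>b. if b then f a else bind_pmf (pmf_of_set A) f)"
proof (rule pmf_eqI)
  fix y
  let ?n = "real (card A)"
  have n: "?n > 0" using assms by (simp add: card_gt_0_iff)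
  have "pmf (bind_pmf (bernoulli_pmf (1 / (card A + 1))) (\<lambda>b. if b then f a else bind_pmf (pmf_of_set A) f)) y
      = 1 / (?n + 1) * pmf (f a) y + (1 - 1 / (?n + 1)) * ((\<Sum>x\<in>A. pmf (f x) y) / ?n)"
    using assms n by (simp add: pmf_bind pmf_bind_pmf_of_set integral_pmf_of_set add.commute)
  also have "\<dots> = (pmf (f a) y + (\<Sum>x\<in>A. pmf (f x) y)) / (?n + 1)"
  proof -
    have "1 - 1 / (?n + 1) = ?n / (?n + 1)" using n by (simp add: field_simps)
    then show ?thesis using n by (simp add: add_divide_distrib)
  qed
  finally show "pmf (bind_pmf (pmf_of_set (insert a A)) f) y = pmf (bind_pmf (bernoulli_pmf (1 / (card A + 1)))
      (\<lambda>b. if b then f a else bind_pmf (pmf_of_set A) f)) y"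
    using assms by (simp add: pmf_bind_pmf_of_set)
qed

lemma convex_pmfs_uniform_mixture:
  assumes "convex_pmfs \<Gamma>" "finite A" "A \<noteq> {}" "\<And>x. x \<in> A \<Longrightarrow> f x \<in> \<Gamma>"
  shows "bind_pmf (pmf_of_set A) f \<in> \<Gamma>"
  using assms(2-4)
proof (induction A rule: finite_ne_induct)
  case (singleton x)
  then show ?case by (simp add: pmf_of_set_singleton bind_return_pmf)
next
  case (insert a A)
  then show ?case
    using assms(1) unfolding convex_pmfs_def bind_pmf_of_set_insert[OF insert.hyps(1-3)]
    by auto
qed

lemma enlarge_iff:
  "\<mu> \<in> enlarge S \<epsilon> \<Gamma> \<longleftrightarrow> \<mu> \<in> probs S \<and> (\<forall>\<delta>>\<epsilon>. \<exists>\<nu>\<in>\<Gamma>. tv_dist \<mu> \<nu> < \<delta>)"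
proof -
  have "(INF \<nu>\<in>\<Gamma>. ereal (tv_dist \<mu> \<nu>)) \<le> ereal \<epsilon> \<longleftrightarrow>
      (\<forall>y>ereal \<epsilon>. \<exists>\<nu>\<in>\<Gamma>. ereal (tv_dist \<mu> \<nu>) < y)"
    by (rule INF_le_iff)
  also have "\<dots> \<longleftrightarrow> (\<forall>\<delta>>\<epsilon>. \<exists>\<nu>\<in>\<Gamma>. tv_dist \<mu> \<nu> < \<delta>)"
  proof (intro iffI allI impI)
    fix y assume *: "\<forall>\<delta>>\<epsilon>. \<exists>\<nu>\<in>\<Gamma>. tv_dist \<mu> \<nu> < \<delta>" and y: "ereal \<epsilon> < y"
    obtain r where "ereal \<epsilon> < ereal r" "ereal r < y" using ereal_dense2[OF y] by auto
    then show "\<exists>\<nu>\<in>\<Gamma>. ereal (tv_dist \<mu> \<nu>) < y"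
      using * by (metis ereal_less_eq(3) less_ereal.simps(1) less_le_trans less_imp_le order.strict_trans)
  qed (metis less_ereal.simps(1))
  finally show ?thesis by (simp add: enlarge_def)
qed

lemma enlarge_mono: "\<epsilon> \<le> \<delta> \<Longrightarrow> enlarge S \<epsilon> \<Gamma> \<subseteq> enlarge S \<delta> \<Gamma>"
  by (auto simp: enlarge_iff)

lemma enlarge_step:
  assumes "\<mu> \<in> enlarge S \<epsilon> \<Gamma>" "\<mu>' \<in> probs S" "tv_dist \<mu>' \<mu> \<le> \<eta>"
  shows "\<mu>' \<in> enlarge S (\<epsilon> + \<eta>) \<Gamma>"
  unfolding enlarge_iff
proof (intro conjI allI impI)
  fix \<delta> assume "\<epsilon> + \<eta> < \<delta>"
  then have "\<epsilon> < \<delta> - \<eta>" by simp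
  then obtain \<nu> where "\<nu> \<in> \<Gamma>" "tv_dist \<mu> \<nu> < \<delta> - \<eta>" using assms(1) by (auto simp: enlarge_iff)
  then show "\<exists>\<nu>\<in>\<Gamma>. tv_dist \<mu>' \<nu> < \<delta>"
    using tv_dist_triangle[of \<mu>' \<nu> \<mu>] assms(3) by (intro bexI[of _ \<nu>]) auto
qed (rule assms(2))

lemma enlarge_uniform_mixture:
  assumes "convex_pmfs \<Gamma>" "finite A" "A \<noteq> {}" "\<And>x. x \<in> A \<Longrightarrow> f x \<in> enlarge S \<epsilon> \<Gamma>"
  shows "bind_pmf (pmf_of_set A) f \<in> enlarge S \<epsilon> \<Gamma>"
  unfolding enlarge_iff
proof (intro conjI allI impI)
  show "bind_pmf (pmf_of_set A) f \<in> probs S"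
    using assms(2-4) by (auto simp: probs_def enlarge_def)
  fix \<delta> assume "\<epsilon> < \<delta>"
  then have "\<forall>x\<in>A. \<exists>\<nu>\<in>\<Gamma>. tv_dist (f x) \<nu> < \<delta>" using assms(4) by (auto simp: enlarge_iff)
  then obtain g where g: "\<And>x. x \<in> A \<Longrightarrow> g x \<in> \<Gamma>" "\<And>x. x \<in> A \<Longrightarrow> tv_dist (f x) (g x) < \<delta>"
    by metis
  have "(\<Sum>x\<in>A. tv_dist (f x) (g x)) < (\<Sum>x\<in>A. \<delta>)"
    using assms(2,3) g(2) by (intro sum_strict_mono) auto
  then have "(\<Sum>x\<in>A. tv_dist (f x) (g x)) / card A < \<delta>"
    using assms(2,3) by (simp add: field_simps card_gt_0_iff)
  then have "tv_dist (bind_pmf (pmf_of_set A) f) (bind_pmf (pmf_of_set A) g) < \<delta>"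
    using tv_dist_bind_pmf_of_set_le[OF assms(2,3), of f g] by linarith
  moreover have "bind_pmf (pmf_of_set A) g \<in> \<Gamma>"
    by (rule convex_pmfs_uniform_mixture[OF assms(1-3)]) (rule g(1))
  ultimately show "\<exists>\<nu>\<in>\<Gamma>. tv_dist (bind_pmf (pmf_of_set A) f) \<nu> < \<delta>" by blast
qed

lemma Lim_at_right_eq_INF:
  fixes f :: "real \<Rightarrow> ereal"
  assumes "\<And>x y. 0 < x \<Longrightarrow> x \<le> y \<Longrightarrow> f x \<le> f y"
  shows "Lim (at_right 0) f = (INF x\<in>{0<..}. f x)"
proof (rule tendsto_Lim)
  show "(f \<longlongrightarrow> (INF x\<in>{0<..}. f x)) (at_right 0)"
  proof (rule order_tendstoI)
    fix a assume "a < (INF x\<in>{0<..}. f x)"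
    then have "a < f x" if "x > 0" for x
      using that by (meson INF_lower greaterThan_iff less_le_trans)
    then show "\<forall>\<^sub>F x in at_right 0. a < f x"
      by (auto simp: eventually_at_filter)
  next
    fix a assume "(INF x\<in>{0<..}. f x) < a"
    then obtain y where y: "y > 0" "f y < a" by (auto simp: INF_less_iff)
    have "\<forall>\<^sub>F x in at_right 0. x < y" "\<forall>\<^sub>F x::real in at_right 0. 0 < x"
      using y(1) by (auto intro: eventually_at_right_less eventually_at_rightI[of 0 y])
    then show "\<forall>\<^sub>F x in at_right 0. f x < a"
      by eventually_elim (use assms y in \<open>meson le_less_trans less_imp_le\<close>)
  qed
qed simp

section \<open>Entropy of finitely supported measures\<close>

lemma finite_configs: "finite S \<Longrightarrow> finite (configs S :: ('i \<Rightarrow> 'a::finite) set)"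
  unfolding configs_def by (intro finite_PiE) auto

lemma card_configs: "finite S \<Longrightarrow> card (configs S :: ('i \<Rightarrow> 'a::finite) set) = CARD('a) ^ card S"
  unfolding configs_def by (simp add: card_PiE)

lemma restrict_in_configs [simp]: "restrict f S \<in> configs S"
  by (auto simp: configs_def)

lemma Pi_pmf_in_probs: "finite S \<Longrightarrow> Pi_pmf S undefined p \<in> probs S"
  using set_Pi_pmf_subset[of S undefined p] unfolding probs_def configs_def
  by (auto simp: PiE_def extensional_def)

lemma entropy_pmf_eq_sum:
  assumes "finite X" "set_pmf \<mu> \<subseteq> X"
  shows "entropy_pmf \<mu> = - (\<Sum>x\<in>X. pmf \<mu> x * log 2 (pmf \<mu> x))"
  unfolding entropy_pmf_def using assms
  by (intro arg_cong[where f=uminus] sum.mono_neutral_left) (auto simp: set_pmf_iff)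

lemma entropy_pmf_eq_expectation:
  assumes "finite (set_pmf \<mu>)"
  shows "entropy_pmf \<mu> = measure_pmf.expectation \<mu> (\<lambda>x. - log 2 (pmf \<mu> x))"
  unfolding entropy_pmf_def
  by (subst integral_measure_pmf_real[OF assms]) (auto simp: sum_negf mult.commute)

text \<open>Gibbs' inequality, for a reference function \<open>r\<close> of total mass at most one.\<close>

lemma entropy_le_cross_entropy:
  assumes X: "finite X" "set_pmf \<mu> \<subseteq> X" and r: "\<And>x. x \<in> X \<Longrightarrow> r x > 0" "(\<Sum>x\<in>X. r x) \<le> 1"
  shows "entropy_pmf \<mu> \<le> - (\<Sum>x\<in>X. pmf \<mu> x * log 2 (r x))"
proof -
  have "pmf \<mu> x * log 2 (r x) - pmf \<mu> x * log 2 (pmf \<mu> x) \<le> (r x - pmf \<mu> x) / ln 2" if "x \<in> X" for x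
  proof (cases "pmf \<mu> x = 0")
    case True
    then show ?thesis using r(1)[OF that] by simp
  next
    case False
    then have p: "pmf \<mu> x > 0" by (simp add: pmf_positive_iff set_pmf_iff)
    have "ln (r x / pmf \<mu> x) \<le> r x / pmf \<mu> x - 1" using p r(1)[OF that] by (intro ln_le_minus_one) auto
    then have "ln (r x) - ln (pmf \<mu> x) \<le> r x / pmf \<mu> x - 1" using p r(1)[OF that] by (simp add: ln_div)
    then have "pmf \<mu> x * (ln (r x) - ln (pmf \<mu> x)) \<le> pmf \<mu> x * (r x / pmf \<mu> x - 1)"
      using p by (intro mult_left_mono) auto
    also have "\<dots> = r x - pmf \<mu> x" using p by (simp add: field_simps)
    finally have "pmf \<mu> x * (ln (r x) - ln (pmf \<mu> x)) / ln 2 \<le> (r x - pmf \<mu> x) / ln 2"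
      by (intro divide_right_mono) auto
    then show ?thesis by (simp add: log_def diff_divide_distrib right_diff_distrib)
  qed
  then have "(\<Sum>x\<in>X. pmf \<mu> x * log 2 (r x) - pmf \<mu> x * log 2 (pmf \<mu> x)) \<le> (\<Sum>x\<in>X. (r x - pmf \<mu> x) / ln 2)"
    by (rule sum_mono)
  also have "\<dots> = ((\<Sum>x\<in>X. r x) - 1) / ln 2"
    using sum_pmf_eq_1[OF X] by (simp add: sum_subtractf sum_divide_distrib[symmetric])
  also have "\<dots> \<le> 0" using r(2) by (simp add: divide_le_0_iff)
  finally show ?thesis
    using X by (simp add: entropy_pmf_eq_sum sum_subtractf)
qed

text \<open>Comparing with the measure that gives half of its mass uniformly to \<open>G\<close> and half to \<open>X\<close> shows that
  a set of nearly full measure has at least about \<open>2 ^ H\<close> elements.\<close>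

lemma entropy_le_log_card:
  assumes X: "finite X" "set_pmf \<mu> \<subseteq> X" and G: "G \<subseteq> X" "G \<noteq> {}"
  shows "entropy_pmf \<mu> \<le> 1 + log 2 (card G) + measure_pmf.prob \<mu> (- G) * log 2 (card X)"
proof -
  define r :: "'a \<Rightarrow> real" where "r x = 1 / (2 * (if x \<in> G then card G else card X))" for x
  have fG: "finite G" using G X finite_subset by blast
  have cG: "card G \<ge> 1" using G fG by (simp add: Suc_le_eq card_gt_0_iff)
  have cX: "card X \<ge> 1" using cG card_mono[OF X(1) G(1)] by linarith
  have one: "(\<Sum>x\<in>X. pmf \<mu> x) = 1" by (rule sum_pmf_eq_1[OF X])
  have XG: "X = G \<union> (X - G)" using G by auto
  have split: "(\<Sum>x\<in>X. h x) = (\<Sum>x\<in>G. h x) + (\<Sum>x\<in>X-G. h x)" for h :: "'a \<Rightarrow> real"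
    using sum.subset_diff[OF G(1) X(1), of h] by simp
  have "(\<Sum>x\<in>X. r x) = (\<Sum>x\<in>G. 1 / (2 * card G)) + (\<Sum>x\<in>X-G. 1 / (2 * card X))"
    unfolding split r_def by simp
  also have "\<dots> \<le> 1 / 2 + (\<Sum>x\<in>X. 1 / (2 * card X))"
    using cG X(1) by (intro add_mono sum_mono2) auto
  also have "\<dots> = 1" using cX by simp
  finally have "entropy_pmf \<mu> \<le> - (\<Sum>x\<in>X. pmf \<mu> x * log 2 (r x))"
    using cG cX by (intro entropy_le_cross_entropy[OF X]) (auto simp: r_def)
  also have "\<dots> = (\<Sum>x\<in>X. pmf \<mu> x * (1 + (if x \<in> G then log 2 (card G) else log 2 (card X))))"
    unfolding sum_negf[symmetric] using cG cX
    by (intro sum.cong refl) (auto simp: r_def log_divide log_mult algebra_simps)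
  also have "\<dots> = 1 + (\<Sum>x\<in>G. pmf \<mu> x) * log 2 (card G) + (\<Sum>x\<in>X-G. pmf \<mu> x) * log 2 (card X)"
    unfolding distrib_left sum.distrib using one split[of "\<lambda>x. pmf \<mu> x * (if x \<in> G then log 2 (card G) else log 2 (card X))"]
    by (simp add: sum_distrib_right)
  also have "(\<Sum>x\<in>X-G. pmf \<mu> x) = measure_pmf.prob \<mu> (- G)"
    by (simp add: prob_eq_sum_pmf[OF X] Diff_eq)
  also have "(\<Sum>x\<in>G. pmf \<mu> x) * log 2 (card G) \<le> 1 * log 2 (card G)"
  proof (rule mult_right_mono)
    show "(\<Sum>x\<in>G. pmf \<mu> x) \<le> 1" using sum_mono2[OF X(1) G(1), of "pmf \<mu>"] one by simp
  qed (use cG in simp)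
  finally show ?thesis by simp
qed

lemma entropy_Pi_pmf:
  fixes p :: "'i \<Rightarrow> 'a::finite pmf"
  assumes "finite A"
  shows "entropy_pmf (Pi_pmf A d p) = (\<Sum>i\<in>A. entropy_pmf (p i))"
proof -
  let ?\<mu> = "Pi_pmf A d p"
  have fin: "finite (set_pmf ?\<mu>)"
    unfolding set_Pi_pmf[OF assms] using assms by (intro finite_PiE_dflt) auto
  have "entropy_pmf ?\<mu> = measure_pmf.expectation ?\<mu> (\<lambda>f. - log 2 (pmf ?\<mu> f))"
    by (rule entropy_pmf_eq_expectation[OF fin])
  also have "\<dots> = measure_pmf.expectation ?\<mu> (\<lambda>f. \<Sum>i\<in>A. - log 2 (pmf (p i) (f i)))"
  proof (intro integral_cong_AE)
    show "AE f in ?\<mu>. - log 2 (pmf ?\<mu> f) = (\<Sum>i\<in>A. - log 2 (pmf (p i) (f i)))"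
      unfolding AE_measure_pmf_iff
    proof
      fix f assume f: "f \<in> set_pmf ?\<mu>"
      then have "pmf ?\<mu> f = (\<Prod>i\<in>A. pmf (p i) (f i))"
        using assms by (auto simp: pmf_Pi set_pmf_iff split: if_splits)
      moreover have "\<And>i. i \<in> A \<Longrightarrow> pmf (p i) (f i) \<noteq> 0"
        using f assms by (auto simp: set_Pi_pmf PiE_dflt_def set_pmf_iff)
      ultimately show "- log 2 (pmf ?\<mu> f) = (\<Sum>i\<in>A. - log 2 (pmf (p i) (f i)))"
        using assms by (simp add: log_def ln_prod sum_negf sum_divide_distrib pmf_positive_iff set_pmf_iff)
    qed
  qed auto
  also have "\<dots> = (\<Sum>i\<in>A. measure_pmf.expectation ?\<mu> (\<lambda>f. - log 2 (pmf (p i) (f i))))"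
    by (intro Bochner_Integration.integral_sum integrable_measure_pmf_finite fin)
  also have "\<dots> = (\<Sum>i\<in>A. entropy_pmf (p i))"
  proof (intro sum.cong refl)
    fix i assume "i \<in> A"
    have "measure_pmf.expectation ?\<mu> (\<lambda>f. - log 2 (pmf (p i) (f i)))
        = measure_pmf.expectation (map_pmf (\<lambda>f. f i) ?\<mu>) (\<lambda>a. - log 2 (pmf (p i) a))"
      by simp
    also have "\<dots> = entropy_pmf (p i)"
      using \<open>i \<in> A\<close> by (simp only: Pi_pmf_component[OF assms] if_True) (simp add: entropy_pmf_eq_expectation)
    finally show "measure_pmf.expectation ?\<mu> (\<lambda>f. - log 2 (pmf (p i) (f i))) = entropy_pmf (p i)" .
  qed
  finally show ?thesis .
qed

lemma Pi_pmf_pullback: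
  assumes A: "finite A" and f: "inj_on f B" "f ` B \<subseteq> A"
  shows "map_pmf (\<lambda>w. restrict (\<lambda>t. w (f t)) B) (Pi_pmf A undefined p) = Pi_pmf B undefined (\<lambda>t. p (f t))"
proof (rule pmf_eqI)
  fix x
  have B: "finite B" using f A by (meson finite_imageD finite_subset)
  show "pmf (map_pmf (\<lambda>w. restrict (\<lambda>t. w (f t)) B) (Pi_pmf A undefined p)) x
      = pmf (Pi_pmf B undefined (\<lambda>t. p (f t))) x"
  proof (cases "x \<in> extensional B")
    case False
    then have "x \<notin> set_pmf (map_pmf (\<lambda>w. restrict (\<lambda>t. w (f t)) B) (Pi_pmf A undefined p))"
      by auto
    then have "pmf (map_pmf (\<lambda>w. restrict (\<lambda>t. w (f t)) B) (Pi_pmf A undefined p)) x = 0"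
      by (simp only: set_pmf_iff not_not)
    moreover have "pmf (Pi_pmf B undefined (\<lambda>t. p (f t))) x = 0"
      using False B by (intro pmf_Pi_outside) (auto simp: extensional_def)
    ultimately show ?thesis by simp
  next
    case True
    let ?E = "\<lambda>u. {a. \<forall>t\<in>B. f t = u \<longrightarrow> a = x t}"
    \<comment> \<open>Reading \<open>x\<close> is a product event, which constrains the letters on \<open>f ` B\<close> only.\<close>
    have ev: "(\<lambda>w. restrict (\<lambda>t. w (f t)) B) -` {x} = Pi A ?E"
    proof (intro set_eqI iffI)
      fix w assume "w \<in> Pi A ?E"
      then have "w (f t) = x t" if "t \<in> B" for t using that f(2) by (auto simp: Pi_def)
      then show "w \<in> (\<lambda>w. restrict (\<lambda>t. w (f t)) B) -` {x}"
        using True by (auto simp: fun_eq_iff extensional_def restrict_def)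
    qed (auto simp: Pi_def)
    have "pmf (map_pmf (\<lambda>w. restrict (\<lambda>t. w (f t)) B) (Pi_pmf A undefined p)) x
        = (\<Prod>u\<in>A. measure_pmf.prob (p u) (?E u))"
      by (simp add: pmf_map ev measure_Pi_pmf_Pi[OF A])
    also have "\<dots> = (\<Prod>u\<in>f ` B. measure_pmf.prob (p u) (?E u))"
    proof (rule prod.mono_neutral_right)
      show "\<forall>u\<in>A - f ` B. measure_pmf.prob (p u) (?E u) = 1"
      proof
        fix u assume "u \<in> A - f ` B"
        then have "?E u = UNIV" by auto
        then show "measure_pmf.prob (p u) (?E u) = 1" by simp
      qed
    qed (use A f in auto)
    also have "\<dots> = (\<Prod>t\<in>B. measure_pmf.prob (p (f t)) (?E (f t)))"
      using f(1) by (simp add: prod.reindex)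
    also have "\<dots> = (\<Prod>t\<in>B. pmf (p (f t)) (x t))"
    proof (rule prod.cong[OF refl])
      fix t assume "t \<in> B"
      then have "?E (f t) = {x t}" using f(1) by (auto simp: inj_on_def)
      then show "measure_pmf.prob (p (f t)) (?E (f t)) = pmf (p (f t)) (x t)"
        by (simp add: measure_pmf_single)
    qed
    also have "\<dots> = pmf (Pi_pmf B undefined (\<lambda>t. p (f t))) x"
      using True B by (subst pmf_Pi') (auto simp: extensional_def)
    finally show ?thesis .
  qed
qed

section \<open>Periodic sequences of independent letters\<close>

text \<open>This is \<open>avg_marginal\<close> in dimension one, for the product measure with factors \<open>q 0, \<dots>, q (M - 1)\<close>; sites
  are natural numbers here, which suits the arithmetic of periodic sequences.\<close>

definition seq_marginal :: "nat \<Rightarrow> nat \<Rightarrow> (nat \<Rightarrow> 'a pmf) \<Rightarrow> (nat \<Rightarrow> 'a) pmf" where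
  "seq_marginal M k q = bind_pmf (pmf_of_set {..<M})
     (\<lambda>x. Pi_pmf {..<k} undefined (\<lambda>t. q ((x + t) mod M)))"

lemma inj_axis_point: "inj (axis_point i)"
  by (rule injI) (auto simp: axis_point_def fun_eq_iff split: if_splits)

lemma box_1: "box M 1 = axis_point 0 ` {..<M}"
proof (intro set_eqI iffI)
  fix v assume "v \<in> box M 1"
  then have "v = axis_point 0 (nat (v 0))" "nat (v 0) < M"
    by (auto simp: box_def lattice_def axis_point_def fun_eq_iff)
  then show "v \<in> axis_point 0 ` {..<M}" by blast
qed (auto simp: box_def lattice_def axis_point_def)

lemma axis_word_in_configs [simp]: "axis_word k i w \<in> configs {..<k}"
  by (simp add: axis_word_def)

lemma map_axis_word_in_probs [simp]: "map_pmf (axis_word k i) \<mu> \<in> probs {..<k}"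
  by (auto simp: probs_def)

lemma window_in_configs [simp]: "window n S w v \<in> configs S"
  by (simp add: window_def)

lemma avg_marginal_in_probs [simp]: "avg_marginal n d S \<mu> \<in> probs S"
  by (auto simp: probs_def avg_marginal_def)

lemma axis_word_window:
  assumes "segment k i \<subseteq> S"
  shows "axis_word k i (window n S w v) = restrict (\<lambda>t. w (site_mod n (site_add v (axis_point i t)))) {..<k}"
  using assms by (auto simp: axis_word_def window_def segment_def fun_eq_iff restrict_def)

lemma cyclic_shift_axis_point:
  "site_mod M (site_add (axis_point 0 x) (axis_point 0 t)) = axis_point 0 ((x + t) mod M)"
  by (auto simp: site_mod_def site_add_def axis_point_def fun_eq_iff zmod_int)

lemma inj_on_add_mod:
  fixes M :: nat
  assumes "k \<le> M"
  shows "inj_on (\<lambda>t. (x + t) mod M) {..<k}"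
proof (rule inj_onI)
  fix s t assume st: "s \<in> {..<k}" "t \<in> {..<k}" "(x + s) mod M = (x + t) mod M"
  then have "int (x + s) mod int M = int (x + t) mod int M"
    by (metis zmod_int)
  then have "int M dvd int (x + s) - int (x + t)" by (simp only: mod_eq_dvd_iff)
  then have "int M dvd int s - int t" by simp
  then show "s = t" using st assms dvd_imp_le_int[of "int s - int t" "int M"] by fastforce
qed

lemma axis_marginal_line:
  assumes "k \<le> M" "M \<ge> 1"
  shows "map_pmf (axis_word k 0) (avg_marginal M 1 (segment k 0) (Pi_pmf (box M 1) undefined p))
       = seq_marginal M k (\<lambda>x. p (axis_point 0 x))"
proof -
  have fin: "finite (box M 1)" by (simp only: box_1) simp
  have "pmf_of_set (box M 1) = map_pmf (axis_point 0) (pmf_of_set {..<M})"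
    unfolding box_1 using assms(2)
    by (intro map_pmf_of_set_inj[symmetric]) (auto intro: inj_on_subset[OF inj_axis_point] simp: lessThan_empty_iff)
  then have "map_pmf (axis_word k 0) (avg_marginal M 1 (segment k 0) (Pi_pmf (box M 1) undefined p))
      = bind_pmf (pmf_of_set {..<M}) (\<lambda>x. map_pmf (\<lambda>w. restrict (\<lambda>t. w (axis_point 0 ((x + t) mod M))) {..<k})
          (Pi_pmf (box M 1) undefined p))"
    by (simp add: avg_marginal_def map_bind_pmf bind_map_pmf pmf.map_comp o_def axis_word_window
        cyclic_shift_axis_point)
  also have "\<dots> = seq_marginal M k (\<lambda>x. p (axis_point 0 x))"
    unfolding seq_marginal_def
  proof (intro bind_pmf_cong refl)
    fix x
    show "map_pmf (\<lambda>w. restrict (\<lambda>t. w (axis_point 0 ((x + t) mod M))) {..<k}) (Pi_pmf (box M 1) undefined p)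
        = Pi_pmf {..<k} undefined (\<lambda>t. p (axis_point 0 ((x + t) mod M)))"
    proof (rule Pi_pmf_pullback[OF fin])
      show "inj_on (\<lambda>t. axis_point 0 ((x + t) mod M)) {..<k}"
        by (rule inj_onI) (metis inj_on_add_mod[OF assms(1)] inj_axis_point inj_onD injD)
      show "(\<lambda>t. axis_point 0 ((x + t) mod M)) ` {..<k} \<subseteq> box M 1"
        using assms(2) unfolding box_1 by (intro image_subsetI imageI) simp
    qed
  qed
  finally show ?thesis .
qed

lemma enlarge_line_system_iff:
  assumes "\<mu> \<in> probs (segment k 0)" "\<Gamma> \<subseteq> probs {..<k}"
  shows "\<mu> \<in> enlarge (segment k 0) \<epsilon> (line_system k \<Gamma>)
     \<longleftrightarrow> map_pmf (axis_word k 0) \<mu> \<in> enlarge {..<k} \<epsilon> \<Gamma>"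
proof -
  define L :: "(nat \<Rightarrow> 'a) \<Rightarrow> site \<Rightarrow> 'a" where "L u = restrict (\<lambda>s. u (nat (s 0))) (segment k 0)" for u
  have L_axis: "L (axis_word k 0 w) = w" if "w \<in> configs (segment k 0)" for w
    using that by (auto simp: L_def axis_word_def configs_def segment_def axis_point_def fun_eq_iff
        PiE_def extensional_def restrict_def cong: if_cong)
  have axis_L: "axis_word k 0 (L u) = u" if "u \<in> configs {..<k}" for u
    using that by (auto simp: L_def axis_word_def configs_def segment_def axis_point_def fun_eq_iff
        PiE_def extensional_def restrict_def)
  have \<mu>: "\<mu> = map_pmf L (map_pmf (axis_word k 0) \<mu>)"
    unfolding pmf.map_comp using assms(1) L_axis
    by (intro map_pmf_idI[symmetric]) (auto simp: probs_def)
  have "(\<exists>\<nu>\<in>line_system k \<Gamma>. tv_dist \<mu> \<nu> < \<delta>) \<longleftrightarrow> (\<exists>\<nu>\<in>\<Gamma>. tv_dist (map_pmf (axis_word k 0) \<mu>) \<nu> < \<delta>)" for \<delta>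
  proof
    assume "\<exists>\<nu>\<in>line_system k \<Gamma>. tv_dist \<mu> \<nu> < \<delta>"
    then obtain \<nu> where "map_pmf (axis_word k 0) \<nu> \<in> \<Gamma>" "tv_dist \<mu> \<nu> < \<delta>"
      by (auto simp: line_system_def)
    then show "\<exists>\<nu>\<in>\<Gamma>. tv_dist (map_pmf (axis_word k 0) \<mu>) \<nu> < \<delta>"
      using tv_dist_map_pmf_le le_less_trans by blast
  next
    assume "\<exists>\<nu>\<in>\<Gamma>. tv_dist (map_pmf (axis_word k 0) \<mu>) \<nu> < \<delta>"
    then obtain \<nu> where \<nu>: "\<nu> \<in> \<Gamma>" "tv_dist (map_pmf (axis_word k 0) \<mu>) \<nu> < \<delta>" by auto
    have "map_pmf (axis_word k 0) (map_pmf L \<nu>) = \<nu>"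
      unfolding pmf.map_comp using assms(2) \<nu>(1) axis_L
      by (intro map_pmf_idI) (auto simp: probs_def)
    then have "map_pmf L \<nu> \<in> line_system k \<Gamma>"
      using \<nu>(1) by (auto simp: line_system_def probs_def L_def)
    moreover have "tv_dist \<mu> (map_pmf L \<nu>) < \<delta>"
      using tv_dist_map_pmf_le[of L "map_pmf (axis_word k 0) \<mu>" \<nu>] \<nu>(2) \<mu> by simp
    ultimately show "\<exists>\<nu>\<in>line_system k \<Gamma>. tv_dist \<mu> \<nu> < \<delta>" by blast
  qed
  then show ?thesis using assms(1) by (simp add: enlarge_iff)
qed

lemma frequently_of_less_limsup:
  fixes f :: "nat \<Rightarrow> ereal"
  assumes "c < limsup f"
  shows "\<exists>n\<ge>n0. c < f n"
proof (rule ccontr)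
  assume "\<not> ?thesis"
  then have "\<forall>\<^sub>F n in sequentially. f n \<le> c"
    by (auto simp: eventually_sequentially not_less)
  then have "limsup f \<le> c" by (rule Limsup_bounded)
  then show False using assms by simp
qed

lemma le_limsup_of_frequently:
  fixes f :: "nat \<Rightarrow> ereal"
  assumes "\<And>n0. \<exists>n\<ge>n0. c \<le> f n"
  shows "c \<le> limsup f"
proof (rule ccontr)
  assume "\<not> ?thesis"
  then have "\<forall>\<^sub>F n in sequentially. f n < c" by (intro Limsup_lessD) simp
  then show False using assms by (auto simp: eventually_sequentially) (meson not_le)
qed

lemma sequence_of_less_h_ind_hat:
  fixes \<Gamma> :: "(nat \<Rightarrow> 'a::finite) pmf set"
  assumes "\<Gamma> \<subseteq> probs {..<k}"
    and "ereal c < h_ind_hat 1 (segment k 0) (enlarge (segment k 0) \<epsilon> (line_system k \<Gamma>))"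
  shows "\<exists>M q. M \<ge> 1 \<and> M \<ge> k \<and> seq_marginal M k q \<in> enlarge {..<k} \<epsilon> \<Gamma> \<and> c * M \<le> (\<Sum>x<M. entropy_pmf (q x))"
proof -
  obtain M where M: "M \<ge> k + 1" and less: "ereal c < (SUP \<mu>\<in>product_measures M 1 (segment k 0)
      (enlarge (segment k 0) \<epsilon> (line_system k \<Gamma>)). ereal (entropy_pmf \<mu> / real M ^ 1))"
    using frequently_of_less_limsup[OF assms(2)[unfolded h_ind_hat_def], of "k + 1"] by blast
  obtain p where p: "avg_marginal M 1 (segment k 0) (Pi_pmf (box M 1) undefined p)
        \<in> enlarge (segment k 0) \<epsilon> (line_system k \<Gamma>)"
      "c < entropy_pmf (Pi_pmf (box M 1) undefined p) / M"
    using less by (auto simp: less_SUP_iff product_measures_def)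
  have fin: "finite (box M 1)" by (simp only: box_1) simp
  have "entropy_pmf (Pi_pmf (box M 1) undefined p) = (\<Sum>x<M. entropy_pmf (p (axis_point 0 x)))"
    unfolding entropy_Pi_pmf[OF fin] unfolding box_1
    by (subst sum.reindex) (auto intro: inj_on_subset[OF inj_axis_point])
  then have "c * M \<le> (\<Sum>x<M. entropy_pmf (p (axis_point 0 x)))"
    using p(2) M by (simp add: field_simps)
  moreover have "seq_marginal M k (\<lambda>x. p (axis_point 0 x)) \<in> enlarge {..<k} \<epsilon> \<Gamma>"
    using p(1) M assms(1) axis_marginal_line[of k M p] by (simp add: enlarge_line_system_iff)
  ultimately show ?thesis using M by (intro exI[of _ M] exI[of _ "\<lambda>x. p (axis_point 0 x)"]) auto
qed

lemma le_h_ind_hat_of_sequences: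
  fixes \<Gamma> :: "(nat \<Rightarrow> 'a::finite) pmf set"
  assumes "\<Gamma> \<subseteq> probs {..<k}"
    and "\<And>M0. \<exists>M\<ge>M0. \<exists>q. seq_marginal M k q \<in> enlarge {..<k} \<epsilon> \<Gamma> \<and> c * M \<le> (\<Sum>x<M. entropy_pmf (q x))"
  shows "ereal c \<le> h_ind_hat 1 (segment k 0) (enlarge (segment k 0) \<epsilon> (line_system k \<Gamma>))"
  unfolding h_ind_hat_def
proof (rule le_limsup_of_frequently)
  fix n0
  obtain M q where M: "M \<ge> n0 + k + 1" and q: "seq_marginal M k q \<in> enlarge {..<k} \<epsilon> \<Gamma>"
    "c * M \<le> (\<Sum>x<M. entropy_pmf (q x))" using assms(2)[of "n0 + k + 1"] by auto
  define p where "p v = q (nat (v 0))" for v :: site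
  have pq: "p (axis_point 0 x) = q x" for x by (simp add: p_def axis_point_def)
  let ?\<mu> = "Pi_pmf (box M 1) undefined p"
  have fin: "finite (box M 1)" by (simp only: box_1) simp
  have "entropy_pmf ?\<mu> = (\<Sum>x<M. entropy_pmf (q x))"
    unfolding entropy_Pi_pmf[OF fin] unfolding box_1
    by (subst sum.reindex) (auto intro: inj_on_subset[OF inj_axis_point] simp: pq)
  then have "c \<le> entropy_pmf ?\<mu> / real M ^ 1"
    using q(2) M by (simp add: field_simps)
  moreover have "?\<mu> \<in> product_measures M 1 (segment k 0) (enlarge (segment k 0) \<epsilon> (line_system k \<Gamma>))"
    using q(1) M assms(1) axis_marginal_line[of k M p]
    by (auto simp: product_measures_def enlarge_line_system_iff pq)
  ultimately show "\<exists>n\<ge>n0. ereal c \<le> (SUP \<mu>\<in>product_measures n 1 (segment k 0)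
      (enlarge (segment k 0) \<epsilon> (line_system k \<Gamma>)). ereal (entropy_pmf \<mu> / real n ^ 1))"
    using M by (intro exI[of _ M] conjI SUP_upper2[of ?\<mu>]) auto
qed

section \<open>Gluing axis marginals\<close>

lemma axial_shape_finite [simp]: "finite (axial_shape k d)"
  by (simp add: axial_shape_def segment_def)

lemma segment_subset_axial_shape: "i < d \<Longrightarrow> segment k i \<subseteq> axial_shape k d"
  by (auto simp: axial_shape_def)

text \<open>Measures on the segments with a common law at the origin are glued by choosing the letter at the
  origin first and then all segments independently, given that letter.\<close>

lemma glue_segments:
  fixes \<sigma> :: "nat \<Rightarrow> (nat \<Rightarrow> 'a::finite) pmf"
  assumes "k \<ge> 1" "d \<ge> 1"
    and \<sigma>: "\<And>i. i < d \<Longrightarrow> \<sigma> i \<in> probs {..<k}"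
    and origin: "\<And>i. i < d \<Longrightarrow> map_pmf (\<lambda>u. u 0) (\<sigma> i) = \<alpha>"
  shows "\<exists>g\<in>probs (axial_shape k d). \<forall>i<d. map_pmf (axis_word k i) g = \<sigma> i"
proof -
  define ax :: "site \<Rightarrow> nat" where "ax s = (if \<exists>i. s i \<noteq> 0 then (LEAST i. s i \<noteq> 0) else 0)" for s
  define glue :: "(nat \<Rightarrow> nat \<Rightarrow> 'a) \<Rightarrow> site \<Rightarrow> 'a"
    where "glue U = restrict (\<lambda>s. U (ax s) (nat (s (ax s)))) (axial_shape k d)" for U
  define C where "C a i = cond_pmf (\<sigma> i) {u. u 0 = a}" for a i
  define g where "g = bind_pmf \<alpha> (\<lambda>a. map_pmf glue (Pi_pmf {..<d} undefined (C a)))"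
  have ne: "set_pmf (\<sigma> i) \<inter> {u. u 0 = a} \<noteq> {}" if "i < d" "a \<in> set_pmf \<alpha>" for a i
    using that unfolding origin[OF that(1), symmetric] by auto
  have ax0: "ax (axis_point i 0) = 0" for i by (simp add: ax_def axis_point_def)
  have axS: "ax (axis_point i t) = i" if "t > 0" for i t
  proof -
    have "(LEAST j. axis_point i t j \<noteq> 0) = i"
      using that by (intro Least_equality) (auto simp: axis_point_def split: if_splits)
    moreover have "axis_point i t i \<noteq> 0" using that by (simp add: axis_point_def)
    ultimately show ?thesis by (auto simp: ax_def)
  qed
  have word: "axis_word k i (glue U) = U i"
    if "i < d" "\<And>j. j < d \<Longrightarrow> U j \<in> configs {..<k} \<and> U j 0 = a" for i U a
  proof
    fix t
    have mem: "axis_point i t \<in> axial_shape k d" if "t < k"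
      using \<open>i < d\<close> that by (auto simp: axial_shape_def segment_def)
    show "axis_word k i (glue U) t = U i t"
    proof (cases "t < k")
      case True
      show ?thesis
      proof (cases "t = 0")
        case True
        then show ?thesis using mem that \<open>k \<ge> 1\<close> \<open>d \<ge> 1\<close>
          by (simp add: axis_word_def glue_def ax0) (simp add: axis_point_def)
      next
        case False
        then show ?thesis using mem \<open>t < k\<close>
          by (simp add: axis_word_def glue_def axS) (simp add: axis_point_def)
      qed
    next
      case False
      then show ?thesis using that(1) that(2)[of i]
        by (auto simp: axis_word_def configs_def PiE_def extensional_def)
    qed
  qed
  have "map_pmf (axis_word k i) g = \<sigma> i" if i: "i < d" for i
  proof -
    have "map_pmf (axis_word k i) g
        = bind_pmf \<alpha> (\<lambda>a. map_pmf (\<lambda>U. axis_word k i (glue U)) (Pi_pmf {..<d} undefined (C a)))"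
      by (simp add: g_def map_bind_pmf pmf.map_comp o_def)
    also have "\<dots> = bind_pmf \<alpha> (\<lambda>a. map_pmf (\<lambda>U. U i) (Pi_pmf {..<d} undefined (C a)))"
    proof (intro bind_pmf_cong refl map_pmf_cong)
      fix a U assume a: "a \<in> set_pmf \<alpha>" and U: "U \<in> set_pmf (Pi_pmf {..<d} undefined (C a))"
      have "U j \<in> configs {..<k} \<and> U j 0 = a" if "j < d" for j
      proof -
        have "U j \<in> set_pmf (C a j)" using U that by (auto simp: set_Pi_pmf PiE_dflt_def)
        then show ?thesis using ne[OF that a] \<sigma>[OF that] by (auto simp: C_def probs_def)
      qed
      then show "axis_word k i (glue U) = U i" by (rule word[OF i])
    qed
    also have "\<dots> = bind_pmf \<alpha> (\<lambda>a. C a i)"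
      using i by (simp add: Pi_pmf_component)
    also have "\<dots> = \<sigma> i"
      unfolding C_def
    proof (rule bind_cond_pmf_cancel)
      fix a u assume "a \<in> set_pmf \<alpha>" "u \<in> set_pmf (\<sigma> i)" "u 0 = a"
      have "measure_pmf.prob (\<sigma> i) {y. y 0 = a} = pmf (map_pmf (\<lambda>u. u 0) (\<sigma> i)) a"
        by (simp add: pmf_map vimage_def)
      also have "\<dots> = measure_pmf.prob \<alpha> {x. u 0 = x}"
        using \<open>u 0 = a\<close> by (simp add: origin[OF i] measure_pmf_single)
      finally show "measure_pmf.prob (\<sigma> i) {y. y 0 = a} = measure_pmf.prob \<alpha> {x. u 0 = x}" .
    qed (use ne[OF i] origin[OF i] in auto)
    finally show ?thesis .
  qed
  moreover have "g \<in> probs (axial_shape k d)"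
    by (auto simp: g_def probs_def glue_def)
  ultimately show ?thesis by blast
qed


lemma pmf_map_eq_sum:
  assumes "finite X" "set_pmf \<mu> \<subseteq> X"
  shows "pmf (map_pmf h \<mu>) u = (\<Sum>x\<in>{x\<in>X. h x = u}. pmf \<mu> x)"
proof -
  have "X \<inter> h -` {u} = {x\<in>X. h x = u}" by auto
  then show ?thesis by (simp add: pmf_map prob_eq_sum_pmf[OF assms])
qed

text \<open>A pattern \<open>x\<close> is kept with probability \<open>\<Prod>\<^sub>i min 1 (\<nu>/\<rho>)\<close>, evaluated at its axis words; the kept mass has
  axis marginals below \<open>\<nu>\<close>, and the missing mass is filled in by gluing the residuals.\<close>

lemma glue_near:
  fixes \<Lambda> :: "(site \<Rightarrow> 'a::finite) pmf"
  assumes k: "k \<ge> 1" and d: "d \<ge> 1"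
    and \<Lambda>: "\<Lambda> \<in> probs (axial_shape k d)"
    and \<rho>: "\<And>i. i < d \<Longrightarrow> map_pmf (axis_word k i) \<Lambda> = \<rho>"
    and \<nu>: "\<nu> \<in> probs {..<k}"
  shows "\<exists>\<Lambda>'\<in>probs (axial_shape k d). (\<forall>i<d. map_pmf (axis_word k i) \<Lambda>' = \<nu>)
            \<and> tv_dist \<Lambda> \<Lambda>' \<le> d * tv_dist \<rho> \<nu>"
proof -
  define X where "X = (configs (axial_shape k d) :: (site \<Rightarrow> 'a) set)"
  define K where "K = (configs {..<k} :: (nat \<Rightarrow> 'a) set)"
  have finX: "finite X" and finK: "finite K" by (auto simp: X_def K_def finite_configs)
  have setL: "set_pmf \<Lambda> \<subseteq> X" using \<Lambda> by (simp add: X_def probs_def)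
  have setN: "set_pmf \<nu> \<subseteq> K" using \<nu> by (simp add: K_def probs_def)
  have "set_pmf (map_pmf (axis_word k 0) \<Lambda>) \<subseteq> K" by (auto simp: K_def)
  then have setR: "set_pmf \<rho> \<subseteq> K" using \<rho>[of 0] d by simp
  have axK: "axis_word k i x \<in> K" for i x by (simp add: K_def)
  have one: "(\<Sum>x\<in>X. pmf \<Lambda> x) = 1" "(\<Sum>u\<in>K. pmf \<nu> u) = 1"
    by (rule sum_pmf_eq_1[OF finX setL], rule sum_pmf_eq_1[OF finK setN])
  \<comment> \<open>The value \<open>1\<close> at \<open>\<rho> u = 0\<close> makes \<open>\<rho> u * (1 - f u)\<close> equal to \<open>max 0 (\<rho> u - \<nu> u)\<close> for all \<open>u\<close>.\<close>
  define f where "f u = (if pmf \<rho> u = 0 then 1 else min 1 (pmf \<nu> u / pmf \<rho> u))" for u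
  have f01: "0 \<le> f u" "f u \<le> 1" for u by (auto simp: f_def)
  have f\<rho>: "pmf \<rho> u * f u \<le> pmf \<nu> u" for u
    by (cases "pmf \<rho> u = 0") (auto simp: f_def min_def field_simps pmf_nonneg)
  have f1: "pmf \<rho> u * (1 - f u) = max 0 (pmf \<rho> u - pmf \<nu> u)" for u
  proof (cases "pmf \<rho> u = 0")
    case False
    then have "pmf \<rho> u > 0" by (simp add: order_less_le)
    then show ?thesis by (auto simp: f_def min_def max_def field_simps)
  qed (simp add: f_def)
  define F where "F x = (\<Prod>i<d. f (axis_word k i x))" for x :: "site \<Rightarrow> 'a"
  have F01: "0 \<le> F x" "F x \<le> 1" for x
    using f01 by (auto simp: F_def intro: prod_nonneg prod_le_1)
  have Ff: "F x \<le> f (axis_word k i x)" if "i < d" for x i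
  proof -
    have "F x = f (axis_word k i x) * (\<Prod>j\<in>{..<d}-{i}. f (axis_word k j x))"
      unfolding F_def using that by (intro prod.remove) auto
    also have "\<dots> \<le> f (axis_word k i x) * 1"
      using f01 by (intro mult_left_mono prod_le_1) auto
    finally show ?thesis by simp
  qed
  have F1: "1 - F x \<le> (\<Sum>i<d. 1 - f (axis_word k i x))" for x
    using Weierstrass_prod_ineq[of "{..<d}" "\<lambda>i. 1 - f (axis_word k i x)"] f01 by (simp add: F_def)
  define \<tau> where "\<tau> = (\<Sum>x\<in>X. pmf \<Lambda> x * (1 - F x))"
  have \<tau>0: "\<tau> \<ge> 0" unfolding \<tau>_def using F01 by (intro sum_nonneg mult_nonneg_nonneg) (auto simp: pmf_nonneg)
  have group: "(\<Sum>u\<in>K. \<Sum>x\<in>{x\<in>X. axis_word k i x = u}. h x) = (\<Sum>x\<in>X. h x)" for h :: "_ \<Rightarrow> real" and i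
    by (rule sum.group) (use finX finK axK in auto)
  have \<tau>_le: "\<tau> \<le> d * tv_dist \<rho> \<nu>"
  proof -
    have "\<tau> \<le> (\<Sum>x\<in>X. \<Sum>i<d. pmf \<Lambda> x * (1 - f (axis_word k i x)))"
      unfolding \<tau>_def sum_distrib_left[symmetric] using F1
      by (intro sum_mono mult_left_mono) (auto simp: pmf_nonneg)
    also have "\<dots> = (\<Sum>i<d. \<Sum>x\<in>X. pmf \<Lambda> x * (1 - f (axis_word k i x)))" by (rule sum.swap)
    also have "\<dots> = (\<Sum>i<d. \<Sum>u\<in>K. pmf \<rho> u * (1 - f u))"
    proof (rule sum.cong[OF refl])
      fix i assume "i \<in> {..<d}"
      then have "pmf \<rho> u = (\<Sum>x\<in>{x\<in>X. axis_word k i x = u}. pmf \<Lambda> x)" for u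
        using pmf_map_eq_sum[OF finX setL, of "axis_word k i" u] \<rho>[of i] by simp
      then have "(\<Sum>u\<in>K. pmf \<rho> u * (1 - f u))
          = (\<Sum>u\<in>K. \<Sum>x\<in>{x\<in>X. axis_word k i x = u}. pmf \<Lambda> x * (1 - f (axis_word k i x)))"
        by (simp add: sum_distrib_right)
      then show "(\<Sum>x\<in>X. pmf \<Lambda> x * (1 - f (axis_word k i x))) = (\<Sum>u\<in>K. pmf \<rho> u * (1 - f u))"
        by (simp only: group)
    qed
    also have "\<dots> = d * (\<Sum>u\<in>K. max 0 (pmf \<rho> u - pmf \<nu> u))" by (simp add: f1)
    also have "\<dots> \<le> d * tv_dist \<rho> \<nu>"
      by (intro mult_left_mono sum_pmf_excess_le_tv_dist finK setR setN) auto
    finally show ?thesis .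
  qed
  define kept where "kept i u = (\<Sum>x\<in>{x\<in>X. axis_word k i x = u}. pmf \<Lambda> x * F x)" for i u
  have kept_le: "kept i u \<le> pmf \<nu> u" if "i < d" for i u
  proof -
    have "kept i u \<le> (\<Sum>x\<in>{x\<in>X. axis_word k i x = u}. pmf \<Lambda> x * f u)"
      unfolding kept_def using Ff[OF that] by (intro sum_mono mult_left_mono) (auto simp: pmf_nonneg)
    also have "\<dots> = pmf \<rho> u * f u"
      using pmf_map_eq_sum[OF finX setL, of "axis_word k i" u] \<rho>[OF that] by (simp add: sum_distrib_right)
    finally show ?thesis using f\<rho>[of u] by linarith
  qed
  have kept_sum: "(\<Sum>u\<in>K. kept i u) = 1 - \<tau>" for i
    unfolding kept_def group \<tau>_def by (simp add: right_diff_distrib sum_subtractf one)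
  \<comment> \<open>If no mass is missing, the residuals cannot be normalised, but then \<open>\<rho> = \<nu>\<close> and \<open>\<Lambda>\<close> itself will do.\<close>
  show ?thesis
  proof (cases "\<tau> = 0")
    case True
    have "map_pmf (axis_word k i) \<Lambda> = \<nu>" if i: "i < d" for i
    proof (rule pmf_eqI)
      fix u
      show "pmf (map_pmf (axis_word k i) \<Lambda>) u = pmf \<nu> u"
      proof (cases "u \<in> K")
        case uK: True
        have "(\<Sum>u\<in>K. pmf \<nu> u - kept i u) = 0" by (simp add: sum_subtractf one kept_sum True)
        then have "pmf \<nu> u = kept i u"
          using uK kept_le[OF i] sum_nonneg_eq_0_iff[OF finK, of "\<lambda>u. pmf \<nu> u - kept i u"] by simp
        also have "\<dots> = (\<Sum>x\<in>{x\<in>X. axis_word k i x = u}. pmf \<Lambda> x)"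
          unfolding kept_def
        proof (rule sum.cong[OF refl])
          fix x assume "x \<in> {x\<in>X. axis_word k i x = u}"
          then have "pmf \<Lambda> x * (1 - F x) = 0"
            using True F01 finX unfolding \<tau>_def
            by (subst (asm) sum_nonneg_eq_0_iff) (auto simp: pmf_nonneg)
          then show "pmf \<Lambda> x * F x = pmf \<Lambda> x" by (auto simp: algebra_simps)
        qed
        finally show ?thesis by (simp add: pmf_map_eq_sum[OF finX setL])
      next
        case False
        then have "pmf \<nu> u = 0" "pmf \<rho> u = 0" using setN setR by (auto simp: set_pmf_iff)
        then show ?thesis using \<rho>[OF i] by simp
      qed
    qed
    then show ?thesis
      using \<Lambda> tv_dist_nonneg[of \<rho> \<nu>] by (intro bexI[of _ \<Lambda>]) auto
  next
    case False
    then have \<tau>pos: "\<tau> > 0" using \<tau>0 by simp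
    define r where "r i u = (if u \<in> K then (pmf \<nu> u - kept i u) / \<tau> else 0)" for i u
    define \<sigma> where "\<sigma> i = embed_pmf (r i)" for i
    have pmf\<sigma>: "pmf (\<sigma> i) u = r i u" if i: "i < d" for i u
      unfolding \<sigma>_def
    proof (rule pmf_embed_pmf)
      show nn: "0 \<le> r i x" for x using kept_le[OF i] \<tau>pos by (simp add: r_def)
      have "(\<integral>\<^sup>+ x. ennreal (r i x) \<partial>count_space UNIV) = (\<integral>\<^sup>+ x. ennreal (r i x) \<partial>count_space K)"
        by (subst nn_integral_count_space_indicator) (auto simp: r_def intro!: nn_integral_cong)
      also have "\<dots> = ennreal (\<Sum>x\<in>K. r i x)"
        using finK nn by (simp add: nn_integral_count_space_finite)
      also have "(\<Sum>x\<in>K. r i x) = 1"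
        using \<tau>pos by (simp add: r_def sum_divide_distrib[symmetric] sum_subtractf one kept_sum)
      finally show "(\<integral>\<^sup>+ x. ennreal (r i x) \<partial>count_space UNIV) = 1" by simp
    qed
    have set\<sigma>: "set_pmf (\<sigma> i) \<subseteq> K" if "i < d" for i
      using pmf\<sigma>[OF that] by (auto simp: set_pmf_iff r_def split: if_splits)
    \<comment> \<open>The kept part is one measure for all axes, so the residuals have the same law at the origin.\<close>
    define orig :: "site" where "orig = axis_point 0 0"
    have orig: "axis_word k i x 0 = x orig" for i x
    proof -
      have "axis_point i 0 = orig" by (auto simp: orig_def axis_point_def fun_eq_iff)
      then show ?thesis using k by (simp add: axis_word_def)
    qed
    have origin: "map_pmf (\<lambda>u. u 0) (\<sigma> i) = map_pmf (\<lambda>u. u 0) (\<sigma> 0)" if i: "i < d" for i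
    proof -
      have "pmf (map_pmf (\<lambda>u. u 0) (\<sigma> i)) b
          = ((\<Sum>u\<in>{u\<in>K. u 0 = b}. pmf \<nu> u) - (\<Sum>x\<in>{x\<in>X. x orig = b}. pmf \<Lambda> x * F x)) / \<tau>" if i: "i < d" for i b
      proof -
        have "(\<Sum>u\<in>{u\<in>K. u 0 = b}. kept i u)
            = (\<Sum>u\<in>{u\<in>K. u 0 = b}. \<Sum>x\<in>{x\<in>{x\<in>X. x orig = b}. axis_word k i x = u}. pmf \<Lambda> x * F x)"
          unfolding kept_def by (intro sum.cong refl) (auto simp: orig[of i, symmetric])
        also have "\<dots> = (\<Sum>x\<in>{x\<in>X. x orig = b}. pmf \<Lambda> x * F x)"
          by (rule sum.group) (use finX finK axK orig in auto)
        finally show ?thesis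
          by (simp add: pmf_map_eq_sum[OF finK set\<sigma>[OF i]] pmf\<sigma>[OF i] r_def sum_subtractf
              sum_divide_distrib[symmetric])
      qed
      from this[OF i] this[of 0] show ?thesis using d by (intro pmf_eqI) simp
    qed
    have "\<sigma> i \<in> probs {..<k}" if "i < d" for i
      using set\<sigma>[OF that] by (simp add: probs_def K_def)
    from glue_segments[OF k d this origin]
    have "\<exists>g\<in>probs (axial_shape k d). \<forall>i<d. map_pmf (axis_word k i) g = \<sigma> i" by assumption
    then obtain g where g: "g \<in> probs (axial_shape k d)" "\<And>i. i < d \<Longrightarrow> map_pmf (axis_word k i) g = \<sigma> i"
      by blast
    have setg: "set_pmf g \<subseteq> X" using g(1) by (simp add: X_def probs_def)
    define \<Lambda>' where "\<Lambda>' = bind_pmf \<Lambda> (\<lambda>x. bind_pmf (bernoulli_pmf (F x)) (\<lambda>b. if b then return_pmf x else g))"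
    have \<Lambda>'X: "set_pmf \<Lambda>' \<subseteq> X" using setL setg by (auto simp: \<Lambda>'_def split: if_splits)
    have pmf': "pmf \<Lambda>' y = pmf \<Lambda> y * F y + \<tau> * pmf g y" if "y \<in> X" for y
    proof -
      have "pmf \<Lambda>' y = (\<Sum>x\<in>X. pmf \<Lambda> x * pmf (bind_pmf (bernoulli_pmf (F x)) (\<lambda>b. if b then return_pmf x else g)) y)"
        unfolding \<Lambda>'_def pmf_bind[of \<Lambda>] using setL by (subst integral_measure_pmf[OF finX]) auto
      also have "\<dots> = (\<Sum>x\<in>X. (if x = y then pmf \<Lambda> y * F y else 0) + pmf \<Lambda> x * (1 - F x) * pmf g y)"
        using F01 by (intro sum.cong refl) (auto simp: pmf_bind algebra_simps indicator_def)
      also have "\<dots> = pmf \<Lambda> y * F y + \<tau> * pmf g y"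
        using finX that by (simp add: sum.distrib \<tau>_def sum_distrib_right)
      finally show ?thesis .
    qed
    have "map_pmf (axis_word k i) \<Lambda>' = \<nu>" if i: "i < d" for i
    proof (rule pmf_eqI)
      fix u
      show "pmf (map_pmf (axis_word k i) \<Lambda>') u = pmf \<nu> u"
      proof (cases "u \<in> K")
        case True
        have "pmf (map_pmf (axis_word k i) \<Lambda>') u
            = kept i u + \<tau> * (\<Sum>y\<in>{y\<in>X. axis_word k i y = u}. pmf g y)"
          by (simp add: pmf_map_eq_sum[OF finX \<Lambda>'X] pmf' sum.distrib kept_def sum_distrib_left)
        also have "(\<Sum>y\<in>{y\<in>X. axis_word k i y = u}. pmf g y) = r i u"
          by (simp add: pmf_map_eq_sum[OF finX setg, symmetric] g(2)[OF i] pmf\<sigma>[OF i])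
        finally show ?thesis using True \<tau>pos by (simp add: r_def)
      next
        case False
        then have "u \<notin> set_pmf (map_pmf (axis_word k i) \<Lambda>')" using axK by auto
        then have "pmf (map_pmf (axis_word k i) \<Lambda>') u = 0" by (simp only: set_pmf_iff not_not)
        moreover have "pmf \<nu> u = 0" using False setN by (auto simp: set_pmf_iff)
        ultimately show ?thesis by simp
      qed
    qed
    moreover have "tv_dist \<Lambda> \<Lambda>' \<le> \<tau>"
    proof (rule tv_dist_leI)
      fix W
      have "measure_pmf.prob \<Lambda> W - measure_pmf.prob \<Lambda>' W
          = (\<Sum>x\<in>X \<inter> W. pmf \<Lambda> x * (1 - F x)) - \<tau> * measure_pmf.prob g W"
        by (simp add: prob_eq_sum_pmf[OF finX setL] prob_eq_sum_pmf[OF finX \<Lambda>'X]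
            prob_eq_sum_pmf[OF finX setg] pmf' sum.distrib sum_distrib_left sum_subtractf algebra_simps)
      moreover have "(\<Sum>x\<in>X \<inter> W. pmf \<Lambda> x * (1 - F x)) \<le> \<tau>"
        unfolding \<tau>_def using F01 finX by (intro sum_mono2) (auto simp: pmf_nonneg)
      moreover have "(\<Sum>x\<in>X \<inter> W. pmf \<Lambda> x * (1 - F x)) \<ge> 0"
        using F01 by (intro sum_nonneg mult_nonneg_nonneg) (auto simp: pmf_nonneg)
      moreover have "0 \<le> \<tau> * measure_pmf.prob g W" "\<tau> * measure_pmf.prob g W \<le> \<tau> * 1"
        using \<tau>0 by (simp, intro mult_left_mono) auto
      ultimately show "\<bar>measure_pmf.prob \<Lambda> W - measure_pmf.prob \<Lambda>' W\<bar> \<le> \<tau>" by linarith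
    qed
    ultimately show ?thesis
      using \<Lambda>'X \<tau>_le by (intro bexI[of _ \<Lambda>']) (auto simp: probs_def X_def)
  qed
qed

section \<open>Typical words of an independent field\<close>

lemma box_eq_PiE_dflt: "box n d = PiE_dflt {..<d} 0 (\<lambda>_. {0..<int n})"
  by (auto simp: box_def lattice_def PiE_dflt_def not_less)

lemma finite_box [simp]: "finite (box n d)"
  unfolding box_eq_PiE_dflt by (intro finite_PiE_dflt) auto

lemma card_box: "card (box n d) = n ^ d"
  unfolding box_eq_PiE_dflt by (subst card_PiE_dflt) auto

lemma box_nonempty [simp]: "n \<ge> 1 \<Longrightarrow> box n d \<noteq> {}"
  using card_box[of n d] by (metis card.empty not_one_le_zero power_not_zero)

lemma axial_shape_lattice: "axial_shape k d \<subseteq> lattice d"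
  by (auto simp: axial_shape_def segment_def lattice_def axis_point_def)

lemma torus_add_in_box:
  assumes "n \<ge> 1" "v \<in> box n d" "s \<in> lattice d"
  shows "site_mod n (site_add v s) \<in> box n d"
  using assms by (auto simp: box_def lattice_def site_mod_def site_add_def)

text \<open>Windows at \<open>v\<close> and \<open>v'\<close> are independent unless they share a site, and then
  \<open>v' = v + s - s'\<close> for some \<open>s, s' \<in> S\<close>; so the variance of a pattern count grows only linearly with the
  size of the box.\<close>

lemma prob_atypical_le:
  fixes q :: "site \<Rightarrow> 'a::finite pmf"
  assumes n: "n \<ge> 1" and S: "finite S" "S \<subseteq> lattice d" and \<eta>: "\<eta> > 0"
  defines "\<mu> \<equiv> Pi_pmf (box n d) undefined q"
  defines "c \<equiv> real (card (configs S :: (site \<Rightarrow> 'a) set))"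
  shows "measure_pmf.prob \<mu> {w. tv_dist (empirical n d S w) (avg_marginal n d S \<mu>) > \<eta>}
       \<le> c\<^sup>2 * (real (card S))\<^sup>2 / (\<eta>\<^sup>2 * real n ^ d)"
proof -
  define A where "A = box n d"
  define C where "C = (configs S :: (site \<Rightarrow> 'a) set)"
  define N where "N = real (card A)"
  have finA: "finite A" "A \<noteq> {}" using n by (auto simp: A_def)
  have N: "N > 0" using finA by (simp add: N_def card_gt_0_iff)
  have finC: "finite C" using S by (simp add: C_def finite_configs)
  have fin\<mu>: "finite (set_pmf \<mu>)"
    unfolding \<mu>_def by (subst set_Pi_pmf) (auto intro: finite_PiE_dflt)
  note int = integrable_measure_pmf_finite[OF fin\<mu>]
  define E where "E x v = {w. window n S w v = x}" for x :: "site \<Rightarrow> 'a" and v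
  define T where "T v = (\<lambda>s. site_mod n (site_add v s)) ` S" for v
  have TA: "T v \<subseteq> A" if "v \<in> A" for v
    using that n S(2) by (auto simp: T_def A_def intro: torus_add_in_box)
  have emp: "pmf (empirical n d S w) x = (\<Sum>v\<in>A. indicator (E x v) w) / N" for w x
  proof -
    have "pmf (empirical n d S w) x = (\<Sum>v\<in>A. pmf (return_pmf (window n S w v)) x) / N"
      unfolding empirical_def map_pmf_def A_def[symmetric] N_def
      by (rule pmf_bind_pmf_of_set[OF finA])
    also have "\<dots> = (\<Sum>v\<in>A. indicator (E x v) w) / N"
      by (intro arg_cong2[where f="(/)"] sum.cong refl) (auto simp: E_def indicator_def)
    finally show ?thesis .
  qed
  have avg: "pmf (avg_marginal n d S \<mu>) x = (\<Sum>v\<in>A. measure_pmf.prob \<mu> (E x v)) / N" for x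
    unfolding avg_marginal_def A_def[symmetric] N_def
    by (subst pmf_bind_pmf_of_set[OF finA]) (simp add: pmf_map E_def vimage_def)
  define Z where "Z x w = pmf (empirical n d S w) x - pmf (avg_marginal n d S \<mu>) x" for x w
  \<comment> \<open>Showing \<open>x\<close> at \<open>v\<close> is a product event; for disjoint windows, at every site one of the two events
    puts no constraint.\<close>
  have indep: "measure_pmf.prob \<mu> (E x v \<inter> E x v') = measure_pmf.prob \<mu> (E x v) * measure_pmf.prob \<mu> (E x v')"
    if x: "x \<in> C" and v: "v \<in> A" "v' \<in> A" and disj: "T v \<inter> T v' = {}" for x v v'
  proof -
    define B where "B v u = {a. \<forall>s\<in>S. site_mod n (site_add v s) = u \<longrightarrow> a = x s}" for v u
    have EB: "E x v = Pi A (B v)" if "v \<in> A" for v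
    proof (intro set_eqI iffI)
      fix w assume "w \<in> Pi A (B v)"
      then have "w (site_mod n (site_add v s)) = x s" if "s \<in> S" for s
        using TA[OF \<open>v \<in> A\<close>] that by (auto simp: Pi_def B_def T_def)
      then show "w \<in> E x v"
        using x by (auto simp: E_def window_def C_def configs_def PiE_def extensional_def restrict_def fun_eq_iff)
    qed (auto simp: E_def window_def B_def Pi_def)
    have Buniv: "B v u = UNIV" if "u \<notin> T v" for v u using that by (auto simp: B_def T_def)
    have "E x v \<inter> E x v' = Pi A (\<lambda>u. B v u \<inter> B v' u)" using EB v by auto
    then have "measure_pmf.prob \<mu> (E x v \<inter> E x v') = (\<Prod>u\<in>A. measure_pmf.prob (q u) (B v u \<inter> B v' u))"
      using finA by (simp add: \<mu>_def A_def measure_Pi_pmf_Pi)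
    also have "\<dots> = (\<Prod>u\<in>A. measure_pmf.prob (q u) (B v u) * measure_pmf.prob (q u) (B v' u))"
    proof (rule prod.cong[OF refl])
      fix u
      have "u \<notin> T v \<or> u \<notin> T v'" using disj by auto
      then show "measure_pmf.prob (q u) (B v u \<inter> B v' u)
          = measure_pmf.prob (q u) (B v u) * measure_pmf.prob (q u) (B v' u)"
        by (auto simp: Buniv)
    qed
    also have "\<dots> = measure_pmf.prob \<mu> (E x v) * measure_pmf.prob \<mu> (E x v')"
      using finA v by (simp add: EB prod.distrib \<mu>_def A_def measure_Pi_pmf_Pi)
    finally show ?thesis .
  qed
  define near where "near = {(v, v') \<in> A \<times> A. T v \<inter> T v' \<noteq> {}}"
  have near: "real (card near) \<le> N * (real (card S))\<^sup>2"
  proof -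
    have "near \<subseteq> (\<lambda>(v, s, s'). (v, site_mod n (\<lambda>i. v i + s i - s' i))) ` (A \<times> S \<times> S)"
    proof
      fix p assume "p \<in> near"
      then obtain v v' s s' where p: "p = (v, v')" "v \<in> A" "v' \<in> A" "s \<in> S" "s' \<in> S"
        "site_mod n (site_add v s) = site_mod n (site_add v' s')"
        by (auto simp: near_def T_def)
      have "v' = site_mod n (\<lambda>i. v i + s i - s' i)"
      proof
        fix i
        have "(v i + s i) mod int n = (v' i + s' i) mod int n"
          using p(6) by (auto simp: site_mod_def site_add_def fun_eq_iff)
        then have "(v i + s i - s' i) mod int n = (v' i + s' i - s' i) mod int n"
          by (metis mod_diff_left_eq)
        moreover have "v' i mod int n = v' i"
          using p(3) n by (cases "i < d") (auto simp: A_def box_def lattice_def)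
        ultimately show "v' i = site_mod n (\<lambda>i. v i + s i - s' i) i" by (simp add: site_mod_def)
      qed
      then show "p \<in> (\<lambda>(v, s, s'). (v, site_mod n (\<lambda>i. v i + s i - s' i))) ` (A \<times> S \<times> S)"
        using p by (intro image_eqI[of _ _ "(v, s, s')"]) auto
    qed
    then have "card near \<le> card (A \<times> S \<times> S)"
      using finA S by (meson card_image_le card_mono finite_SigmaI finite_imageI le_trans)
    then show ?thesis using finA by (simp add: N_def card_cartesian_product power2_eq_square)
        (metis mult.assoc of_nat_le_iff of_nat_mult)
  qed
  have var: "measure_pmf.expectation \<mu> (\<lambda>w. (Z x w)\<^sup>2) \<le> (real (card S))\<^sup>2 / N" if x: "x \<in> C" for x
  proof -
    define P where "P v = measure_pmf.prob \<mu> (E x v)" for v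
    have P01: "0 \<le> P v" "P v \<le> 1" for v by (auto simp: P_def)
    have Z: "Z x w = (\<Sum>v\<in>A. indicator (E x v) w - P v) / N" for w
      by (simp add: Z_def emp avg P_def sum_subtractf diff_divide_distrib)
    have "measure_pmf.expectation \<mu> (\<lambda>w. (Z x w)\<^sup>2)
        = measure_pmf.expectation \<mu> (\<lambda>w. \<Sum>(v, v')\<in>A \<times> A. (indicator (E x v) w - P v) * (indicator (E x v') w - P v')) / N\<^sup>2"
      by (simp add: Z power_divide power2_eq_square[of "sum _ _"] sum_product sum.cartesian_product)
    also have "measure_pmf.expectation \<mu> (\<lambda>w. \<Sum>(v, v')\<in>A \<times> A. (indicator (E x v) w - P v) * (indicator (E x v') w - P v'))
        = (\<Sum>(v, v')\<in>A \<times> A. measure_pmf.expectation \<mu> (\<lambda>w. (indicator (E x v) w - P v) * (indicator (E x v') w - P v')))"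
      by (subst Bochner_Integration.integral_sum) (auto intro: int simp: case_prod_unfold)
    also have "\<dots> = (\<Sum>(v, v')\<in>A \<times> A. measure_pmf.prob \<mu> (E x v \<inter> E x v') - P v * P v')"
    proof (intro sum.cong refl, clarify)
      fix v v'
      have "measure_pmf.expectation \<mu> (\<lambda>w. (indicator (E x v) w - P v) * (indicator (E x v') w - P v'))
          = measure_pmf.expectation \<mu> (\<lambda>w. indicator (E x v \<inter> E x v') w - P v' * indicator (E x v) w
              - P v * indicator (E x v') w + P v * P v')"
        by (intro Bochner_Integration.integral_cong refl) (auto simp: indicator_def algebra_simps)
      also have "\<dots> = measure_pmf.prob \<mu> (E x v \<inter> E x v') - P v' * P v - P v * P v' + P v * P v'"
        by (simp add: int P_def)
      finally show "measure_pmf.expectation \<mu> (\<lambda>w. (indicator (E x v) w - P v) * (indicator (E x v') w - P v'))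
          = measure_pmf.prob \<mu> (E x v \<inter> E x v') - P v * P v'" by simp
    qed
    also have "\<dots> \<le> (\<Sum>p\<in>A \<times> A. if p \<in> near then 1 else 0)"
    proof (intro sum_mono, clarify)
      fix v v' assume v: "v \<in> A" "v' \<in> A"
      have "measure_pmf.prob \<mu> (E x v \<inter> E x v') \<le> 1" "0 \<le> P v * P v'" using P01 by auto
      moreover have "measure_pmf.prob \<mu> (E x v \<inter> E x v') = P v * P v'" if "(v, v') \<notin> near"
        using indep[OF x v] that v by (auto simp: near_def P_def)
      ultimately show "measure_pmf.prob \<mu> (E x v \<inter> E x v') - P v * P v' \<le> (if (v, v') \<in> near then 1 else 0)"
        by (auto simp del: measure_pmf.prob_le_1)
    qed
    also have "\<dots> = real (card near)"
    proof -
      have "(A \<times> A) \<inter> near = near" by (auto simp: near_def)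
      then show ?thesis using finA by (simp add: sum.If_cases Int_def[symmetric])
    qed
    also have "\<dots> \<le> N * (real (card S))\<^sup>2" by (rule near)
    finally have "measure_pmf.expectation \<mu> (\<lambda>w. (Z x w)\<^sup>2) \<le> N * (real (card S))\<^sup>2 / N\<^sup>2"
      by (simp add: divide_right_mono)
    then show ?thesis using N by (simp add: power2_eq_square)
  qed
  have "measure_pmf.prob \<mu> {w. tv_dist (empirical n d S w) (avg_marginal n d S \<mu>) > \<eta>}
      \<le> measure_pmf.prob \<mu> {w\<in>space \<mu>. c * (\<Sum>x\<in>C. (Z x w)\<^sup>2) \<ge> \<eta>\<^sup>2}"
  proof (rule measure_pmf.finite_measure_mono)
    show "{w. tv_dist (empirical n d S w) (avg_marginal n d S \<mu>) > \<eta>}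
        \<subseteq> {w\<in>space \<mu>. c * (\<Sum>x\<in>C. (Z x w)\<^sup>2) \<ge> \<eta>\<^sup>2}"
    proof safe
      fix w assume w: "\<eta> < tv_dist (empirical n d S w) (avg_marginal n d S \<mu>)"
      have "set_pmf (empirical n d S w) \<subseteq> C" "set_pmf (avg_marginal n d S \<mu>) \<subseteq> C"
        by (auto simp: empirical_def C_def avg_marginal_def)
      then have "\<eta> \<le> (\<Sum>x\<in>C. \<bar>Z x w\<bar>)"
        using tv_dist_le_sum[OF finC, of "empirical n d S w" "avg_marginal n d S \<mu>"] w
        unfolding Z_def by linarith
      then have "\<eta>\<^sup>2 \<le> (\<Sum>x\<in>C. \<bar>Z x w\<bar>)\<^sup>2" using \<eta> by (intro power_mono) auto
      also have "\<dots> \<le> (\<Sum>x\<in>C. \<bar>Z x w\<bar>\<^sup>2) * card C" by (rule sum_squared_le_sum_of_squares)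
      finally show "\<eta>\<^sup>2 \<le> c * (\<Sum>x\<in>C. (Z x w)\<^sup>2)" by (simp add: c_def C_def mult.commute)
    qed auto
  qed auto
  also have "\<dots> \<le> measure_pmf.expectation \<mu> (\<lambda>w. c * (\<Sum>x\<in>C. (Z x w)\<^sup>2)) / \<eta>\<^sup>2"
    using \<eta> by (intro integral_Markov_inequality_measure[where A="{}"] int)
      (auto simp: c_def intro!: AE_I2 mult_nonneg_nonneg sum_nonneg)
  also have "measure_pmf.expectation \<mu> (\<lambda>w. c * (\<Sum>x\<in>C. (Z x w)\<^sup>2))
      = c * (\<Sum>x\<in>C. measure_pmf.expectation \<mu> (\<lambda>w. (Z x w)\<^sup>2))"
    by (simp add: Bochner_Integration.integral_sum int)
  also have "\<dots> \<le> c * (\<Sum>x\<in>C. (real (card S))\<^sup>2 / N)"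
    by (intro mult_left_mono sum_mono var) (auto simp: c_def)
  also have "\<dots> = c\<^sup>2 * (real (card S))\<^sup>2 / N"
    by (simp add: c_def C_def power2_eq_square)
  finally show ?thesis
    using \<eta> by (simp add: N_def A_def card_box divide_right_mono mult.commute)
qed

section \<open>Capacity is at least the independence entropy\<close>

definition phase :: "nat \<Rightarrow> nat \<Rightarrow> site \<Rightarrow> nat" where
  "phase M d v = nat ((\<Sum>i<d. v i) mod int M)"

lemma phase_torus_add:
  assumes M: "M \<ge> 1" "M dvd n" and i: "i < d"
  shows "phase M d (site_mod n (site_add v (axis_point i t))) = (phase M d v + t) mod M"
proof -
  have "(\<Sum>j<d. site_mod n (site_add v (axis_point i t)) j) mod int M
      = (\<Sum>j<d. site_mod n (site_add v (axis_point i t)) j mod int M) mod int M"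
    by (rule mod_sum_eq[symmetric])
  also have "\<dots> = (\<Sum>j<d. (v j + axis_point i t j) mod int M) mod int M"
    using M by (simp add: site_mod_def site_add_def mod_mod_cancel)
  also have "\<dots> = (\<Sum>j<d. v j + axis_point i t j) mod int M"
    by (rule mod_sum_eq)
  also have "(\<Sum>j<d. v j + axis_point i t j) = (\<Sum>j<d. v j) + int t"
    using i by (simp add: sum.distrib axis_point_def)
  also have "((\<Sum>j<d. v j) + int t) mod int M = ((\<Sum>j<d. v j) mod int M + int t) mod int M"
    by (simp add: mod_add_left_eq)
  finally have "(\<Sum>j<d. site_mod n (site_add v (axis_point i t)) j) mod int M
      = int ((phase M d v + t) mod M)"
    using M by (simp add: phase_def zmod_int)
  then show ?thesis by (simp add: phase_def)
qed

lemma phase_less: "M \<ge> 1 \<Longrightarrow> phase M d v < M"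
  by (simp add: phase_def nat_less_iff)

text \<open>The uniform measure on the box is invariant under the cyclic shift along an axis, which advances the
  phase by one; so the phase is uniformly distributed.\<close>

lemma phase_uniform:
  assumes M: "M \<ge> 1" "M dvd n" and n: "n \<ge> 1" and d: "d \<ge> 1"
  shows "map_pmf (phase M d) (pmf_of_set (box n d)) = pmf_of_set {..<M}"
proof -
  define sh where "sh v = site_mod n (site_add v (axis_point 0 1))" for v
  have into: "sh ` box n d \<subseteq> box n d"
    using n d by (auto simp: sh_def lattice_def axis_point_def intro!: torus_add_in_box)
  have "inj_on sh (box n d)"
  proof (rule inj_onI)
    fix v v' assume v: "v \<in> box n d" "v' \<in> box n d" and eq: "sh v = sh v'"
    show "v = v'"
    proof
      fix i
      have "(v i + axis_point 0 1 i) mod int n = (v' i + axis_point 0 1 i) mod int n"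
        using eq by (auto simp: sh_def site_mod_def site_add_def fun_eq_iff)
      then have "(v i + axis_point 0 1 i - axis_point 0 1 i) mod int n
          = (v' i + axis_point 0 1 i - axis_point 0 1 i) mod int n"
        by (metis mod_diff_left_eq)
      moreover have "v i mod int n = v i" "v' i mod int n = v' i"
        using v n by (cases "i < d"; auto simp: box_def lattice_def)+
      ultimately show "v i = v' i" by simp
    qed
  qed
  then have inv: "map_pmf sh (pmf_of_set (box n d)) = pmf_of_set (box n d)"
    using n into by (subst map_pmf_of_set_inj) (auto simp: endo_inj_surj)
  define P where "P = map_pmf (phase M d) (pmf_of_set (box n d))"
  have "map_pmf (phase M d) (pmf_of_set (box n d))
      = map_pmf (phase M d) (map_pmf sh (pmf_of_set (box n d)))"
    by (simp only: inv)
  also have "\<dots> = map_pmf (\<lambda>v. (phase M d v + 1) mod M) (pmf_of_set (box n d))"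
    unfolding pmf.map_comp o_def sh_def using d
    by (intro map_pmf_cong refl phase_torus_add[OF M]) simp
  also have "\<dots> = map_pmf (\<lambda>y. (y + 1) mod M) (map_pmf (phase M d) (pmf_of_set (box n d)))"
    by (simp only: pmf.map_comp o_def)
  finally have "map_pmf (phase M d) (pmf_of_set (box n d))
      = map_pmf (\<lambda>y. (y + 1) mod M) (map_pmf (phase M d) (pmf_of_set (box n d)))" .
  then have P: "P = map_pmf (\<lambda>y. (y + 1) mod M) P" unfolding P_def .
  have setP: "set_pmf P \<subseteq> {..<M}" using phase_less[OF M(1)] by (auto simp: P_def)
  have step: "pmf P (Suc y) = pmf P y" if "Suc y < M" for y
  proof -
    have "pmf P (Suc y) = (\<Sum>x\<in>{x\<in>{..<M}. (x + 1) mod M = Suc y}. pmf P x)"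
      by (subst P, rule pmf_map_eq_sum[OF _ setP]) simp
    also have "{x\<in>{..<M}. (x + 1) mod M = Suc y} = {y}"
    proof (intro set_eqI iffI)
      fix x assume x: "x \<in> {x\<in>{..<M}. (x + 1) mod M = Suc y}"
      then show "x \<in> {y}" by (cases "x + 1 = M") auto
    qed (use that in auto)
    finally show ?thesis by simp
  qed
  have const: "pmf P y = pmf P 0" if "y < M" for y
    using that by (induction y) (auto simp: step)
  have "(\<Sum>y<M. pmf P y) = 1" by (rule sum_pmf_eq_1) (use setP in auto)
  moreover have "(\<Sum>y<M. pmf P y) = (\<Sum>y<M. pmf P 0)"
    by (rule sum.cong[OF refl]) (use const in blast)
  ultimately have P0: "pmf P 0 = 1 / M" using M by (simp add: field_simps)
  have "pmf P y = pmf (pmf_of_set {..<M}) y" for y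
  proof (cases "y < M")
    case True
    then have "pmf P y = 1 / M" using const P0 by metis
    then show ?thesis using M True by (subst pmf_of_set) (auto simp: lessThan_empty_iff)
  next
    case False
    then have "pmf P y = 0" using setP by (auto simp: set_pmf_iff)
    then show ?thesis using False M by (subst pmf_of_set) (auto simp: lessThan_empty_iff)
  qed
  then show ?thesis unfolding P_def[symmetric] by (rule pmf_eqI)
qed

text \<open>If the letter at \<open>v\<close> is drawn from \<open>q\<close> at the phase of \<open>v\<close>, every axis-parallel line carries the
  sequence \<open>q\<close>, up to a shift. So all axis marginals are the averaged marginal of \<open>q\<close>, and the entropy
  per site is that of \<open>q\<close>.\<close>

lemma axis_marginal_phase_field:
  assumes M: "M \<ge> 1" "M dvd n" "k \<le> M" and n: "n \<ge> 1" and i: "i < d"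
  shows "map_pmf (axis_word k i) (avg_marginal n d (axial_shape k d)
           (Pi_pmf (box n d) undefined (\<lambda>v. q (phase M d v)))) = seq_marginal M k q"
proof -
  let ?\<mu> = "Pi_pmf (box n d) undefined (\<lambda>v. q (phase M d v))"
  let ?f = "\<lambda>v t. site_mod n (site_add v (axis_point i t))"
  have "map_pmf (axis_word k i) (avg_marginal n d (axial_shape k d) ?\<mu>)
      = bind_pmf (pmf_of_set (box n d)) (\<lambda>v. map_pmf (\<lambda>w. restrict (\<lambda>t. w (?f v t)) {..<k}) ?\<mu>)"
    by (simp add: avg_marginal_def map_bind_pmf pmf.map_comp o_def
        axis_word_window[OF segment_subset_axial_shape[OF i]])
  also have "\<dots> = bind_pmf (pmf_of_set (box n d))
      (\<lambda>v. Pi_pmf {..<k} undefined (\<lambda>t. q ((phase M d v + t) mod M)))"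
  proof (intro bind_pmf_cong refl)
    fix v assume "v \<in> set_pmf (pmf_of_set (box n d))"
    then have v: "v \<in> box n d" using n by simp
    have "map_pmf (\<lambda>w. restrict (\<lambda>t. w (?f v t)) {..<k}) ?\<mu>
        = Pi_pmf {..<k} undefined (\<lambda>t. q (phase M d (?f v t)))"
    proof (rule Pi_pmf_pullback)
      show "inj_on (?f v) {..<k}"
      proof (rule inj_onI)
        fix s t assume st: "s \<in> {..<k}" "t \<in> {..<k}" "?f v s = ?f v t"
        have "phase M d (?f v s) = phase M d (?f v t)" by (simp only: st(3))
        then have "(phase M d v + s) mod M = (phase M d v + t) mod M"
          by (simp only: phase_torus_add[OF M(1,2) i])
        then show "s = t" using inj_onD[OF inj_on_add_mod[OF M(3)] _ st(1,2)] by blast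
      qed
      show "?f v ` {..<k} \<subseteq> box n d"
        using v n i by (auto intro!: torus_add_in_box simp: lattice_def axis_point_def)
    qed simp
    then show "map_pmf (\<lambda>w. restrict (\<lambda>t. w (?f v t)) {..<k}) ?\<mu>
        = Pi_pmf {..<k} undefined (\<lambda>t. q ((phase M d v + t) mod M))"
      by (simp only: phase_torus_add[OF M(1,2) i])
  qed
  also have "\<dots> = bind_pmf (map_pmf (phase M d) (pmf_of_set (box n d)))
      (\<lambda>x. Pi_pmf {..<k} undefined (\<lambda>t. q ((x + t) mod M)))"
    by (simp add: bind_map_pmf)
  also have "\<dots> = seq_marginal M k q"
    using i by (subst phase_uniform[OF M(1,2) n]) (auto simp: seq_marginal_def)
  finally show ?thesis .
qed

lemma entropy_phase_field:
  fixes q :: "nat \<Rightarrow> 'a::finite pmf"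
  assumes M: "M \<ge> 1" "M dvd n" and n: "n \<ge> 1" and d: "d \<ge> 1"
  shows "entropy_pmf (Pi_pmf (box n d) undefined (\<lambda>v. q (phase M d v)))
       = real n ^ d * ((\<Sum>x<M. entropy_pmf (q x)) / M)"
proof -
  have "(\<Sum>v\<in>box n d. entropy_pmf (q (phase M d v)))
      = real n ^ d * measure_pmf.expectation (map_pmf (phase M d) (pmf_of_set (box n d))) (\<lambda>x. entropy_pmf (q x))"
    unfolding integral_map_pmf integral_pmf_of_set[OF box_nonempty[OF n] finite_box] card_box
    using n by simp
  also have "measure_pmf.expectation (map_pmf (phase M d) (pmf_of_set (box n d))) (\<lambda>x. entropy_pmf (q x))
      = (\<Sum>x<M. entropy_pmf (q x)) / M"
    unfolding phase_uniform[OF assms] using M by (subst integral_pmf_of_set) (auto simp: lessThan_empty_iff)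
  finally show ?thesis by (simp add: entropy_Pi_pmf)
qed

lemma empirical_in_probs [simp]: "empirical n d S w \<in> probs S"
  by (auto simp: probs_def empirical_def)

lemma finite_admissible [simp]: "finite (admissible n d S \<Gamma> :: (site \<Rightarrow> 'a::finite) set)"
  unfolding admissible_def by (simp add: finite_configs)

text \<open>An averaged marginal in the \<open>\<epsilon> / (4 * d)\<close>-enlargement has distance less than \<open>\<epsilon> / (2 * d)\<close> from some
  \<open>\<nu> \<in> \<Gamma>\<close>. Gluing multiplies this distance by \<open>d\<close>, and the other \<open>\<epsilon> / 2\<close> is for the fluctuations of the
  empirical measure.\<close>

lemma limsup_admissible_ge:
  fixes \<Gamma> :: "(nat \<Rightarrow> 'a::finite) pmf set"
  assumes k: "k \<ge> 1" and d: "d \<ge> 1" and \<Gamma>: "\<Gamma> \<subseteq> probs {..<k}" and \<epsilon>: "\<epsilon> > 0"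
    and c: "ereal c < h_ind_hat 1 (segment k 0) (enlarge (segment k 0) (\<epsilon> / (4 * real d)) (line_system k \<Gamma>))"
  shows "ereal c \<le> limsup (\<lambda>n. log2_card (admissible n d (axial_shape k d)
           (enlarge (axial_shape k d) \<epsilon> (axial_product k d \<Gamma>))) / ereal (real n ^ d))"
proof -
  let ?S = "axial_shape k d"
  obtain c' where c': "ereal c < ereal c'"
      "ereal c' < h_ind_hat 1 (segment k 0) (enlarge (segment k 0) (\<epsilon> / (4 * real d)) (line_system k \<Gamma>))"
    using ereal_dense2[OF c] by auto
  obtain M q where M: "M \<ge> 1" "M \<ge> k" and q: "seq_marginal M k q \<in> enlarge {..<k} (\<epsilon> / (4 * real d)) \<Gamma>"
      "c' * M \<le> (\<Sum>x<M. entropy_pmf (q x))"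
    using sequence_of_less_h_ind_hat[OF \<Gamma> c'(2)] by blast
  have "\<epsilon> / (4 * real d) < \<epsilon> / (2 * real d)" using \<epsilon> d by (intro divide_strict_left_mono) auto
  moreover have "\<forall>\<delta>>\<epsilon> / (4 * real d). \<exists>\<nu>\<in>\<Gamma>. tv_dist (seq_marginal M k q) \<nu> < \<delta>"
    using q(1) unfolding enlarge_iff by (rule conjunct2)
  ultimately obtain \<nu> where \<nu>: "\<nu> \<in> \<Gamma>" "tv_dist (seq_marginal M k q) \<nu> < \<epsilon> / (2 * real d)"
    by blast
  define C where "C = (real (card (configs ?S :: (site \<Rightarrow> 'a) set)))\<^sup>2 * (real (card ?S))\<^sup>2 / (\<epsilon> / 2)\<^sup>2"
  define a where "a = log 2 (real CARD('a))"
  have C0: "C \<ge> 0" by (simp add: C_def)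
  have "1 \<le> real CARD('a)" by (simp add: Suc_le_eq)
  then have a0: "a \<ge> 0" unfolding a_def by (rule zero_le_log_cancel_iff[THEN iffD2, rotated 2]) auto
  show ?thesis
  proof (rule le_limsup_of_frequently)
    fix n0
    \<comment> \<open>A multiple of \<open>M\<close> so large that typical words exist and that the constant losses in the count are
      less than \<open>c' - c\<close> per site.\<close>
    define m where "m = max n0 (nat \<lceil>max (C + 1) ((1 + C * a) / (c' - c))\<rceil>)"
    define n where "n = M * (m + 1)"
    have nm: "n \<ge> m + 1" using M mult_le_mono1[of 1 M "m + 1"] by (simp add: n_def)
    then have n: "n \<ge> 1" "n \<ge> n0" "M dvd n" by (auto simp: m_def n_def)
    define V where "V = real n ^ d"
    have "real n ^ 1 \<le> real n ^ d" using n d by (intro power_increasing) auto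
    moreover have "real m + 1 \<le> real n" using nm by linarith
    ultimately have "V \<ge> real m + 1" unfolding V_def power_one_right by linarith
    moreover have "real m \<ge> max (C + 1) ((1 + C * a) / (c' - c))"
      unfolding m_def by (simp only: of_nat_max) linarith
    ultimately have V: "V > C + 1" "V \<ge> (1 + C * a) / (c' - c)" by linarith+
    define \<mu> where "\<mu> = Pi_pmf (box n d) undefined (\<lambda>v. q (phase M d v))"
    define \<Lambda> where "\<Lambda> = avg_marginal n d ?S \<mu>"
    have \<Lambda>: "map_pmf (axis_word k i) \<Lambda> = seq_marginal M k q" if "i < d" for i
      unfolding \<Lambda>_def \<mu>_def using M n that by (intro axis_marginal_phase_field) auto
    obtain \<Lambda>' where \<Lambda>': "\<Lambda>' \<in> probs ?S" "\<And>i. i < d \<Longrightarrow> map_pmf (axis_word k i) \<Lambda>' = \<nu>"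
        "tv_dist \<Lambda> \<Lambda>' \<le> d * tv_dist (seq_marginal M k q) \<nu>"
    proof -
      have "\<Lambda> \<in> probs ?S" "\<nu> \<in> probs {..<k}" using \<nu>(1) \<Gamma> by (auto simp: \<Lambda>_def)
      from glue_near[OF k d this(1) \<Lambda> this(2)] show ?thesis using that by blast
    qed
    have "d * tv_dist (seq_marginal M k q) \<nu> \<le> d * (\<epsilon> / (2 * real d))"
      using \<nu>(2) by (intro mult_left_mono) auto
    then have near: "tv_dist \<Lambda> \<Lambda>' \<le> \<epsilon> / 2" using \<Lambda>'(3) d by simp
    have in_prod: "\<Lambda>' \<in> axial_product k d \<Gamma>" using \<Lambda>' \<nu>(1) by (auto simp: axial_product_def)
    define A where "A = admissible n d ?S (enlarge ?S \<epsilon> (axial_product k d \<Gamma>))"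
    define G where "G = {w \<in> configs (box n d). tv_dist (empirical n d ?S w) \<Lambda> \<le> \<epsilon> / 2}"
    have finG: "finite G" by (simp add: G_def finite_configs)
    have GA: "G \<subseteq> A"
    proof
      fix w assume w: "w \<in> G"
      have "tv_dist (empirical n d ?S w) \<Lambda>' \<le> \<epsilon>"
        using tv_dist_triangle[of "empirical n d ?S w" \<Lambda>' \<Lambda>] near w by (auto simp: G_def)
      then have "empirical n d ?S w \<in> enlarge ?S \<epsilon> (axial_product k d \<Gamma>)"
        using in_prod unfolding enlarge_iff by (auto intro!: bexI[of _ \<Lambda>'])
      then show "w \<in> A" using w by (simp add: A_def admissible_def G_def)
    qed
    have "set_pmf \<mu> \<subseteq> configs (box n d)"
      using Pi_pmf_in_probs[OF finite_box] by (auto simp: \<mu>_def probs_def)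
    note X = finite_configs[OF finite_box] this
    have "measure_pmf.prob \<mu> (- G) \<le> measure_pmf.prob \<mu> {w. tv_dist (empirical n d ?S w) \<Lambda> > \<epsilon> / 2}"
      using X(2) by (intro measure_pmf.finite_measure_mono_AE) (auto simp: AE_measure_pmf_iff G_def)
    also have "\<dots> \<le> C / V"
      using prob_atypical_le[where \<eta> = "\<epsilon> / 2" and S = ?S and d = d and q = "\<lambda>v. q (phase M d v)",
          OF n(1) axial_shape_finite axial_shape_lattice] \<epsilon>
      by (simp add: \<mu>_def \<Lambda>_def C_def V_def)
    finally have bad: "measure_pmf.prob \<mu> (- G) \<le> C / V" .
    have Gne: "G \<noteq> {}"
    proof
      assume "G = {}"
      then have "measure_pmf.prob \<mu> (- G) = 1" by (simp only: Compl_empty_eq measure_pmf_UNIV)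
      moreover have "C / V < 1" using V(1) C0 by (simp only: divide_less_eq_1) linarith
      ultimately show False using bad by linarith
    qed
    have "c' \<le> (\<Sum>x<M. entropy_pmf (q x)) / M" using q(2) M by (simp add: field_simps)
    then have "V * c' \<le> V * ((\<Sum>x<M. entropy_pmf (q x)) / M)"
      using V C0 by (intro mult_left_mono) auto
    then have lower: "c' * V \<le> entropy_pmf \<mu>"
      unfolding \<mu>_def entropy_phase_field[OF M(1) n(3) n(1) d] by (simp add: V_def mult.commute)
    have upper: "entropy_pmf \<mu> \<le> 1 + log 2 (card G)
        + measure_pmf.prob \<mu> (- G) * log 2 (card (configs (box n d) :: (site \<Rightarrow> 'a) set))"
      by (rule entropy_le_log_card[OF X _ Gne]) (auto simp: G_def)
    have "card (configs (box n d) :: (site \<Rightarrow> 'a) set) = CARD('a) ^ (n ^ d)"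
      by (simp only: card_configs[OF finite_box] card_box)
    moreover have "log 2 (real (CARD('a) ^ (n ^ d))) = real (n ^ d) * a"
      unfolding a_def of_nat_power[of "CARD('a)"] by (rule log_nat_power) simp
    ultimately have logX: "log 2 (card (configs (box n d) :: (site \<Rightarrow> 'a) set)) = V * a"
      by (simp only: V_def of_nat_power)
    have "measure_pmf.prob \<mu> (- G) * (V * a) \<le> C / V * (V * a)"
      using bad V C0 a0 by (intro mult_right_mono) auto
    also have "C / V * (V * a) = C * a" using V C0 by simp
    finally have "log 2 (card G) \<ge> c' * V - (1 + C * a)"
      using lower upper unfolding logX by linarith
    moreover have "(1 + C * a) \<le> V * (c' - c)"
      using V(2) c'(1) by (simp add: field_simps)
    ultimately have "log 2 (card G) \<ge> c * V" by (simp add: algebra_simps)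
    moreover have cardA: "0 < card G" "card G \<le> card A"
      using Gne finG GA by (auto simp: card_gt_0_iff A_def intro!: card_mono)
    then have "log 2 (card G) \<le> log 2 (card A)" by simp
    ultimately have "c \<le> log 2 (card A) / V" using V C0 by (simp add: field_simps)
    then have "ereal c \<le> log2_card A / ereal (real n ^ d)"
      using cardA n(1) by (auto simp: log2_card_def V_def)
    then show "\<exists>n\<ge>n0. ereal c \<le> log2_card (admissible n d ?S
        (enlarge ?S \<epsilon> (axial_product k d \<Gamma>))) / ereal (real n ^ d)"
      using n(2) unfolding A_def by blast
  qed
qed

section \<open>Entropy by counting\<close>

text \<open>Think of a uniformly random word of a finite set \<open>A\<close>. Then \<open>agree A C w\<close> is a conditioning event,
  \<open>letter A C v w\<close> the conditional law of the letter at \<open>v\<close>, and \<open>hcond A C v\<close> is \<open>card A\<close> times the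
  conditional entropy of that letter given the letters on \<open>C\<close>. Without the normalisation, all entropies are
  plain sums over \<open>A\<close>.\<close>

definition agree :: "('i \<Rightarrow> 'a) set \<Rightarrow> 'i set \<Rightarrow> ('i \<Rightarrow> 'a) \<Rightarrow> ('i \<Rightarrow> 'a) set" where
  "agree A C w = {w' \<in> A. \<forall>v\<in>C. w' v = w v}"

definition letter :: "('i \<Rightarrow> 'a) set \<Rightarrow> 'i set \<Rightarrow> 'i \<Rightarrow> ('i \<Rightarrow> 'a) \<Rightarrow> 'a pmf" where
  "letter A C v w = map_pmf (\<lambda>w'. w' v) (pmf_of_set (agree A C w))"

definition hcond :: "('i \<Rightarrow> 'a) set \<Rightarrow> 'i set \<Rightarrow> 'i \<Rightarrow> real" where
  "hcond A C v = (\<Sum>w\<in>A. - log 2 (pmf (letter A C v w) (w v)))"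

lemma agree_self: "w \<in> A \<Longrightarrow> w \<in> agree A C w"
  by (simp add: agree_def)

lemma agree_subset: "agree A C w \<subseteq> A"
  by (auto simp: agree_def)

lemma finite_agree: "finite A \<Longrightarrow> finite (agree A C w)"
  by (rule finite_subset[OF agree_subset])

lemma agree_eq: "w' \<in> agree A C w \<Longrightarrow> agree A C w' = agree A C w"
  by (auto simp: agree_def)

lemma agree_antimono: "C \<subseteq> C' \<Longrightarrow> agree A C' w \<subseteq> agree A C w"
  by (auto simp: agree_def)

lemma card_agree_pos: "finite A \<Longrightarrow> w \<in> A \<Longrightarrow> card (agree A C w) > 0"
  using agree_self[of w A C] finite_agree[of A C w] by (auto simp: card_gt_0_iff)

lemma letter_cong: "w' \<in> agree A C w \<Longrightarrow> letter A C v w' = letter A C v w"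
  unfolding letter_def by (simp only: agree_eq)

lemma pmf_map_uniform:
  assumes "finite B" "B \<noteq> {}"
  shows "pmf (map_pmf f (pmf_of_set B)) y = card {x\<in>B. f x = y} / card B"
proof -
  have "B \<inter> f -` {y} = {x\<in>B. f x = y}" by auto
  then show ?thesis using assms by (simp add: pmf_map measure_pmf_of_set)
qed

lemma pmf_letter:
  assumes "finite A" "w \<in> A"
  shows "pmf (letter A C v w) (w v) = card (agree A (insert v C) w) / card (agree A C w)"
proof -
  have "{x \<in> agree A C w. x v = w v} = agree A (insert v C) w" by (auto simp: agree_def)
  then show ?thesis
    using assms agree_self[of w A C] finite_agree[OF assms(1), of C w]
    unfolding letter_def by (subst pmf_map_uniform) auto
qed

lemma pmf_letter_pos: "finite A \<Longrightarrow> w \<in> A \<Longrightarrow> pmf (letter A C v w) (w v) > 0"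
  by (simp add: pmf_letter card_agree_pos)

text \<open>A uniform word can be drawn by first drawing a class of agreeing words; this turns averages of
  conditional quantities into plain averages over \<open>A\<close>.\<close>

lemma sum_class_average:
  fixes g :: "('i \<Rightarrow> 'a) \<Rightarrow> real"
  assumes "finite A"
  shows "(\<Sum>w\<in>A. (\<Sum>w'\<in>agree A C w. g w') / card (agree A C w)) = (\<Sum>w\<in>A. g w)"
proof -
  have sym: "w' \<in> agree A C w \<longleftrightarrow> w \<in> agree A C w'" if "w \<in> A" "w' \<in> A" for w w'
    using that by (auto simp: agree_def)
  have "(\<Sum>w\<in>A. (\<Sum>w'\<in>agree A C w. g w') / card (agree A C w))
      = (\<Sum>w\<in>A. \<Sum>w'\<in>A. if w' \<in> agree A C w then g w' / card (agree A C w) else 0)"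
  proof (rule sum.cong[OF refl])
    fix w
    have "(\<Sum>w'\<in>A. if w' \<in> agree A C w then g w' / card (agree A C w) else 0)
        = (\<Sum>w'\<in>A \<inter> agree A C w. g w' / card (agree A C w))"
      using assms by (simp add: sum.inter_restrict)
    also have "A \<inter> agree A C w = agree A C w" using agree_subset[of A C w] by auto
    finally show "(\<Sum>w'\<in>agree A C w. g w') / card (agree A C w)
        = (\<Sum>w'\<in>A. if w' \<in> agree A C w then g w' / card (agree A C w) else 0)"
      by (simp add: sum_divide_distrib)
  qed
  also have "\<dots> = (\<Sum>w'\<in>A. \<Sum>w\<in>A. if w' \<in> agree A C w then g w' / card (agree A C w) else 0)"
    by (rule sum.swap)
  also have "\<dots> = (\<Sum>w'\<in>A. g w')"
  proof (rule sum.cong[OF refl])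
    fix w' assume w': "w' \<in> A"
    have "(\<Sum>w\<in>A. if w' \<in> agree A C w then g w' / card (agree A C w) else 0)
        = (\<Sum>w\<in>A. if w \<in> agree A C w' then g w' / card (agree A C w') else 0)"
    proof (rule sum.cong[OF refl])
      fix w assume w: "w \<in> A"
      show "(if w' \<in> agree A C w then g w' / card (agree A C w) else 0)
          = (if w \<in> agree A C w' then g w' / card (agree A C w') else 0)"
      proof (cases "w \<in> agree A C w'")
        case True
        then have "w' \<in> agree A C w" using sym[OF w w'] by (rule iffD2[rotated])
        then show ?thesis using True by (simp only: agree_eq[OF True] if_True)
      next
        case False
        then have "w' \<notin> agree A C w" using sym[OF w w'] by metis
        then show ?thesis using False by (simp only: if_False)
      qed
    qed
    also have "\<dots> = (\<Sum>w\<in>A \<inter> agree A C w'. g w' / card (agree A C w'))"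
      by (rule sum.inter_restrict[OF assms, symmetric])
    also have "A \<inter> agree A C w' = agree A C w'" using agree_subset[of A C w'] by auto
    finally show "(\<Sum>w\<in>A. if w' \<in> agree A C w then g w' / card (agree A C w) else 0) = g w'"
      using card_agree_pos[OF assms w', of C] by simp
  qed
  finally show ?thesis .
qed

lemma hcond_eq_sum_entropy:
  fixes A :: "('i \<Rightarrow> 'a::finite) set"
  assumes "finite A"
  shows "hcond A C v = (\<Sum>w\<in>A. entropy_pmf (letter A C v w))"
proof -
  have "entropy_pmf (letter A C v w)
      = (\<Sum>w'\<in>agree A C w. - log 2 (pmf (letter A C v w') (w' v))) / card (agree A C w)" if w: "w \<in> A" for w
  proof -
    have "entropy_pmf (letter A C v w)
        = measure_pmf.expectation (letter A C v w) (\<lambda>a. - log 2 (pmf (letter A C v w) a))"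
      by (rule entropy_pmf_eq_expectation) simp
    also have "\<dots> = (\<Sum>w'\<in>agree A C w. - log 2 (pmf (letter A C v w) (w' v))) / card (agree A C w)"
      unfolding letter_def[of A C v w] integral_map_pmf
      using finite_agree[OF assms, of C w] agree_self[OF w, of C] by (subst integral_pmf_of_set) auto
    also have "(\<Sum>w'\<in>agree A C w. - log 2 (pmf (letter A C v w) (w' v)))
        = (\<Sum>w'\<in>agree A C w. - log 2 (pmf (letter A C v w') (w' v)))"
      by (intro sum.cong refl) (simp only: letter_cong)
    finally show ?thesis .
  qed
  then have "(\<Sum>w\<in>A. entropy_pmf (letter A C v w))
      = (\<Sum>w\<in>A. (\<Sum>w'\<in>agree A C w. - log 2 (pmf (letter A C v w') (w' v))) / card (agree A C w))"
    by (intro sum.cong refl) auto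
  also have "\<dots> = hcond A C v"
    unfolding hcond_def by (rule sum_class_average[OF assms])
  finally show ?thesis ..
qed

text \<open>Conditioning on more sites lowers the entropy: each finer conditional law is compared, by Gibbs'
  inequality, with the coarser one.\<close>

lemma hcond_antimono:
  fixes A :: "('i \<Rightarrow> 'a::finite) set"
  assumes A: "finite A" and C: "C \<subseteq> C'"
  shows "hcond A C' v \<le> hcond A C v"
proof -
  have "entropy_pmf (letter A C' v w)
      \<le> (\<Sum>w'\<in>agree A C' w. - log 2 (pmf (letter A C v w') (w' v))) / card (agree A C' w)" if w: "w \<in> A" for w
  proof -
    have fin: "finite (agree A C' w)" "agree A C' w \<noteq> {}"
      using finite_agree[OF A] agree_self[OF w] by auto
    let ?X = "set_pmf (letter A C v w)"
    have set: "set_pmf (letter A C' v w) \<subseteq> ?X"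
      using agree_antimono[OF C, of A w] fin finite_agree[OF A, of C w] agree_self[OF w, of C]
      unfolding letter_def by (subst (1 2) set_map_pmf, subst (1 2) set_pmf_of_set) auto
    have "entropy_pmf (letter A C' v w)
        \<le> - (\<Sum>a\<in>?X. pmf (letter A C' v w) a * log 2 (pmf (letter A C v w) a))"
    proof (rule entropy_le_cross_entropy[OF _ set])
      show "(\<Sum>a\<in>?X. pmf (letter A C v w) a) \<le> 1" by (simp add: sum_pmf_eq_1)
    qed (auto simp: pmf_positive)
    also have "\<dots> = measure_pmf.expectation (letter A C' v w) (\<lambda>a. - log 2 (pmf (letter A C v w) a))"
      using set by (subst integral_measure_pmf_real[of ?X]) (auto simp: sum_negf mult.commute)
    also have "\<dots> = (\<Sum>w'\<in>agree A C' w. - log 2 (pmf (letter A C v w) (w' v))) / card (agree A C' w)"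
      unfolding letter_def[of A C' v w] integral_map_pmf using fin by (subst integral_pmf_of_set) auto
    also have "(\<Sum>w'\<in>agree A C' w. - log 2 (pmf (letter A C v w) (w' v)))
        = (\<Sum>w'\<in>agree A C' w. - log 2 (pmf (letter A C v w') (w' v)))"
    proof (rule sum.cong[OF refl])
      fix w' assume "w' \<in> agree A C' w"
      then have "w' \<in> agree A C w" using agree_antimono[OF C, of A w] by auto
      then show "- log 2 (pmf (letter A C v w) (w' v)) = - log 2 (pmf (letter A C v w') (w' v))"
        by (simp only: letter_cong)
    qed
    finally show ?thesis .
  qed
  then have "(\<Sum>w\<in>A. entropy_pmf (letter A C' v w))
      \<le> (\<Sum>w\<in>A. (\<Sum>w'\<in>agree A C' w. - log 2 (pmf (letter A C v w') (w' v))) / card (agree A C' w))"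
    by (rule sum_mono)
  then show ?thesis
    by (simp only: sum_class_average[OF A] hcond_eq_sum_entropy[OF A, of C', symmetric] hcond_def[of A C, symmetric])
qed

lemma hcond_nonneg:
  assumes "finite A" shows "hcond A C v \<ge> 0"
  unfolding hcond_def
proof (rule sum_nonneg)
  fix w assume "w \<in> A"
  then have "0 < pmf (letter A C v w) (w v)" by (rule pmf_letter_pos[OF assms])
  then have "log 2 (pmf (letter A C v w) (w v)) \<le> 0"
    using pmf_le_1[of "letter A C v w" "w v"] by (simp only: log_le_zero_cancel_iff one_less_numeral_iff semiring_norm)
  then show "0 \<le> - log 2 (pmf (letter A C v w) (w v))" by simp
qed

lemma hcond_le:
  fixes A :: "('i \<Rightarrow> 'a::finite) set"
  assumes "finite A" shows "hcond A C v \<le> card A * log 2 CARD('a)"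
proof -
  have "entropy_pmf p \<le> log 2 CARD('a)" for p :: "'a pmf"
  proof -
    have "entropy_pmf p \<le> - (\<Sum>a\<in>UNIV. pmf p a * log 2 (1 / CARD('a)))"
      by (rule entropy_le_cross_entropy) auto
    also have "\<dots> = log 2 CARD('a)"
      by (simp add: sum_negf sum_distrib_right[symmetric] sum_pmf_eq_1 log_divide)
    finally show ?thesis .
  qed
  then show ?thesis
    unfolding hcond_eq_sum_entropy[OF assms] by (intro sum_bounded_above[THEN order_trans]) auto
qed

text \<open>The chain rule for entropy, along a strict total order of the sites: remove the last site.\<close>

lemma sum_hcond_chain:
  fixes R :: "'i \<Rightarrow> 'i \<Rightarrow> bool"
  assumes A: "finite A" and V: "finite V"
    and R: "\<And>u v. R u v \<Longrightarrow> \<not> R v u" "\<And>u v w. R u v \<Longrightarrow> R v w \<Longrightarrow> R u w"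
      "\<And>u v. u \<in> V \<Longrightarrow> v \<in> V \<Longrightarrow> u \<noteq> v \<Longrightarrow> R u v \<or> R v u"
  shows "(\<Sum>v\<in>V. hcond A {u\<in>V. R u v} v) = (\<Sum>w\<in>A. log 2 (card A / card (agree A V w)))"
  using V R(3)
proof (induction "card V" arbitrary: V)
  case 0
  then show ?case by (auto simp: agree_def intro!: sum.neutral)
next
  case (Suc m)
  have "V \<noteq> {}" using Suc.hyps(2) by auto
  moreover have "asymp_on V R" by (rule asymp_onI) (rule R(1))
  moreover have "transp_on V R" by (rule transp_onI) (rule R(2))
  ultimately obtain x where x: "x \<in> V" "\<And>y. y \<in> V \<Longrightarrow> y \<noteq> x \<Longrightarrow> \<not> R x y"
    using Finite_Set.bex_max_element[OF Suc.prems(1)] by metis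
  have irrefl: "\<not> R y y" for y using R(1) by metis
  let ?V = "V - {x}"
  have V: "V = insert x ?V" using x(1) by (rule insert_Diff[symmetric])
  have past: "{u\<in>V. R u x} = ?V"
  proof (intro set_eqI iffI)
    fix u assume "u \<in> ?V"
    then have u: "u \<in> V" "u \<noteq> x" by auto
    then have "R u x" using Suc.prems(2)[OF u(1) x(1) u(2)] x(2)[OF u] by metis
    then show "u \<in> {u\<in>V. R u x}" using u by simp
  qed (use irrefl in auto)
  have "(\<Sum>v\<in>V. hcond A {u\<in>V. R u v} v) = hcond A ?V x + (\<Sum>v\<in>?V. hcond A {u\<in>V. R u v} v)"
    using x Suc.prems(1) by (simp add: sum.remove[of V x] past)
  also have "(\<Sum>v\<in>?V. hcond A {u\<in>V. R u v} v) = (\<Sum>v\<in>?V. hcond A {u\<in>?V. R u v} v)"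
  proof (rule sum.cong[OF refl])
    fix v assume "v \<in> ?V"
    then have "\<not> R x v" using x(2)[of v] by auto
    then have "{u\<in>V. R u v} = {u\<in>?V. R u v}" by auto
    then show "hcond A {u\<in>V. R u v} v = hcond A {u\<in>?V. R u v} v" by simp
  qed
  also have "\<dots> = (\<Sum>w\<in>A. log 2 (card A / card (agree A ?V w)))"
    using Suc.hyps(2) Suc.prems x by (intro Suc.hyps(1)) auto
  also have "hcond A ?V x + \<dots> = (\<Sum>w\<in>A. log 2 (card A / card (agree A V w)))"
    unfolding hcond_def sum.distrib[symmetric]
  proof (rule sum.cong[OF refl])
    fix w assume w: "w \<in> A"
    have "card A > 0" using A w by (auto simp: card_gt_0_iff)
    then show "- log 2 (pmf (letter A ?V x w) (w x)) + log 2 (card A / card (agree A ?V w))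
        = log 2 (card A / card (agree A V w))"
      using card_agree_pos[OF A w, of ?V] card_agree_pos[OF A w, of V] V
      by (simp add: pmf_letter[OF A w] log_divide)
  qed
  finally show ?case .
qed

text \<open>Along a path of sites \<open>u 0, u 1, \<dots>\<close> the relative entropy between the conditional law of the word
  read and the product of its letter laws is, on average, the entropy lost by conditioning each letter
  on the preceding ones.\<close>

lemma sum_tv_dist_path_le:
  fixes A :: "('i \<Rightarrow> 'a::finite) set" and \<theta> :: real and k :: nat
  assumes A: "finite A" and \<theta>: "\<theta> > 0"
  shows "(\<Sum>w\<in>A. tv_dist (map_pmf (\<lambda>w'. restrict (\<lambda>t. w' (u t)) {..<k}) (pmf_of_set (agree A C w)))
                      (Pi_pmf {..<k} undefined (\<lambda>t. letter A C (u t) w)))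
     \<le> \<theta> * card A + (\<Sum>t<k. hcond A C (u t) - hcond A (C \<union> u ` {..<t}) (u t)) / \<theta>"
proof -
  define rd where "rd w' = restrict (\<lambda>t. w' (u t)) {..<k}" for w' :: "'i \<Rightarrow> 'a"
  define Q where "Q w = map_pmf rd (pmf_of_set (agree A C w))" for w
  define R where "R w = Pi_pmf {..<k} undefined (\<lambda>t. letter A C (u t) w)" for w
  define X where "X = (configs {..<k} :: (nat \<Rightarrow> 'a) set)"
  have finX: "finite X" by (simp add: X_def finite_configs)
  define U where "U t = C \<union> u ` {..<t}" for t
  have US: "insert (u t) (U t) = U (Suc t)" for t by (auto simp: U_def lessThan_Suc)
  define ratio where "ratio w' = (\<Sum>t<k. ln (pmf (letter A (U t) (u t) w') (w' (u t))))
      - (\<Sum>t<k. ln (pmf (letter A C (u t) w') (w' (u t))))" for w'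
  have Q: "pmf (Q w) (rd w') = card (agree A (U k) w') / card (agree A C w')"
    if w: "w \<in> A" and w': "w' \<in> agree A C w" for w w'
  proof -
    have "{x \<in> agree A C w. rd x = rd w'} = agree A (U k) w'"
      using w' by (auto simp: agree_def rd_def U_def fun_eq_iff restrict_def)
    then show ?thesis
      unfolding Q_def using finite_agree[OF A, of C w] agree_self[OF w, of C] agree_eq[OF w']
      by (subst pmf_map_uniform) auto
  qed
  have tele: "ln (card (agree A (U m) w') / card (agree A C w'))
      = (\<Sum>t<m. ln (pmf (letter A (U t) (u t) w') (w' (u t))))" if w': "w' \<in> A" for w' m
  proof (induction m)
    case 0
    then show ?case using card_agree_pos[OF A w', of C] by (simp add: U_def)
  next
    case (Suc m)
    have "pmf (letter A (U m) (u m) w') (w' (u m)) = card (agree A (U (Suc m)) w') / card (agree A (U m) w')"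
      by (simp only: pmf_letter[OF A w'] US)
    then have "ln (pmf (letter A (U m) (u m) w') (w' (u m)))
        = ln (card (agree A (U (Suc m)) w') / card (agree A C w')) - ln (card (agree A (U m) w') / card (agree A C w'))"
      using card_agree_pos[OF A w', of C] card_agree_pos[OF A w', of "U m"] card_agree_pos[OF A w', of "U (Suc m)"]
      by (simp add: ln_div)
    then show ?case unfolding sum.lessThan_Suc using Suc.IH by linarith
  qed
  have R: "pmf (R w) (rd w') = (\<Prod>t<k. pmf (letter A C (u t) w') (w' (u t)))"
    if w': "w' \<in> agree A C w" for w w'
    unfolding R_def by (subst pmf_Pi') (auto simp: rd_def letter_cong[OF w', symmetric])
  have pt: "tv_dist (Q w) (R w) \<le> \<theta> + ((\<Sum>w'\<in>agree A C w. ratio w') / card (agree A C w)) / \<theta>"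
    if w: "w \<in> A" for w
  proof -
    have fin: "finite (agree A C w)" "agree A C w \<noteq> {}"
      using finite_agree[OF A] agree_self[OF w] by auto
    have setQ: "set_pmf (Q w) = rd ` agree A C w" using fin by (simp add: Q_def)
    have sub: "set_pmf (Q w) \<subseteq> set_pmf (R w)"
    proof
      fix y assume "y \<in> set_pmf (Q w)"
      then obtain w' where w': "w' \<in> agree A C w" "y = rd w'" unfolding setQ by auto
      have "pmf (R w) y > 0"
        unfolding w'(2) R[OF w'(1)] using w'(1) agree_subset[of A C w]
        by (intro prod_pos) (auto intro!: pmf_letter_pos[OF A])
      then show "y \<in> set_pmf (R w)" by (simp add: set_pmf_iff)
    qed
    have QX: "set_pmf (Q w) \<subseteq> X" unfolding setQ by (auto simp: X_def rd_def)
    have RX: "set_pmf (R w) \<subseteq> X"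
      using Pi_pmf_in_probs[of "{..<k}"] by (auto simp: R_def X_def probs_def)
    have "tv_dist (Q w) (R w) \<le> \<theta> + (\<Sum>x\<in>X. pmf (Q w) x * ln (pmf (Q w) x / pmf (R w) x)) / \<theta>"
      by (rule tv_dist_le_relative_entropy[OF finX QX RX sub \<theta>])
    also have "(\<Sum>x\<in>X. pmf (Q w) x * ln (pmf (Q w) x / pmf (R w) x))
        = measure_pmf.expectation (Q w) (\<lambda>x. ln (pmf (Q w) x / pmf (R w) x))"
      using QX by (subst integral_measure_pmf_real[OF finX]) (auto simp: mult.commute)
    also have "\<dots> = (\<Sum>w'\<in>agree A C w. ln (pmf (Q w) (rd w') / pmf (R w) (rd w'))) / card (agree A C w)"
      unfolding Q_def[of w] integral_map_pmf using fin by (subst integral_pmf_of_set) auto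
    also have "(\<Sum>w'\<in>agree A C w. ln (pmf (Q w) (rd w') / pmf (R w) (rd w'))) = (\<Sum>w'\<in>agree A C w. ratio w')"
    proof (rule sum.cong[OF refl])
      fix w' assume w': "w' \<in> agree A C w"
      then have A': "w' \<in> A" using agree_subset[of A C w] by auto
      have pos: "pmf (letter A C (u t) w') (w' (u t)) > 0" for t by (rule pmf_letter_pos[OF A A'])
      have "ln (pmf (Q w) (rd w') / pmf (R w) (rd w')) = ln (pmf (Q w) (rd w')) - ln (pmf (R w) (rd w'))"
        unfolding Q[OF w w'] R[OF w'] using pos card_agree_pos[OF A A']
        by (intro ln_divide_pos) (auto intro!: prod_pos divide_pos_pos)
      also have "\<dots> = ratio w'"
        unfolding Q[OF w w'] R[OF w'] tele[OF A'] ratio_def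
        by (subst ln_prod) (simp_all add: pos less_imp_neq[OF pos, symmetric])
      finally show "ln (pmf (Q w) (rd w') / pmf (R w) (rd w')) = ratio w'" .
    qed
    finally show ?thesis .
  qed
  have h: "(\<Sum>w'\<in>A. ln (pmf (letter A D v w') (w' v))) = - ln 2 * hcond A D v" for D v
    by (simp add: hcond_def log_def sum_negf sum_divide_distrib[symmetric])
  define loss where "loss = (\<Sum>t<k. hcond A C (u t) - hcond A (U t) (u t))"
  have loss0: "loss \<ge> 0"
    unfolding loss_def by (intro sum_nonneg) (auto simp: U_def intro!: hcond_antimono[OF A])
  have "(\<Sum>w\<in>A. tv_dist (Q w) (R w)) \<le> (\<Sum>w\<in>A. \<theta> + ((\<Sum>w'\<in>agree A C w. ratio w') / card (agree A C w)) / \<theta>)"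
    by (rule sum_mono) (rule pt)
  also have "\<dots> = \<theta> * card A + (\<Sum>w\<in>A. (\<Sum>w'\<in>agree A C w. ratio w') / card (agree A C w)) / \<theta>"
    by (simp add: sum.distrib sum_divide_distrib)
  also have "(\<Sum>w\<in>A. (\<Sum>w'\<in>agree A C w. ratio w') / card (agree A C w)) = (\<Sum>w\<in>A. ratio w)"
    by (rule sum_class_average[OF A])
  also have "\<dots> = (\<Sum>t<k. \<Sum>w\<in>A. ln (pmf (letter A (U t) (u t) w) (w (u t))))
      - (\<Sum>t<k. \<Sum>w\<in>A. ln (pmf (letter A C (u t) w) (w (u t))))"
    by (simp add: ratio_def sum_subtractf sum.swap[of _ A])
  also have "\<dots> = ln 2 * loss"
    by (simp add: h loss_def sum_subtractf sum_distrib_left[symmetric] sum_negf algebra_simps)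
  also have "\<theta> * card A + ln 2 * loss / \<theta> \<le> \<theta> * card A + 1 * loss / \<theta>"
    using loss0 \<theta> ln_2_less_1 by (intro add_left_mono divide_right_mono mult_right_mono) auto
  finally show ?thesis by (simp add: Q_def R_def rd_def[abs_def] loss_def U_def)
qed

section \<open>Choosing a direction\<close>

text \<open>In the lexicographic order, \<open>past n d l v\<close> consists of the sites before \<open>v\<close> that differ from it in
  the first \<open>l\<close> coordinates only. \<open>side_past n d l v\<close> consists of whole lines in direction
  \<open>l\<close>, namely those that precede the line of \<open>v\<close> in the slab through \<open>v\<close> spanned by the first \<open>l + 1\<close>
  directions; it lies between \<open>past n d l v\<close> and \<open>past n d (Suc l) v\<close>, and is the
  same for all sites of a line.\<close>

definition past :: "nat \<Rightarrow> nat \<Rightarrow> nat \<Rightarrow> site \<Rightarrow> site set" where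
  "past n d l v = {u \<in> box n d. (\<forall>i\<ge>l. u i = v i) \<and> less_fun u v}"

definition side_past :: "nat \<Rightarrow> nat \<Rightarrow> nat \<Rightarrow> site \<Rightarrow> site set" where
  "side_past n d l v =
     {u \<in> box n d. (\<forall>i>l. u i = v i) \<and> (\<exists>i<l. u i < v i \<and> (\<forall>j<i. u j = v j))}"

definition step :: "nat \<Rightarrow> site \<Rightarrow> nat \<Rightarrow> site" where
  "step l v t = v(l := v l + int t)"

lemma past_subset_side_past: "past n d l v \<subseteq> side_past n d l v"
proof
  fix u assume u: "u \<in> past n d l v"
  then obtain i where i: "u i < v i" "\<forall>j<i. u j = v j" by (auto simp: past_def less_fun_def)
  then have "i < l" using u by (cases "i < l") (auto simp: past_def)
  then show "u \<in> side_past n d l v" using u i by (auto simp: past_def side_past_def)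
qed

lemma side_past_subset_past: "side_past n d l v \<subseteq> past n d (Suc l) v"
  by (auto simp: past_def side_past_def less_fun_def)

lemma side_past_step: "side_past n d l (step l v t) = side_past n d l v"
proof -
  have "(\<exists>i<l. u i < step l v t i \<and> (\<forall>j<i. u j = step l v t j)) \<longleftrightarrow> (\<exists>i<l. u i < v i \<and> (\<forall>j<i. u j = v j))" for u
    by (intro ex_cong1 conj_cong refl all_cong1 imp_cong) (auto simp: step_def)
  moreover have "(\<forall>i>l. u i = step l v t i) \<longleftrightarrow> (\<forall>i>l. u i = v i)" for u
    by (auto simp: step_def)
  ultimately show ?thesis by (simp add: side_past_def)
qed

lemma step_in_past:
  assumes "step l v s \<in> box n d" "s < t"
  shows "step l v s \<in> past n d (Suc l) (step l v t)"
proof -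
  have "less_fun (step l v s) (step l v t)"
    unfolding less_fun_def using assms(2) by (intro exI[of _ l]) (auto simp: step_def)
  then show ?thesis using assms(1) by (auto simp: past_def step_def)
qed

lemma step_in_box:
  assumes "v \<in> box n d" "l < d" "v l + int t < int n"
  shows "step l v t \<in> box n d"
  using assms by (auto simp: box_def lattice_def step_def)

lemma torus_add_eq_step:
  assumes "v \<in> box n d" "l < d" "v l + int t < int n"
  shows "site_mod n (site_add v (axis_point l t)) = step l v t"
proof
  fix i
  have "0 \<le> v i + axis_point l t i \<and> v i + axis_point l t i < int n"
    using assms by (cases "i < d") (auto simp: box_def lattice_def axis_point_def)
  then show "site_mod n (site_add v (axis_point l t)) i = step l v t i"
    by (simp add: site_mod_def site_add_def step_def axis_point_def)
qed

lemma less_fun_total_on_box: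
  assumes "u \<in> box n d" "v \<in> box n d" "u \<noteq> v"
  shows "less_fun u v \<or> less_fun v u"
proof -
  have "{i. u i \<noteq> v i} \<subseteq> {..<d}" using assms by (auto simp: box_def lattice_def not_less[symmetric])
  then have "finite {i. u i \<noteq> v i}" by (rule finite_subset) simp
  then show ?thesis using less_fun_trichotomy[of u v] assms(3) by auto
qed

text \<open>The sums over the box of the entropies given \<open>past n d l\<close> decrease in \<open>l\<close>, from at most \<open>log \<bar>\<Sigma>\<bar>\<close> per site
  to the entropy of the whole word. So one of the \<open>d\<close> steps is small, and in that direction
  knowing the earlier part of the line hardly adds to the knowledge of the preceding lines.\<close>

lemma exists_direction:
  fixes A :: "(site \<Rightarrow> 'a::finite) set"
  assumes A: "finite A" "A \<subseteq> configs (box n d)" and d: "d \<ge> 1"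
  shows "\<exists>l<d. (\<Sum>v\<in>box n d. hcond A (side_past n d l v) v - hcond A (past n d (Suc l) v) v)
             \<le> card A * real n ^ d * log 2 CARD('a) / d
           \<and> card A * log 2 (card A) \<le> (\<Sum>v\<in>box n d. hcond A (side_past n d l v) v)"
proof -
  define F where "F l = (\<Sum>v\<in>box n d. hcond A (past n d l v) v)" for l
  define K where "K = card A * real n ^ d * log 2 CARD('a)"
  have "F 0 \<le> (\<Sum>v\<in>box n d. card A * log 2 CARD('a))"
    unfolding F_def by (rule sum_mono) (rule hcond_le[OF A(1)])
  then have F0: "F 0 \<le> K" by (simp add: K_def card_box mult_ac)
  have F_nonneg: "F l \<ge> 0" for l unfolding F_def by (rule sum_nonneg) (rule hcond_nonneg[OF A(1)])
  have anti: "F (Suc l) \<le> F l" for l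
    unfolding F_def using past_subset_side_past side_past_subset_past
    by (intro sum_mono hcond_antimono[OF A(1)]) blast
  have "F d \<le> F l" if "l \<le> d" for l
    using that by (induction rule: inc_induct) (use anti order_trans in blast)+
  moreover have "F d = card A * log 2 (card A)"
  proof -
    have "past n d d v = {u \<in> box n d. less_fun u v}" if "v \<in> box n d" for v
      using that by (auto simp: past_def box_def lattice_def)
    then have "F d = (\<Sum>v\<in>box n d. hcond A {u \<in> box n d. less_fun u v} v)"
      by (simp add: F_def)
    also have "\<dots> = (\<Sum>w\<in>A. log 2 (card A / card (agree A (box n d) w)))"
      by (rule sum_hcond_chain[OF A(1) finite_box less_fun_asym less_fun_trans less_fun_total_on_box])
    also have "\<dots> = (\<Sum>w\<in>A. log 2 (card A))"
    proof (rule sum.cong[OF refl])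
      fix w assume w: "w \<in> A"
      have "agree A (box n d) w = {w}"
      proof (intro set_eqI iffI)
        fix w' assume w': "w' \<in> agree A (box n d) w"
        have "w' u = w u" for u
        proof (cases "u \<in> box n d")
          case False
          have "w \<in> configs (box n d)" "w' \<in> configs (box n d)"
            using w w' A(2) by (auto simp: agree_def)
          then show ?thesis using False by (auto simp: configs_def PiE_def extensional_def)
        qed (use w' in \<open>simp add: agree_def\<close>)
        then show "w' \<in> {w}" by auto
      qed (use w in \<open>simp add: agree_def\<close>)
      then show "log 2 (card A / card (agree A (box n d) w)) = log 2 (card A)" by simp
    qed
    finally show ?thesis by simp
  qed
  ultimately have Fd: "card A * log 2 (card A) \<le> F l" if "l \<le> d" for l using that by simp
  have "\<exists>l<d. F l - F (Suc l) \<le> K / d"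
  proof (rule ccontr)
    assume "\<not> ?thesis"
    then have "(\<Sum>l<d. K / d) < (\<Sum>l<d. F l - F (Suc l))"
      using d by (intro sum_strict_mono) (auto simp: not_le lessThan_empty_iff)
    also have "\<dots> = F 0 - F d" by (rule sum_lessThan_telescope')
    also have "\<dots> \<le> K" using F0 F_nonneg[of d] by linarith
    finally show False using d by simp
  qed
  then obtain l where l: "l < d" "F l - F (Suc l) \<le> K / d" by blast
  have "(\<Sum>v\<in>box n d. hcond A (side_past n d l v) v) \<le> F l"
    unfolding F_def by (intro sum_mono hcond_antimono[OF A(1)] past_subset_side_past)
  then have "(\<Sum>v\<in>box n d. hcond A (side_past n d l v) v - hcond A (past n d (Suc l) v) v) \<le> K / d"
    using l(2) by (simp add: sum_subtractf F_def)
  moreover have "F (Suc l) \<le> (\<Sum>v\<in>box n d. hcond A (side_past n d l v) v)"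
    unfolding F_def by (intro sum_mono hcond_antimono[OF A(1)] side_past_subset_past)
  then have "card A * log 2 (card A) \<le> (\<Sum>v\<in>box n d. hcond A (side_past n d l v) v)"
    using Fd[of "Suc l"] l(1) by linarith
  ultimately show ?thesis using l(1) by (auto simp: K_def)
qed

text \<open>The sites of a window before \<open>step l v t\<close> and \<open>side_past n d l v\<close> together lie in the past of
  \<open>step l v t\<close>, and each site is the \<open>t\<close>-th of at most one window.\<close>

lemma sum_hcond_path_le:
  fixes A :: "(site \<Rightarrow> 'a::finite) set"
  assumes A: "finite A" and l: "l < d"
  shows "(\<Sum>v\<in>{v\<in>box n d. v l + int k \<le> int n}. \<Sum>t<k. hcond A (side_past n d l v) (step l v t)
            - hcond A (side_past n d l v \<union> step l v ` {..<t}) (step l v t))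
       \<le> k * (\<Sum>v\<in>box n d. hcond A (side_past n d l v) v - hcond A (past n d (Suc l) v) v)"
proof -
  let ?G = "{v\<in>box n d. v l + int k \<le> int n}"
  define e where "e v = hcond A (side_past n d l v) v - hcond A (past n d (Suc l) v) v" for v
  have e0: "e v \<ge> 0" for v
    using hcond_antimono[OF A side_past_subset_past, of n d l v v] by (simp add: e_def)
  have inbox: "step l v t \<in> box n d" if "v \<in> ?G" "t < k" for v t
    using that l by (intro step_in_box) auto
  have "(\<Sum>v\<in>?G. \<Sum>t<k. hcond A (side_past n d l v) (step l v t)
            - hcond A (side_past n d l v \<union> step l v ` {..<t}) (step l v t))
      \<le> (\<Sum>v\<in>?G. \<Sum>t<k. e (step l v t))"
  proof (intro sum_mono)
    fix v t assume v: "v \<in> ?G" and t: "t \<in> {..<k}"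
    have "side_past n d l v \<union> step l v ` {..<t} \<subseteq> past n d (Suc l) (step l v t)"
      using side_past_subset_past[of n d l "step l v t"] v t
      by (auto simp: side_past_step intro!: step_in_past inbox)
    then show "hcond A (side_past n d l v) (step l v t)
        - hcond A (side_past n d l v \<union> step l v ` {..<t}) (step l v t) \<le> e (step l v t)"
      using hcond_antimono[OF A] by (simp add: e_def side_past_step)
  qed
  also have "\<dots> = (\<Sum>t<k. \<Sum>v\<in>?G. e (step l v t))" by (rule sum.swap)
  also have "\<dots> \<le> (\<Sum>t<k. \<Sum>v\<in>box n d. e v)"
  proof (rule sum_mono)
    fix t assume t: "t \<in> {..<k}"
    have "inj_on (\<lambda>v. step l v t) ?G"
    proof (rule inj_onI)
      fix v v' assume "step l v t = step l v' t"
      then have "step l v t i = step l v' t i" for i by simp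
      then show "v = v'" unfolding step_def by (intro ext) (metis add_right_cancel fun_upd_apply)
    qed
    then have "(\<Sum>v\<in>?G. e (step l v t)) = (\<Sum>v\<in>(\<lambda>v. step l v t) ` ?G. e v)"
      by (simp add: sum.reindex)
    also have "\<dots> \<le> (\<Sum>v\<in>box n d. e v)"
      using inbox t e0 by (intro sum_mono2) auto
    finally show "(\<Sum>v\<in>?G. e (step l v t)) \<le> (\<Sum>v\<in>box n d. e v)" .
  qed
  finally show ?thesis by (simp add: e_def)
qed

section \<open>Capacity is asymptotically at most the independence entropy\<close>

lemma sum_lessThan_add:
  fixes g :: "nat \<Rightarrow> real"
  shows "(\<Sum>x<m + n. g x) = (\<Sum>x<m. g x) + (\<Sum>j<n. g (m + j))"
  by (induction n) (simp_all add: add.assoc)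

lemma sum_blocks:
  fixes f :: "nat \<Rightarrow> nat \<Rightarrow> real"
  assumes "n \<ge> 1"
  shows "(\<Sum>x<B * n. f (x div n) (x mod n)) = (\<Sum>b<B. \<Sum>j<n. f b j)"
proof (induction B)
  case (Suc B)
  have "(\<Sum>x<Suc B * n. f (x div n) (x mod n)) = (\<Sum>x<B * n + n. f (x div n) (x mod n))"
    by (simp add: add.commute)
  also have "\<dots> = (\<Sum>b<B. \<Sum>j<n. f b j) + (\<Sum>j<n. f ((B * n + j) div n) ((B * n + j) mod n))"
    by (simp only: sum_lessThan_add Suc.IH)
  also have "(\<Sum>j<n. f ((B * n + j) div n) ((B * n + j) mod n)) = (\<Sum>j<n. f B j)"
    by (intro sum.cong refl) simp
  finally show ?case by simp
qed simp

lemma bij_betw_lines_box: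
  assumes "l < d"
  shows "bij_betw (\<lambda>(v, j). step l v j) ({v \<in> box n d. v l = 0} \<times> {..<n}) (box n d)"
proof (rule bij_betw_byWitness[where f' = "\<lambda>v. (v(l := 0), nat (v l))"])
  show "(\<lambda>v. (v(l := 0), nat (v l))) ` box n d \<subseteq> {v \<in> box n d. v l = 0} \<times> {..<n}"
    using assms by (auto simp: box_def lattice_def nat_less_iff)
  show "(\<lambda>(v, j). step l v j) ` ({v \<in> box n d. v l = 0} \<times> {..<n}) \<subseteq> box n d"
    using assms by (auto intro!: step_in_box)
qed (use assms in \<open>auto simp: step_def box_def fun_eq_iff\<close>)

lemma sum_box_lines:
  fixes g :: "site \<Rightarrow> real"
  assumes "l < d"
  shows "(\<Sum>v\<in>box n d. g v) = (\<Sum>v\<in>{v \<in> box n d. v l = 0}. \<Sum>j<n. g (step l v j))"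
  using sum.reindex_bij_betw[OF bij_betw_lines_box[OF assms], of g n]
  by (simp add: sum.cartesian_product case_prod_unfold)

lemma card_lines:
  assumes "l < d"
  shows "card {v \<in> box n d. v l = 0} * n = n ^ d"
  using bij_betw_same_card[OF bij_betw_lines_box[OF assms, of n]] by (simp add: card_cartesian_product card_box)

lemma card_truncated:
  assumes l: "l < d" and k: "k \<le> n"
  shows "card {v \<in> box n d. \<not> v l + int k \<le> int n} * n \<le> k * n ^ d"
proof -
  let ?L = "{v \<in> box n d. v l = 0}"
  have fin: "finite ?L" by simp
  have "{v \<in> box n d. \<not> v l + int k \<le> int n} \<subseteq> (\<lambda>(v, j). step l v j) ` (?L \<times> {n - k..<n})"
  proof
    fix v assume v: "v \<in> {v \<in> box n d. \<not> v l + int k \<le> int n}"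
    have "step l (v(l := 0)) (nat (v l)) = v" using v l by (auto simp: step_def box_def fun_eq_iff)
    moreover have "v(l := 0) \<in> ?L" using v l by (auto simp: box_def lattice_def)
    moreover have "nat (v l) \<in> {n - k..<n}" using v l by (auto simp: box_def)
    ultimately show "v \<in> (\<lambda>(v, j). step l v j) ` (?L \<times> {n - k..<n})"
      by (intro image_eqI[of _ _ "(v(l := 0), nat (v l))"]) auto
  qed
  then have "card {v \<in> box n d. \<not> v l + int k \<le> int n} \<le> card (?L \<times> {n - k..<n})"
    using fin by (meson card_image_le card_mono finite_SigmaI finite_atLeastLessThan finite_imageI le_trans)
  also have "\<dots> = card ?L * k" using k by (simp add: card_cartesian_product)
  finally have "card {v \<in> box n d. \<not> v l + int k \<le> int n} * n \<le> card ?L * k * n" by simp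
  also have "card ?L * k * n = k * n ^ d" using card_lines[OF l, of n] by (simp add: mult_ac)
  finally show ?thesis .
qed

lemma pmf_map_pmf_of_set_eq_sum:
  assumes "finite B" "B \<noteq> {}"
  shows "pmf (map_pmf f (pmf_of_set B)) y = (\<Sum>x\<in>B. pmf (return_pmf (f x)) y) / card B"
  unfolding map_pmf_def using assms by (rule pmf_bind_pmf_of_set)

text \<open>Averaging the conditional laws over the condition gives back the law under a uniform word of \<open>A\<close>,
  whatever set \<open>C v\<close> is conditioned on; averaged over the sites as well, this is the mean empirical
  axis marginal.\<close>

lemma mixture_of_conditional_words:
  fixes A :: "(site \<Rightarrow> 'a::finite) set"
  assumes A: "finite A" "A \<noteq> {}" and n: "n \<ge> 1" and l: "l < d"
  shows "(\<Sum>w\<in>A. \<Sum>v\<in>box n d. pmf (map_pmf (\<lambda>w'. axis_word k l (window n (axial_shape k d) w' v))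
              (pmf_of_set (agree A (C v) w))) y) / (real (card A) * real n ^ d)
       = pmf (bind_pmf (pmf_of_set A) (\<lambda>w. map_pmf (axis_word k l) (empirical n d (axial_shape k d) w))) y"
proof -
  define g where "g v w = pmf (return_pmf (axis_word k l (window n (axial_shape k d) w v))) y" for v w
  have "(\<Sum>w\<in>A. pmf (map_pmf (\<lambda>w'. axis_word k l (window n (axial_shape k d) w' v)) (pmf_of_set (agree A (C v) w))) y)
      = (\<Sum>w\<in>A. g v w)" for v
  proof -
    have "(\<Sum>w\<in>A. pmf (map_pmf (\<lambda>w'. axis_word k l (window n (axial_shape k d) w' v)) (pmf_of_set (agree A (C v) w))) y)
        = (\<Sum>w\<in>A. (\<Sum>w'\<in>agree A (C v) w. g v w') / card (agree A (C v) w))"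
    proof (rule sum.cong[OF refl])
      fix w assume "w \<in> A"
      then have "agree A (C v) w \<noteq> {}" using agree_self[of w A "C v"] by auto
      then show "pmf (map_pmf (\<lambda>w'. axis_word k l (window n (axial_shape k d) w' v)) (pmf_of_set (agree A (C v) w))) y
          = (\<Sum>w'\<in>agree A (C v) w. g v w') / card (agree A (C v) w)"
        unfolding g_def by (intro pmf_map_pmf_of_set_eq_sum finite_agree[OF A(1)])
    qed
    then show ?thesis by (simp only: sum_class_average[OF A(1)])
  qed
  then have "(\<Sum>w\<in>A. \<Sum>v\<in>box n d. pmf (map_pmf (\<lambda>w'. axis_word k l (window n (axial_shape k d) w' v))
              (pmf_of_set (agree A (C v) w))) y) = (\<Sum>v\<in>box n d. \<Sum>w\<in>A. g v w)"
    by (subst sum.swap) (simp only:)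
  also have "\<dots> = (\<Sum>w\<in>A. \<Sum>v\<in>box n d. g v w)" by (rule sum.swap)
  finally have *: "(\<Sum>w\<in>A. \<Sum>v\<in>box n d. pmf (map_pmf (\<lambda>w'. axis_word k l (window n (axial_shape k d) w' v))
              (pmf_of_set (agree A (C v) w))) y) = (\<Sum>w\<in>A. \<Sum>v\<in>box n d. g v w)" .
  have "pmf (map_pmf (axis_word k l) (empirical n d (axial_shape k d) w)) y
      = (\<Sum>v\<in>box n d. g v w) / real n ^ d" for w
    unfolding empirical_def pmf.map_comp g_def
    by (subst pmf_map_pmf_of_set_eq_sum) (use n in \<open>simp_all add: card_box o_def\<close>)
  then show ?thesis
    unfolding * pmf_bind_pmf_of_set[OF A] by (simp add: sum_divide_distrib mult.commute)
qed

text \<open>The conditional letter laws are strung together to one periodic sequence: a block for every word of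
  \<open>A\<close> and every line in the chosen direction, all repeated often enough to exceed any given length.
  Windows that do not leave their block see a product law that is on average close to the conditional
  law of the word read there; the remaining ones are a fraction of at most \<open>k / n\<close>.\<close>

lemma entropy_of_admissible_le:
  fixes \<Gamma> :: "(nat \<Rightarrow> 'a::finite) pmf set" and d k n :: nat and \<epsilon> \<theta> :: real
  assumes k: "k \<ge> 1" "k \<le> n" and d: "d \<ge> 1" and \<Gamma>: "\<Gamma> \<subseteq> probs {..<k}" "convex_pmfs \<Gamma>" and \<theta>: "\<theta> > 0"
  defines "A \<equiv> admissible n d (axial_shape k d) (enlarge (axial_shape k d) \<epsilon> (axial_product k d \<Gamma>))"
  assumes ne: "A \<noteq> {}"
  shows "ereal (log 2 (card A) / real n ^ d) \<le> h_ind_hat 1 (segment k 0) (enlarge (segment k 0)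
           (\<epsilon> + (\<theta> + k * log 2 CARD('a) / (d * \<theta>) + k / n)) (line_system k \<Gamma>))"
proof (rule le_h_ind_hat_of_sequences[OF \<Gamma>(1)])
  fix M0
  let ?S = "axial_shape k d"
  define N where "N = card A"
  define a where "a = log 2 CARD('a)"
  have n: "n \<ge> 1" using k by simp
  have A: "finite A" "A \<subseteq> configs (box n d)" by (auto simp: A_def admissible_def finite_configs)
  have N: "N \<ge> 1" using A ne by (simp add: N_def Suc_le_eq card_gt_0_iff)
  obtain l where l: "l < d"
    and small: "(\<Sum>v\<in>box n d. hcond A (side_past n d l v) v - hcond A (past n d (Suc l) v) v)
                  \<le> N * real n ^ d * a / d"
    and big: "N * log 2 N \<le> (\<Sum>v\<in>box n d. hcond A (side_past n d l v) v)"
    using exists_direction[OF A d] unfolding N_def a_def by blast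
  define C where "C = side_past n d l"
  define L where "L = {v \<in> box n d. v l = 0}"
  have L: "finite L" "card L * n = n ^ d" using card_lines[OF l, of n] by (auto simp: L_def)
  define B where "B = card (A \<times> L)"
  obtain \<beta> where "bij_betw \<beta> {0..<B} (A \<times> L)"
    using ex_bij_betw_nat_finite[of "A \<times> L"] A L by (auto simp: B_def)
  then have \<beta>: "bij_betw \<beta> {..<B} (A \<times> L)" by (simp add: atLeast0LessThan)
  \<comment> \<open>Position \<open>x\<close> lies in block \<open>(x mod P) div n\<close>, up to period; \<open>wd x\<close> and \<open>st x\<close> are the word and the
    site that it stands for.\<close>
  define P where "P = B * n"
  have PN: "P = N * n ^ d" using L(2) by (simp add: P_def B_def N_def card_cartesian_product mult.assoc)
  then have P: "P \<ge> 1" using N n by simp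
  define M where "M = (M0 + 1) * P"
  have M: "M \<ge> M0" "M \<ge> 1" using P mult_le_mono2[of 1 P "M0 + 1"] by (auto simp: M_def)
  define wd where "wd x = fst (\<beta> ((x mod P) div n))" for x
  define st where "st x = step l (snd (\<beta> ((x mod P) div n))) ((x mod P) mod n)" for x
  define q where "q x = letter A (C (st x)) (st x) (wd x)" for x

  have \<beta>_mem: "\<beta> ((x mod P) div n) \<in> A \<times> L" for x
  proof -
    have "x mod P < B * n" using P by (simp add: P_def)
    then have "(x mod P) div n < B" by (simp add: less_mult_imp_div_less)
    then show ?thesis using \<beta> by (auto simp: bij_betw_def)
  qed
  have wd_in: "wd x \<in> A" for x using \<beta>_mem[of x] by (auto simp: wd_def)
  have base: "snd (\<beta> ((x mod P) div n)) \<in> L" for x using \<beta>_mem[of x] by (metis mem_Times_iff)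
  have st_l: "st x l = int ((x mod P) mod n)" for x
    using base[of x] by (simp add: st_def L_def step_def)

  have avg: "(\<Sum>x<M. G (wd x) (st x)) = (M0 + 1) * (\<Sum>w\<in>A. \<Sum>v\<in>box n d. G w v)" for G :: "_ \<Rightarrow> _ \<Rightarrow> real"
  proof -
    define g where "g b j = G (fst (\<beta> b)) (step l (snd (\<beta> b)) j)" for b j
    have "(\<Sum>x<M. G (wd x) (st x)) = (\<Sum>x<M. g ((x mod P) div n) ((x mod P) mod n))"
      by (simp add: g_def wd_def st_def)
    also have "\<dots> = (\<Sum>r<M0 + 1. \<Sum>x<P. g (x div n) (x mod n))"
      unfolding M_def by (rule sum_blocks[OF P, where f = "\<lambda>r x. g (x div n) (x mod n)"])
    also have "\<dots> = (M0 + 1) * (\<Sum>b<B. \<Sum>j<n. g b j)"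
      unfolding P_def sum_blocks[OF n, of g] by simp
    also have "(\<Sum>b<B. \<Sum>j<n. g b j) = (\<Sum>p\<in>A \<times> L. \<Sum>j<n. G (fst p) (step l (snd p) j))"
      unfolding g_def by (rule sum.reindex_bij_betw[OF \<beta>])
    also have "\<dots> = (\<Sum>w\<in>A. \<Sum>v\<in>L. \<Sum>j<n. G w (step l v j))"
      using sum.cartesian_product[of "\<lambda>w v. \<Sum>j<n. G w (step l v j)" L A] by (simp only: case_prod_unfold)
    also have "\<dots> = (\<Sum>w\<in>A. \<Sum>v\<in>box n d. G w v)"
      unfolding L_def by (intro sum.cong refl sum_box_lines[OF l, symmetric])
    finally show ?thesis .
  qed

  have MN: "real M = (M0 + 1) * (N * real n ^ d)"
    by (simp add: M_def PN distrib_right)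

  define Q where "Q w v = map_pmf (\<lambda>w'. axis_word k l (window n ?S w' v)) (pmf_of_set (agree A (C v) w))" for w v
  define T where "T = bind_pmf (pmf_of_set A) (\<lambda>w. map_pmf (axis_word k l) (empirical n d ?S w))"
  have Mset: "finite {..<M}" "{..<M} \<noteq> {}" using M by (auto simp: lessThan_empty_iff)
  have T: "T = bind_pmf (pmf_of_set {..<M}) (\<lambda>x. Q (wd x) (st x))"
  proof (rule pmf_eqI)
    fix y
    have "pmf (bind_pmf (pmf_of_set {..<M}) (\<lambda>x. Q (wd x) (st x))) y = (\<Sum>x<M. pmf (Q (wd x) (st x)) y) / M"
      by (simp add: pmf_bind_pmf_of_set[OF Mset])
    also have "\<dots> = (\<Sum>w\<in>A. \<Sum>v\<in>box n d. pmf (Q w v) y) / (N * real n ^ d)"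
      unfolding avg[of "\<lambda>w v. pmf (Q w v) y"] MN by (simp del: of_nat_add of_nat_Suc)
    also have "\<dots> = pmf T y"
      unfolding Q_def T_def N_def by (rule mixture_of_conditional_words[OF A(1) ne n l])
    finally show "pmf T y = pmf (bind_pmf (pmf_of_set {..<M}) (\<lambda>x. Q (wd x) (st x))) y" ..
  qed
  have "T \<in> enlarge {..<k} \<epsilon> \<Gamma>"
    unfolding T_def
  proof (rule enlarge_uniform_mixture[OF \<Gamma>(2) A(1) ne])
    fix w assume "w \<in> A"
    then have w: "empirical n d ?S w \<in> enlarge ?S \<epsilon> (axial_product k d \<Gamma>)"
      by (simp add: A_def admissible_def)
    show "map_pmf (axis_word k l) (empirical n d ?S w) \<in> enlarge {..<k} \<epsilon> \<Gamma>"
      unfolding enlarge_iff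
    proof (intro conjI allI impI)
      fix \<delta> assume "\<epsilon> < \<delta>"
      then obtain \<nu> where "\<nu> \<in> axial_product k d \<Gamma>" "tv_dist (empirical n d ?S w) \<nu> < \<delta>"
        using w by (auto simp: enlarge_iff)
      then show "\<exists>\<nu>\<in>\<Gamma>. tv_dist (map_pmf (axis_word k l) (empirical n d ?S w)) \<nu> < \<delta>"
        using l tv_dist_map_pmf_le[of "axis_word k l" "empirical n d ?S w" \<nu>]
        by (intro bexI[of _ "map_pmf (axis_word k l) \<nu>"]) (auto simp: axial_product_def)
    qed simp
  qed
  moreover have "seq_marginal M k q \<in> probs {..<k}"
    using Pi_pmf_in_probs[of "{..<k}"] by (fastforce simp: seq_marginal_def probs_def)
  moreover have "tv_dist (seq_marginal M k q) T \<le> \<theta> + k * a / (d * \<theta>) + k / n"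
  proof -
    define R where "R w v = Pi_pmf {..<k} undefined (\<lambda>t. letter A (C v) (step l v t) w)" for w v
    define fits where "fits v \<longleftrightarrow> v l + int k \<le> int n" for v :: site
    define \<delta> where "\<delta> w v = (if fits v then tv_dist (Q w v) (R w v) else 1)" for w v
    have "tv_dist (Pi_pmf {..<k} undefined (\<lambda>t. q ((x + t) mod M))) (Q (wd x) (st x)) \<le> \<delta> (wd x) (st x)" for x
    proof (cases "fits (st x)")
      case True
      have "q ((x + t) mod M) = letter A (C (st x)) (step l (st x) t) (wd x)" if t: "t < k" for t
      proof -
        define y where "y = x mod P"
        have j: "y mod n + t < n" using True t unfolding fits_def st_l y_def[symmetric] by linarith
        have "y < B * n" using P by (simp add: y_def P_def)
        have "(x + t) mod M mod P = (x + t) mod P" by (simp add: M_def mod_mod_cancel)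
        also have "\<dots> = (y + t) mod P" by (simp add: y_def mod_add_left_eq)
        also have "y + t < P"
        proof -
          have "y div n < B" using \<open>y < B * n\<close> by (simp add: less_mult_imp_div_less)
          have "y + t < Suc (y div n) * n"
            using j div_mult_mod_eq[of y n] unfolding mult_Suc by linarith
          also have "\<dots> \<le> B * n" using \<open>y div n < B\<close> by (intro mult_le_mono1) simp
          finally show ?thesis by (simp add: P_def)
        qed
        then have "(y + t) mod P = y + t" by simp
        finally have pos: "(x + t) mod M mod P = y + t" .
        have sp: "(z + b * n) div n = b" "(z + b * n) mod n = z" if "z < n" for z b
          using that n by (simp_all only: div_mult_self1 mod_mult_self1) simp_all
        have "y + t = (y mod n + t) + y div n * n" using div_mult_mod_eq[of y n] by linarith
        then have dm: "(y + t) div n = y div n" "(y + t) mod n = y mod n + t"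
          using sp[OF j, of "y div n"] by (simp_all only:)
        have "wd ((x + t) mod M) = wd x" by (simp add: wd_def pos dm y_def[symmetric])
        moreover have "st ((x + t) mod M) = step l (st x) t"
          by (simp add: st_def pos dm y_def[symmetric]) (simp add: step_def add.assoc)
        ultimately show ?thesis by (simp add: q_def C_def side_past_step)
      qed
      then have "Pi_pmf {..<k} undefined (\<lambda>t. q ((x + t) mod M)) = R (wd x) (st x)"
        unfolding R_def by (intro Pi_pmf_cong) auto
      then show ?thesis using True by (simp add: \<delta>_def tv_dist_commute)
    next
      case False
      then show ?thesis by (simp add: \<delta>_def tv_dist_le_1)
    qed
    then have "tv_dist (seq_marginal M k q) T \<le> (\<Sum>x<M. \<delta> (wd x) (st x)) / M"
      unfolding T seq_marginal_def
      by (intro order_trans[OF tv_dist_bind_pmf_of_set_le[OF Mset]])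
        (simp add: divide_right_mono sum_mono)
    also have "\<dots> = (\<Sum>w\<in>A. \<Sum>v\<in>box n d. \<delta> w v) / (N * real n ^ d)"
      unfolding avg[of \<delta>] MN by (simp del: of_nat_add of_nat_Suc)
    also have "(\<Sum>w\<in>A. \<Sum>v\<in>box n d. \<delta> w v)
        = (\<Sum>v\<in>{v\<in>box n d. fits v}. \<Sum>w\<in>A. tv_dist (Q w v) (R w v)) + real (card {v\<in>box n d. \<not> fits v}) * N"
    proof -
      have "(\<Sum>w\<in>A. \<Sum>v\<in>box n d. \<delta> w v) = (\<Sum>v\<in>box n d. if fits v then (\<Sum>w\<in>A. tv_dist (Q w v) (R w v)) else N)"
        by (subst sum.swap) (auto simp: \<delta>_def N_def intro!: sum.cong)
      also have "\<dots> = (\<Sum>v\<in>{v\<in>box n d. fits v}. \<Sum>w\<in>A. tv_dist (Q w v) (R w v)) + real (card {v\<in>box n d. \<not> fits v}) * N"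
        by (simp add: sum.If_cases Int_def Collect_neg_eq[symmetric])
      finally show ?thesis .
    qed
    also have "(\<Sum>v\<in>{v\<in>box n d. fits v}. \<Sum>w\<in>A. tv_dist (Q w v) (R w v))
        \<le> \<theta> * (N * real n ^ d) + k * (N * real n ^ d * a / d) / \<theta>"
    proof -
      let ?loss = "\<lambda>v. \<Sum>t<k. hcond A (C v) (step l v t) - hcond A (C v \<union> step l v ` {..<t}) (step l v t)"
      have "(\<Sum>v\<in>{v\<in>box n d. fits v}. \<Sum>w\<in>A. tv_dist (Q w v) (R w v))
          \<le> (\<Sum>v\<in>{v\<in>box n d. fits v}. \<theta> * N + ?loss v / \<theta>)"
      proof (rule sum_mono)
        fix v assume v: "v \<in> {v\<in>box n d. fits v}"
        have "axis_word k l (window n ?S w' v) = restrict (\<lambda>t. w' (step l v t)) {..<k}" for w' :: "site \<Rightarrow> 'a"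
          unfolding axis_word_window[OF segment_subset_axial_shape[OF l]]
          using v l by (intro restrict_ext arg_cong[where f = w'] torus_add_eq_step) (auto simp: fits_def)
        then have "Q w v = map_pmf (\<lambda>w'. restrict (\<lambda>t. w' (step l v t)) {..<k}) (pmf_of_set (agree A (C v) w))" for w
          by (simp add: Q_def)
        then show "(\<Sum>w\<in>A. tv_dist (Q w v) (R w v)) \<le> \<theta> * N + ?loss v / \<theta>"
          unfolding R_def N_def
          using sum_tv_dist_path_le[OF A(1) \<theta>, where u = "step l v" and k = k and C = "C v"] by simp
      qed
      also have "\<dots> = \<theta> * N * real (card {v\<in>box n d. fits v}) + (\<Sum>v\<in>{v\<in>box n d. fits v}. ?loss v) / \<theta>"
        by (simp add: sum.distrib sum_divide_distrib)
      also have "\<dots> \<le> \<theta> * N * real (n ^ d) + k * (N * real n ^ d * a / d) / \<theta>"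
      proof (intro add_mono mult_left_mono divide_right_mono)
        have "card {v\<in>box n d. fits v} \<le> card (box n d)" by (intro card_mono) auto
        then show "real (card {v\<in>box n d. fits v}) \<le> real (n ^ d)" by (simp only: card_box of_nat_le_iff)
        have "(\<Sum>v\<in>{v\<in>box n d. fits v}. ?loss v)
            \<le> k * (\<Sum>v\<in>box n d. hcond A (side_past n d l v) v - hcond A (past n d (Suc l) v) v)"
          unfolding fits_def C_def by (rule sum_hcond_path_le[OF A(1) l])
        also have "\<dots> \<le> k * (N * real n ^ d * a / d)" using small by (intro mult_left_mono) auto
        finally show "(\<Sum>v\<in>{v\<in>box n d. fits v}. ?loss v) \<le> k * (N * real n ^ d * a / d)" .
      qed (use \<theta> in auto)
      finally show ?thesis by (simp add: mult.assoc)
    qed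
    also have "real (card {v\<in>box n d. \<not> fits v}) * N \<le> k / n * (N * real n ^ d)"
    proof -
      have "card {v\<in>box n d. \<not> fits v} * n \<le> k * n ^ d"
        unfolding fits_def by (rule card_truncated[OF l k(2)])
      then have "real (card {v\<in>box n d. \<not> fits v}) * n \<le> k * real n ^ d"
        by (metis of_nat_le_iff of_nat_mult of_nat_power)
      then have "real (card {v\<in>box n d. \<not> fits v}) \<le> k / n * real n ^ d"
        using n by (simp add: field_simps)
      then have "real (card {v\<in>box n d. \<not> fits v}) * N \<le> k / n * real n ^ d * N"
        by (intro mult_right_mono) auto
      then show ?thesis by (simp add: mult_ac)
    qed
    finally have "tv_dist (seq_marginal M k q) T
        \<le> (\<theta> * (N * real n ^ d) + k * (N * real n ^ d * a / d) / \<theta> + k / n * (N * real n ^ d)) / (N * real n ^ d)"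
      using N n by (simp add: divide_right_mono)
    also have "\<dots> = \<theta> + k * a / (d * \<theta>) + k / n"
    proof -
      have "(\<theta> * V + k * (V * a / d) / \<theta> + k / n * V) / V = \<theta> + k * a / (d * \<theta>) + k / n" if "V > 0" for V :: real
        using that by (simp add: add_divide_distrib)
      moreover have "N * real n ^ d > 0" using N n by simp
      ultimately show ?thesis .
    qed
    finally show ?thesis .
  qed
  ultimately have "seq_marginal M k q \<in> enlarge {..<k} (\<epsilon> + (\<theta> + k * a / (d * \<theta>) + k / n)) \<Gamma>"
    by (rule enlarge_step)
  moreover have "log 2 N / real n ^ d * M \<le> (\<Sum>x<M. entropy_pmf (q x))"
  proof -
    have "(\<Sum>x<M. entropy_pmf (q x)) = (M0 + 1) * (\<Sum>v\<in>box n d. hcond A (C v) v)"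
      unfolding q_def avg[of "\<lambda>w v. entropy_pmf (letter A (C v) v w)"] hcond_eq_sum_entropy[OF A(1)]
      by (subst sum.swap) (rule refl)
    moreover have "(M0 + 1) * (N * log 2 N) \<le> (M0 + 1) * (\<Sum>v\<in>box n d. hcond A (C v) v)"
      using big by (intro mult_left_mono) (auto simp: C_def)
    moreover have "log 2 N / real n ^ d * M = (M0 + 1) * (N * log 2 N)"
      unfolding MN using n by simp
    ultimately show ?thesis by linarith
  qed
  ultimately show "\<exists>M\<ge>M0. \<exists>q. seq_marginal M k q
      \<in> enlarge {..<k} (\<epsilon> + (\<theta> + k * log 2 CARD('a) / (d * \<theta>) + k / n)) \<Gamma>
      \<and> log 2 (card A) / real n ^ d * M \<le> (\<Sum>x<M. entropy_pmf (q x))"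
    using M unfolding a_def N_def by blast
qed


section \<open>Limits\<close>

lemma log2_card_mono:
  assumes "finite B" "A \<subseteq> B"
  shows "log2_card A \<le> log2_card B"
  using assms card_mono[OF assms] by (auto simp: log2_card_def card_gt_0_iff intro!: log_mono)

lemma capacity_eq_INF:
  fixes \<Gamma> :: "(site \<Rightarrow> 'a::finite) pmf set"
  shows "capacity d S \<Gamma> = (INF \<epsilon>\<in>{0<..}.
    limsup (\<lambda>n. log2_card (admissible n d S (enlarge S \<epsilon> \<Gamma>)) / ereal (real n ^ d)))"
  unfolding capacity_def
proof (rule Lim_at_right_eq_INF)
  fix x y :: real assume "x \<le> y"
  then have sub: "admissible n d S (enlarge S x \<Gamma>) \<subseteq> admissible n d S (enlarge S y \<Gamma>)" for n
    using enlarge_mono[of x y S \<Gamma>] by (auto simp: admissible_def)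
  show "limsup (\<lambda>n. log2_card (admissible n d S (enlarge S x \<Gamma>)) / ereal (real n ^ d))
      \<le> limsup (\<lambda>n. log2_card (admissible n d S (enlarge S y \<Gamma>)) / ereal (real n ^ d))"
    by (rule Limsup_mono, rule eventually_mono[OF eventually_gt_at_top[of 0]])
      (auto intro!: ereal_divide_right_mono log2_card_mono sub)
qed

lemma h_ind_hat_mono:
  assumes "\<Gamma> \<subseteq> \<Delta>"
  shows "h_ind_hat d S \<Gamma> \<le> h_ind_hat d S \<Delta>"
  unfolding h_ind_hat_def
proof (rule Limsup_mono, rule always_eventually, rule allI)
  fix n
  have "product_measures n d S \<Gamma> \<subseteq> product_measures n d S \<Delta>"
    using assms by (auto simp: product_measures_def)
  then show "(SUP \<mu>\<in>product_measures n d S \<Gamma>. ereal (entropy_pmf \<mu> / real n ^ d))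
      \<le> (SUP \<mu>\<in>product_measures n d S \<Delta>. ereal (entropy_pmf \<mu> / real n ^ d))"
    by (rule SUP_subset_mono) simp
qed

lemma h_ind_eq_INF: "h_ind d S \<Gamma> = (INF \<epsilon>\<in>{0<..}. h_ind_hat d S (enlarge S \<epsilon> \<Gamma>))"
  unfolding h_ind_def
  by (rule Lim_at_right_eq_INF) (intro h_ind_hat_mono enlarge_mono)

lemma h_ind_le_capacity:
  fixes \<Gamma> :: "(nat \<Rightarrow> 'a::finite) pmf set"
  assumes "k \<ge> 1" "d \<ge> 1" "\<Gamma> \<subseteq> probs {..<k}"
  shows "h_ind 1 (segment k 0) (line_system k \<Gamma>) \<le> capacity d (axial_shape k d) (axial_product k d \<Gamma>)"
  unfolding capacity_eq_INF
proof (rule INF_greatest)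
  fix \<epsilon> :: real assume "\<epsilon> \<in> {0<..}"
  then have \<epsilon>: "\<epsilon> > 0" by simp
  show "h_ind 1 (segment k 0) (line_system k \<Gamma>) \<le> limsup (\<lambda>n. log2_card (admissible n d (axial_shape k d)
      (enlarge (axial_shape k d) \<epsilon> (axial_product k d \<Gamma>))) / ereal (real n ^ d))" (is "?h \<le> ?f")
  proof (rule ccontr)
    assume "\<not> ?h \<le> ?f"
    then have "?f < ?h" by simp
    then obtain c where c: "?f < ereal c" "ereal c < ?h" using ereal_dense2 by auto
    have "?h \<le> h_ind_hat 1 (segment k 0) (enlarge (segment k 0) (\<epsilon> / (4 * real d)) (line_system k \<Gamma>))"
      unfolding h_ind_eq_INF using \<epsilon> assms(2) by (intro INF_lower) auto
    then have "ereal c < h_ind_hat 1 (segment k 0) (enlarge (segment k 0) (\<epsilon> / (4 * real d)) (line_system k \<Gamma>))"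
      using c(2) by (rule less_le_trans[rotated])
    then have "ereal c \<le> ?f" by (rule limsup_admissible_ge[OF assms \<epsilon>])
    then show False using c(1) by simp
  qed
qed

text \<open>A quarter of \<open>\<epsilon>\<close> each goes to the enlargement, to the parameter of Pinsker's inequality, to the dependence
  left on a line and to the truncated windows; the third one determines how large \<open>d\<close> must be.\<close>

lemma capacity_le_h_ind_hat:
  fixes \<Gamma> :: "(nat \<Rightarrow> 'a::finite) pmf set" and \<epsilon> :: real
  assumes k: "k \<ge> 1" and d: "d \<ge> 1" and \<Gamma>: "\<Gamma> \<subseteq> probs {..<k}" "convex_pmfs \<Gamma>" and \<epsilon>: "\<epsilon> > 0"
    and large: "real d * \<epsilon>\<^sup>2 \<ge> 16 * real k * log 2 CARD('a)"
  shows "capacity d (axial_shape k d) (axial_product k d \<Gamma>)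
       \<le> h_ind_hat 1 (segment k 0) (enlarge (segment k 0) \<epsilon> (line_system k \<Gamma>))" (is "_ \<le> ?h")
proof -
  let ?A = "\<lambda>n. admissible n d (axial_shape k d) (enlarge (axial_shape k d) (\<epsilon> / 4) (axial_product k d \<Gamma>))"
  have "log2_card (?A n) / ereal (real n ^ d) \<le> ?h" if n: "n \<ge> k" "real n \<ge> 4 * k / \<epsilon>" for n
  proof (cases "?A n = {}")
    case True
    then show ?thesis using n(1) k by (simp add: log2_card_def)
  next
    case False
    then have "card (?A n) > 0" by (simp add: card_gt_0_iff)
    then have "log2_card (?A n) / ereal (real n ^ d) = ereal (log 2 (card (?A n)) / real n ^ d)"
      using n(1) k False by (simp add: log2_card_def)
    also have "\<dots> \<le> h_ind_hat 1 (segment k 0) (enlarge (segment k 0)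
        (\<epsilon> / 4 + (\<epsilon> / 4 + k * log 2 CARD('a) / (d * (\<epsilon> / 4)) + k / n)) (line_system k \<Gamma>))"
      using \<epsilon> by (intro entropy_of_admissible_le k n d \<Gamma> False) auto
    also have "\<dots> \<le> ?h"
    proof (intro h_ind_hat_mono enlarge_mono)
      have "k * log 2 CARD('a) / (d * (\<epsilon> / 4)) \<le> \<epsilon> / 4"
        using large \<epsilon> d by (simp add: field_simps power2_eq_square)
      moreover have "k / n \<le> \<epsilon> / 4" using n k \<epsilon> by (simp add: field_simps)
      ultimately show "\<epsilon> / 4 + (\<epsilon> / 4 + k * log 2 CARD('a) / (d * (\<epsilon> / 4)) + k / n) \<le> \<epsilon>"
        by linarith
    qed
    finally show ?thesis .
  qed
  moreover have "\<forall>\<^sub>F n in sequentially. n \<ge> k \<and> real n \<ge> 4 * k / \<epsilon>"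
    using eventually_ge_at_top[of "max k (nat \<lceil>4 * k / \<epsilon>\<rceil>)"]
    by eventually_elim linarith
  ultimately have "limsup (\<lambda>n. log2_card (?A n) / ereal (real n ^ d)) \<le> ?h"
    by (intro Limsup_bounded) (auto elim: eventually_mono)
  moreover have "capacity d (axial_shape k d) (axial_product k d \<Gamma>)
      \<le> limsup (\<lambda>n. log2_card (?A n) / ereal (real n ^ d))"
    unfolding capacity_eq_INF using \<epsilon> by (intro INF_lower) simp
  ultimately show ?thesis by simp
qed

theorem theorem34:
  fixes k :: nat and \<Gamma> :: "(nat \<Rightarrow> 'a::finite) pmf set"
  assumes "k \<ge> 1"
    and "\<Gamma> \<subseteq> probs {..<k}"
    and "convex_pmfs \<Gamma>"
  shows "limsup (\<lambda>d. capacity d (axial_shape k d) (axial_product k d \<Gamma>))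
       = h_ind 1 (segment k 0) (line_system k \<Gamma>)"
proof (rule antisym)
  show "limsup (\<lambda>d. capacity d (axial_shape k d) (axial_product k d \<Gamma>))
      \<le> h_ind 1 (segment k 0) (line_system k \<Gamma>)"
    unfolding h_ind_eq_INF
  proof (rule INF_greatest)
    fix \<epsilon> :: real assume "\<epsilon> \<in> {0<..}"
    then have \<epsilon>: "\<epsilon> > 0" by simp
    show "limsup (\<lambda>d. capacity d (axial_shape k d) (axial_product k d \<Gamma>))
        \<le> h_ind_hat 1 (segment k 0) (enlarge (segment k 0) \<epsilon> (line_system k \<Gamma>))"
    proof (rule Limsup_bounded)
      let ?c = "16 * real k * log 2 CARD('a) / \<epsilon>\<^sup>2"
      show "\<forall>\<^sub>F d in sequentially. capacity d (axial_shape k d) (axial_product k d \<Gamma>)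
          \<le> h_ind_hat 1 (segment k 0) (enlarge (segment k 0) \<epsilon> (line_system k \<Gamma>))"
        using eventually_ge_at_top[of "max 1 (nat \<lceil>?c\<rceil>)"]
      proof eventually_elim
        case (elim d)
        then have d: "d \<ge> 1" "real d \<ge> ?c" by linarith+
        have "real d * \<epsilon>\<^sup>2 \<ge> 16 * real k * log 2 CARD('a)"
          using d(2) \<epsilon> by (simp add: pos_divide_le_eq)
        then show ?case by (rule capacity_le_h_ind_hat[OF assms(1) d(1) assms(2,3) \<epsilon>])
      qed
    qed
  qed
  show "h_ind 1 (segment k 0) (line_system k \<Gamma>)
      \<le> limsup (\<lambda>d. capacity d (axial_shape k d) (axial_product k d \<Gamma>))"
  proof (rule le_limsup_of_frequently)
    fix n0
    show "\<exists>d\<ge>n0. h_ind 1 (segment k 0) (line_system k \<Gamma>)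
        \<le> capacity d (axial_shape k d) (axial_product k d \<Gamma>)"
      using assms by (intro exI[of _ "n0 + 1"] conjI h_ind_le_capacity) auto
  qed
qed

end
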